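(* Let $1<p_0<\infty$ and let $u$ be a positive Lipschitz $p_0$-harmonic function in a domain $\Omega\subset\mathbb{R}^n$. Let $x_0\in\partial\Omega$ and assume that $u$ vanishes continuously on $\partial\Omega\cap B_\rho(x_0)$ for some $\rho>0$. (a) If there exists a ball $B_r(y)\subset\Omega$ such that $x_0\in\partial B_r(y)$, then, in the ball $B_r(y)$, $$u(x)=\alpha\langle x-x_0,\nu\rangle^+ +o(|x-x_0|)\quad\text{as } x\to x_0,\ x\in B_r(y),$$ for some $\alpha>0$, with $\nu=\frac{y-x_0}{|y-x_0|}$. (b) If there exists a ball $B_r(y)\subset\Omega^c$ such that $x_0\in\partial B_r(y)$, then $$u(x)=\beta\langle x-x_0,\nu\rangle^+ +o(|x-x_0|)\quad\text{as } x\to x_0,\ x\in\Omega,$$ for some $\beta\ge0$, with $\nu=\frac{x_0-y}{|x_0-y|}$. In addition, if $\beta>0$, then $B_r(y)$ is tangent to $\partial\Omega$ at $x_0$.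
   Context: $B_r(y)$ is the open ball of radius $r$ centered at $y$; $t^+=\max\{t,0\}$. $u$ is $p_0$-harmonic in $\Omega$ if $\Delta_{p_0}u=\mathrm{div}(|\nabla u|^{p_0-2}\nabla u)=0$ in $\Omega$ in the weak sense (equivalently, in the viscosity sense): $\int_\Omega|\nabla u|^{p_0-2}\nabla u\cdot\nabla\varphi\,dx=0$ for every $\varphi\in C_0^\infty(\Omega)$ (which makes sense since $u$ is Lipschitz). "$u$ vanishes continuously on $\partial\Omega\cap B_\rho(x_0)$" means that $u$ extended by $0$ to $\partial\Omega\cap B_\rho(x_0)$ is continuous there. "$B_r(y)$ is tangent to $\partial\Omega$ at $x_0$" means that the tangent hyperplane $\{\langle x-x_0,\nu\rangle=0\}$ to $\partial B_r(y)$ at $x_0$ is tangent to $\partial\Omega$ at $x_0$, i.e. $\langle x-x_0,\nu\rangle=o(|x-x_0|)$ as $x\to x_0$, $x\in\partial\Omega$. *)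

theory Defs
  imports "HOL-Analysis.Analysis" "HOL-Library.Landau_Symbols"
begin

definition grad :: "('a::euclidean_space \<Rightarrow> real) \<Rightarrow> 'a \<Rightarrow> 'a" where
  "grad f x = (\<Sum>b\<in>Basis. frechet_derivative f (at x) b *\<^sub>R b)"

primrec Ck :: "nat \<Rightarrow> ('a::euclidean_space \<Rightarrow> real) \<Rightarrow> bool" where
  "Ck 0 f \<longleftrightarrow> continuous_on UNIV f"
| "Ck (Suc k) f \<longleftrightarrow> f differentiable_on UNIV \<and>
     (\<forall>b\<in>Basis. Ck k (\<lambda>x. frechet_derivative f (at x) b))"

(* The class of smooth functions with compact support in S. Its members are extended by zero,
   so smoothness on the whole space is the same as smoothness on the open set S. *)
definition test_function :: "'a::euclidean_space set \<Rightarrow> ('a \<Rightarrow> real) \<Rightarrow> bool" where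
  "test_function S \<phi> \<longleftrightarrow> (\<forall>k. Ck k \<phi>) \<and>
     compact (closure {x. \<phi> x \<noteq> 0}) \<and> closure {x. \<phi> x \<noteq> 0} \<subseteq> S"

definition locally_integrable ::
    "'a::euclidean_space set \<Rightarrow> ('a \<Rightarrow> 'b::euclidean_space) \<Rightarrow> bool" where
  "locally_integrable S f \<longleftrightarrow> (\<forall>K. compact K \<and> K \<subseteq> S \<longrightarrow> f absolutely_integrable_on K)"

(* The distributional gradient; for Lipschitz u it agrees almost everywhere with grad u. *)
definition weak_gradient ::
    "'a::euclidean_space set \<Rightarrow> ('a \<Rightarrow> real) \<Rightarrow> ('a \<Rightarrow> 'a) \<Rightarrow> bool" where
  "weak_gradient S u G \<longleftrightarrow> locally_integrable S u \<and> locally_integrable S G \<and>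
     (\<forall>\<phi>. test_function S \<phi> \<longrightarrow>
        (LINT x:S|lebesgue. u x *\<^sub>R grad \<phi> x) = - (LINT x:S|lebesgue. \<phi> x *\<^sub>R G x))"

(* Weak solutions, in the local Sobolev space of exponent p, of div (|Du|^(p-2) Du) = 0.
   The requirement on norm G powr p makes the integrand below integrable; it holds
   automatically for Lipschitz u. Where G vanishes, the flux is 0 also for p < 2. *)
definition p_harmonic_on ::
    "real \<Rightarrow> 'a::euclidean_space set \<Rightarrow> ('a \<Rightarrow> real) \<Rightarrow> bool" where
  "p_harmonic_on p S u \<longleftrightarrow>
     (\<exists>G. weak_gradient S u G \<and> locally_integrable S (\<lambda>x. norm (G x) powr p) \<and>
        (\<forall>\<phi>. test_function S \<phi> \<longrightarrow>
           (LINT x:S|lebesgue. (norm (G x) powr (p - 2) *\<^sub>R G x) \<bullet> grad \<phi> x) = 0))"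

definition vanishes_continuously ::
    "'a::euclidean_space set \<Rightarrow> 'a set \<Rightarrow> ('a \<Rightarrow> real) \<Rightarrow> bool" where
  "vanishes_continuously S F u \<longleftrightarrow>
     (\<forall>z\<in>F. continuous (at z within S \<union> F) (\<lambda>x. if x \<in> S then u x else 0))"

(* The hyperplane through x0 orthogonal to \<nu> is tangent to F at x0. *)
definition tangent_hyperplane_at ::
    "'a::euclidean_space set \<Rightarrow> 'a \<Rightarrow> 'a \<Rightarrow> bool" where
  "tangent_hyperplane_at F x0 \<nu> \<longleftrightarrow>
     (\<lambda>x. (x - x0) \<bullet> \<nu>) \<in> o[at x0 within F](\<lambda>x. norm (x - x0))"

end

theory Submission
  imports Defs
begin

text \<open>Let \<open>f\<close> be \<open>u\<close> extended by zero in part (a), and its negative in part (b), and let \<open>\<alpha>\<close> be the supremum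
  of the slopes \<open>m\<close> such that \<open>f x \<ge> m \<langle>x - x\<^sub>0, \<nu>\<rangle> - K |x - x\<^sub>0|\<^sup>2\<close> near \<open>x\<^sub>0\<close> in the half-space
  \<open>\<langle>x - x\<^sub>0, \<nu>\<rangle> \<ge> 0\<close>, for some \<open>K\<close>. Then \<open>f x \<ge> \<alpha> \<langle>x - x\<^sub>0, \<nu>\<rangle> - o(|x - x\<^sub>0|)\<close> by definition. If this were not
  sharp at points \<open>z\<close> arbitrarily close to \<open>x\<^sub>0\<close>, compare \<open>f\<close> with a linear function plus
  \<open>A (exp (- g q(x - z)) - exp (- g \<tau>\<^sup>2))\<close>, where \<open>q\<close> is a quadratic form chosen such that the ellipsoid
  \<open>q(x - z) < \<tau>\<^sup>2\<close> touches the hyperplane at \<open>x\<^sub>0\<close>. On this ellipsoid \<open>|x - x\<^sub>0|\<^sup>2\<close> is controlled by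
  \<open>\<langle>x - x\<^sub>0, \<nu>\<rangle>\<close>, so that the quadratic error only lowers the slope slightly, whereas the barrier raises it
  by a fixed amount, contradicting the choice of \<open>\<alpha>\<close>. Positivity of \<open>\<alpha>\<close> in (a) is the same argument with a ball and
  slope \<open>0\<close>.

  Comparison of a weak solution \<open>v\<close> with a smooth strict subsolution \<open>w\<close> is obtained by testing with a smooth
  version of \<open>(w - v)\<^sup>+\<close>, in which \<open>v\<close> is replaced by mollifications \<open>v\<^sub>n\<close>. Since only the factor
  \<open>\<nabla>w - \<nabla>v\<^sub>n\<close> depends on \<open>\<nabla>v\<^sub>n\<close>, and linearly, weak convergence of the bounded gradients \<open>\<nabla>v\<^sub>n\<close>
  suffices, and the strict inequality contradicts the monotonicity of the flux.\<close>

subsection \<open>Functions of class C^k\<close>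

text \<open>Ellipsoids are forced by the position of the bad point: a ball touching the hyperplane
  at x0 has its centre on the normal, while the bad point may lie almost in the hyperplane. A shear
  carries such a centre onto the normal, and lifting the point by a small multiple of its distance t
  to x0 keeps the eccentricity bounded in terms of the excess. With lengths measured in units of t,
  the slope gained is fixed before the trial slope m < \<alpha>, its constant K and finally t are
  chosen, so the loss can be made smaller than the gain.

  The flux is differentiated only where the gradient of the comparison function is nonzero. So the
  linear part has to dominate the barrier, which requires \<alpha> \<noteq> 0. In (a) a positive
  slope is established beforehand; in (b) the change of sign gives \<alpha> \<le> 0, and for
  \<alpha> = 0 the missing bound is just f \<le> 0. The sign also settles the case of an ellipsoid
  leaving the domain in (b): for \<alpha> < 0 the comparison function is nonpositive there, while f
  = 0. In (a) small ellipsoids stay inside the interior ball.\<close>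

abbreviation smooth :: "('a::euclidean_space \<Rightarrow> real) \<Rightarrow> bool" where
  "smooth f \<equiv> \<forall>k. Ck k f"

lemma Ck_SucI:
  assumes "\<And>x. (f has_derivative f' x) (at x)" "\<And>b. b \<in> Basis \<Longrightarrow> Ck k (\<lambda>x. f' x b)"
  shows "Ck (Suc k) f"
proof -
  have "frechet_derivative f (at x) = f' x" for x
    using frechet_derivative_at[OF assms(1)] by simp
  moreover have "f differentiable_on UNIV"
    unfolding differentiable_on_def differentiable_def using assms(1) by auto
  ultimately show ?thesis using assms(2) by simp
qed

lemma Ck_Suc_has_derivative:
  assumes "Ck (Suc k) f"
  shows "(f has_derivative frechet_derivative f (at x)) (at x)"
  using assms frechet_derivative_works[of f "at x"] by (simp add: differentiable_on_def)

lemma Ck_Suc_imp_Ck: "Ck (Suc k) f \<Longrightarrow> Ck k f"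
proof (induction k arbitrary: f)
  case 0
  then show ?case by (simp add: differentiable_imp_continuous_on)
next
  case (Suc k)
  have "Ck k (\<lambda>x. frechet_derivative f (at x) b)" if "b \<in> Basis" for b
    using Suc.IH[of "\<lambda>x. frechet_derivative f (at x) b"] Suc.prems that by simp
  then show ?case using Suc.prems by simp
qed

lemma Ck_const: "Ck k (\<lambda>x. c)"
proof (induction k arbitrary: c)
  case (Suc k)
  show ?case by (rule Ck_SucI[where f' = "\<lambda>x h. 0"]) (auto intro: Suc)
qed simp

lemma Ck_inner: "Ck k (\<lambda>x. x \<bullet> a)"
proof (cases k)
  case (Suc j)
  show ?thesis unfolding Suc
    by (rule Ck_SucI[where f' = "\<lambda>x h. h \<bullet> a"]) (auto intro: Ck_const intro!: derivative_eq_intros)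
qed (auto intro!: continuous_intros)

lemma Ck_add: "Ck k f \<Longrightarrow> Ck k g \<Longrightarrow> Ck k (\<lambda>x. f x + g x)"
proof (induction k arbitrary: f g)
  case (Suc k)
  show ?case
    by (rule Ck_SucI[OF has_derivative_add[OF Ck_Suc_has_derivative[OF Suc.prems(1)]
          Ck_Suc_has_derivative[OF Suc.prems(2)]]], rule Suc.IH)
       (use Suc.prems in simp_all)
qed (auto intro: continuous_intros)

lemma Ck_mult: "Ck k f \<Longrightarrow> Ck k g \<Longrightarrow> Ck k (\<lambda>x. f x * g x)"
proof (induction k arbitrary: f g)
  case (Suc k)
  note D = Ck_Suc_has_derivative[OF Suc.prems(1)] Ck_Suc_has_derivative[OF Suc.prems(2)]
  note C = Suc.prems[THEN Ck_Suc_imp_Ck]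
  show ?case
  proof (rule Ck_SucI[OF has_derivative_mult[OF D]])
    fix b :: 'a assume "b \<in> Basis"
    then have "Ck k (\<lambda>x. frechet_derivative f (at x) b)" "Ck k (\<lambda>x. frechet_derivative g (at x) b)"
      using Suc.prems by simp_all
    then show "Ck k (\<lambda>x. f x * frechet_derivative g (at x) b + frechet_derivative f (at x) b * g x)"
      using C by (intro Ck_add Suc.IH)
  qed
qed (auto intro: continuous_intros)

lemma Ck_cmult: "Ck k f \<Longrightarrow> Ck k (\<lambda>x. c * f x)"
  using Ck_mult[OF Ck_const] by blast

lemma Ck_diff: "Ck k f \<Longrightarrow> Ck k g \<Longrightarrow> Ck k (\<lambda>x. f x - g x)"
  using Ck_add[OF _ Ck_cmult[of k g "-1"], of f] by simp

lemma Ck_sum: "(\<And>i. i \<in> I \<Longrightarrow> Ck k (f i)) \<Longrightarrow> Ck k (\<lambda>x. \<Sum>i\<in>I. f i x)"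
proof (induction I rule: infinite_finite_induct)
  case (insert i I)
  then show ?case using Ck_add[of k "f i" "\<lambda>x. \<Sum>i\<in>I. f i x"] by simp
qed (auto intro: Ck_const)

text \<open>The outer function is given as a sequence of successive derivatives: the chain rule only
  raises the index in \<open>G j (f x)\<close> and adds a factor from \<open>f\<close>, so the
  induction never leaves the family.\<close>

lemma Ck_compose:
  assumes "\<And>j t. (G j has_real_derivative G (Suc j) t) (at t)" and "Ck k f"
  shows "Ck k (\<lambda>x. G j (f x))"
  using assms(2)
proof (induction k arbitrary: f j)
  case 0
  have "continuous_on UNIV (G j)"
    using assms(1) DERIV_isCont continuous_at_imp_continuous_on by blast
  from continuous_on_compose2[OF this] 0 show ?case by simp
next
  case (Suc k)
  have D: "((\<lambda>x. G j (f x)) has_derivative (\<lambda>h. G (Suc j) (f x) * frechet_derivative f (at x) h)) (at x)" for x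
    using has_derivative_compose[OF Ck_Suc_has_derivative[OF Suc.prems] assms(1)[of j "f x", unfolded has_field_derivative_def]] .
  show ?case
    by (rule Ck_SucI[OF D], rule Ck_mult[OF Suc.IH[OF Ck_Suc_imp_Ck[OF Suc.prems]]])
       (use Suc.prems in simp)
qed

lemma Ck_exp: "Ck k f \<Longrightarrow> Ck k (\<lambda>x. exp (f x))"
  using Ck_compose[of "\<lambda>j t. exp t" k f 0] by (simp add: DERIV_exp)

text \<open>On \<open>D\<close> the glued function is \<open>f\<close>, off \<open>K\<close> it is
  0, and these two open sets cover the space. This cuts off test functions whose formula vanishes
  near the boundary of \<open>D\<close> from inside but is uncontrolled beyond it.\<close>

lemma Ck_restrict:
  assumes "open D" "closed K" "K \<subseteq> D" and "\<And>x. x \<in> D - K \<Longrightarrow> f x = 0" and "Ck k f"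
  shows "Ck k (\<lambda>x. if x \<in> D then f x else 0)"
  using assms(4,5)
proof (induction k arbitrary: f)
  case 0
  have "continuous (at x) (\<lambda>x. if x \<in> D then f x else 0)" for x
  proof (cases "x \<in> D")
    case True
    have "continuous (at x) f" using 0 by (simp add: continuous_on_eq_continuous_at)
    moreover have "\<forall>\<^sub>F y in nhds x. (if y \<in> D then f y else 0) = f y"
      using True \<open>open D\<close> by (auto simp: eventually_nhds)
    ultimately show ?thesis by (simp add: isCont_cong)
  next
    case False
    then have "\<forall>\<^sub>F y in nhds x. (if y \<in> D then f y else 0) = (\<lambda>_. 0) y"
      using 0(1) \<open>K \<subseteq> D\<close> \<open>closed K\<close> unfolding eventually_nhds
      by (intro exI[of _ "- K"]) auto
    then show ?thesis using isCont_cong[of _ "\<lambda>_. 0"] by simp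
  qed
  then show ?case by (simp add: continuous_on_eq_continuous_at)
next
  case (Suc k)
  note Df = Ck_Suc_has_derivative[OF Suc.prems(2)]
  have D0: "frechet_derivative f (at x) b = 0" if "x \<in> D - K" for x b
  proof -
    have "(f has_derivative (\<lambda>_. 0)) (at x)"
    proof (rule has_derivative_transform_within_open[where s = "D - K" and f = "\<lambda>_. 0"])
      show "open (D - K)" using assms by blast
    qed (use Suc.prems that in auto)
    then show ?thesis using frechet_derivative_at[of f "\<lambda>_. 0"] by metis
  qed
  have "((\<lambda>x. if x \<in> D then f x else 0) has_derivative
      (\<lambda>h. if x \<in> D then frechet_derivative f (at x) h else 0)) (at x)" for x
  proof (cases "x \<in> D")
    case True
    show ?thesis using True
      by (auto intro!: has_derivative_transform_within_open[OF Df \<open>open D\<close>])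
  next
    case False
    have "((\<lambda>x. if x \<in> D then f x else 0) has_derivative (\<lambda>_. 0)) (at x)"
    proof (rule has_derivative_transform_within_open[where s = "- K" and f = "\<lambda>_. 0"])
      show "open (- K)" using assms by blast
    qed (use Suc.prems False \<open>K \<subseteq> D\<close> in auto)
    then show ?thesis using False by simp
  qed
  then show ?case
    by (rule Ck_SucI, intro Suc.IH) (use Suc.prems D0 in simp_all)
qed

subsection \<open>A smooth function vanishing on a half-line\<close>

text \<open>With s = 1/t one has ds/dt = -s^2, so the derivative of p(s) exp(-s) is s^2 (p - p')(s)
  exp(-s). These are the polynomial factors in the successive derivatives of exp(-1/t).\<close>

primrec bump_poly :: "nat \<Rightarrow> real poly" where
  "bump_poly 0 = 1"
| "bump_poly (Suc j) = [:0, 0, 1:] * (bump_poly j - pderiv (bump_poly j))"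

definition bump :: "nat \<Rightarrow> real \<Rightarrow> real" where
  "bump j t = (if 0 < t then poly (bump_poly j) (1 / t) * exp (- 1 / t) else 0)"

lemma poly_exp_decay: "((\<lambda>x. poly p x * exp (- x)) \<longlongrightarrow> (0::real)) at_top"
proof -
  have "((\<lambda>x. \<Sum>i\<le>degree p. coeff p i * (x ^ i / exp x)) \<longlongrightarrow> (\<Sum>i\<le>degree p. coeff p i * 0)) at_top"
    by (intro tendsto_intros tendsto_power_div_exp_0)
  then show ?thesis
    by (simp add: poly_altdef exp_minus divide_inverse sum_distrib_right mult.assoc)
qed

lemma bump_DERIV: "(bump j has_real_derivative bump (Suc j) t) (at t)"
proof (cases t "0::real" rule: linorder_cases)
  case less
  have "(bump j has_real_derivative 0) (at t)"
    by (rule has_field_derivative_transform_within[where d = "- t" and f = "\<lambda>_. 0"])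
       (use less in \<open>auto simp: bump_def dist_real_def\<close>)
  then show ?thesis using less by (simp add: bump_def)
next
  case equal
  \<comment> \<open>The difference quotient at 0 contributes one more factor 1/h, which
    \<open>pCons 0\<close> absorbs; exponential decay in the variable 1/h then applies.\<close>
  have "((\<lambda>h. poly (pCons 0 (bump_poly j)) h * exp (- h)) \<longlongrightarrow> (0::real)) at_top"
    by (rule poly_exp_decay)
  then have "((\<lambda>h. poly (pCons 0 (bump_poly j)) (inverse h) * exp (- inverse h)) \<longlongrightarrow> (0::real)) (at_right 0)"
    by (rule filterlim_compose) (rule filterlim_inverse_at_top_right)
  then have "((\<lambda>h. bump j h / h) \<longlongrightarrow> 0) (at_right 0)"
    by (rule Lim_transform_eventually)
       (auto simp: bump_def eventually_at_filter divide_inverse)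
  moreover have "((\<lambda>h. bump j h / h) \<longlongrightarrow> 0) (at_left 0)"
    by (rule Lim_transform_eventually[OF tendsto_const])
       (auto simp: bump_def eventually_at_filter)
  ultimately have "((\<lambda>h. bump j h / h) \<longlongrightarrow> 0) (at 0)"
    by (simp add: filterlim_split_at)
  then show ?thesis using equal by (simp add: bump_def DERIV_def)
next
  case greater
  let ?p = "bump_poly j"
  have "((\<lambda>t. poly ?p (1 / t) * exp (- 1 / t)) has_real_derivative
     (poly (pderiv ?p) (1 / t) * (- 1 / t ^ 2) * exp (- 1 / t) + poly ?p (1 / t) * (exp (- 1 / t) * (1 / t ^ 2)))) (at t)"
    using greater
    by (auto intro!: derivative_eq_intros DERIV_chain2[OF poly_DERIV] simp: power2_eq_square divide_simps)
  also have "(poly (pderiv ?p) (1 / t) * (- 1 / t ^ 2) * exp (- 1 / t) + poly ?p (1 / t) * (exp (- 1 / t) * (1 / t ^ 2)))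
     = bump (Suc j) t"
    using greater by (simp add: bump_def field_simps power2_eq_square)
  finally show ?thesis
    by (rule has_field_derivative_transform_within[where d = t]) (use greater in \<open>auto simp: bump_def dist_real_def\<close>)
qed

lemma bump_0: "bump 0 t = (if 0 < t then exp (- 1 / t) else 0)"
  by (simp add: bump_def)

lemma bump_1_nonneg: "0 \<le> bump (Suc 0) t"
  by (simp add: bump_def pderiv_1)

lemma continuous_on_bump [continuous_intros]:
  "continuous_on S f \<Longrightarrow> continuous_on S (\<lambda>x. bump j (f x))"
  using continuous_on_compose2[of UNIV "bump j" S f] bump_DERIV DERIV_isCont
    continuous_at_imp_continuous_on by blast

lemma Ck_bump: "Ck k f \<Longrightarrow> Ck k (\<lambda>x. bump j (f x))"
  by (rule Ck_compose[where G = bump, OF bump_DERIV])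

section \<open>Integrals of derivatives of compactly supported functions\<close>

lemma integrable_continuous_bounded_support:
  fixes f :: "'a::euclidean_space \<Rightarrow> real"
  assumes "continuous_on UNIV f" "bounded K" "\<And>x. x \<notin> K \<Longrightarrow> f x = 0"
  shows "integrable lborel f"
proof -
  obtain R where "K \<subseteq> cball 0 R" using bounded_subset_ballD[OF \<open>bounded K\<close>, of 0] ball_subset_cball by blast
  then have "(\<lambda>x. indicator (cball 0 R) x *\<^sub>R f x) = f"
    by (intro ext) (use assms(3) in \<open>fastforce simp: indicator_def subset_iff\<close>)
  then show ?thesis
    using borel_integrable_compact[of "cball 0 R" f] assms(1) continuous_on_subset by auto
qed

lemma lborel_integral_translate:
  fixes f :: "'a::euclidean_space \<Rightarrow> real"
  assumes "f \<in> borel_measurable borel"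
  shows "(LINT y|lborel. f (c + y)) = (LINT y|lborel. f y)"
  using integral_distr[of "(+) c" lborel borel f] assms by (simp add: lborel_distr_plus)

text \<open>By translation invariance the difference quotients in direction \<open>b\<close> have
  integral 0. The mean value theorem bounds them by \<open>B\<close> on a fixed ball, so dominated
  convergence passes to the derivative.\<close>

lemma integral_partial_derivative_eq_0:
  fixes f :: "'a::euclidean_space \<Rightarrow> real"
  assumes D: "\<And>x. (f has_derivative f' x) (at x)" and "bounded K"
    and supp: "\<And>x. x \<notin> K \<Longrightarrow> f x = 0" and bound: "\<And>x. \<bar>f' x b\<bar> \<le> B"
  shows "(LINT x|lborel. f' x b) = 0"
proof -
  have cont: "continuous_on UNIV f"
    using D has_derivative_continuous_on[of UNIV f f'] by auto
  then have [measurable]: "f \<in> borel_measurable borel" by (rule borel_measurable_continuous_onI)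
  obtain R where R: "K \<subseteq> cball 0 R" using bounded_subset_ballD[OF \<open>bounded K\<close>, of 0] ball_subset_cball by blast
  define q where "q n x = (f (x + (1 / Suc n) *\<^sub>R b) - f x) * Suc n" for n x
  have line: "((\<lambda>s. f (x + s *\<^sub>R b)) has_real_derivative f' (x + s *\<^sub>R b) b) (at s)" for x s
  proof -
    have "((\<lambda>s. f (x + s *\<^sub>R b)) has_derivative (\<lambda>h. f' (x + s *\<^sub>R b) (h *\<^sub>R b))) (at s)"
      by (rule has_derivative_compose[OF _ D]) (auto intro!: derivative_eq_intros)
    moreover have "f' (x + s *\<^sub>R b) (h *\<^sub>R b) = f' (x + s *\<^sub>R b) b * h" for h
      using linear_cmul[OF has_derivative_linear[OF D]] by simp
    ultimately show ?thesis by (simp add: has_field_derivative_def)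
  qed
  have qlim: "(\<lambda>n. q n x) \<longlonglongrightarrow> f' x b" for x
  proof -
    have "((\<lambda>h. (f (x + h *\<^sub>R b) - f x) / h) \<longlongrightarrow> f' x b) (at 0)"
      using line[of x 0] by (simp add: DERIV_def)
    moreover have "filterlim (\<lambda>n. 1 / real (Suc n)) (at 0) sequentially"
      using LIMSEQ_inverse_real_of_nat by (simp add: filterlim_at inverse_eq_divide)
    ultimately have "(\<lambda>n. (f (x + (1 / real (Suc n)) *\<^sub>R b) - f x) / (1 / real (Suc n))) \<longlonglongrightarrow> f' x b"
      by (rule filterlim_compose)
    then show ?thesis by (simp add: q_def)
  qed
  \<comment> \<open>Outside the ball of radius \<open>R + norm b\<close> both x and its translate
    avoid \<open>K\<close>, since the translation has length at most \<open>norm b\<close>.\<close>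
  have qbound: "\<bar>q n x\<bar> \<le> B * indicator (cball 0 (R + norm b)) x" for n x
  proof (cases "x \<in> cball 0 (R + norm b)")
    case True
    obtain s where "f (x + (1 / Suc n) *\<^sub>R b) - f (x + 0 *\<^sub>R b) = (1 / Suc n - 0) * f' (x + s *\<^sub>R b) b"
      using MVT2[of 0 "1 / Suc n" "\<lambda>s. f (x + s *\<^sub>R b)" "\<lambda>s. f' (x + s *\<^sub>R b) b"] line by auto
    then have "q n x = f' (x + s *\<^sub>R b) b" by (simp add: q_def)
    then show ?thesis using True bound by simp
  next
    case False
    have "norm ((1 / Suc n) *\<^sub>R b) \<le> norm b" by (simp add: divide_simps mult_le_cancel_left1)
    moreover have "norm x > R + norm b" using False by simp
    ultimately have "norm (x + (1 / Suc n) *\<^sub>R b) > R" "norm x > R"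
      using norm_triangle_ineq4[of "x + (1 / Suc n) *\<^sub>R b" "(1 / Suc n) *\<^sub>R b"] norm_ge_zero[of b]
      by (simp_all del: norm_ge_zero)
    then have "f (x + (1 / Suc n) *\<^sub>R b) = 0" "f x = 0"
      using R supp by (metis mem_cball_0 not_le subset_iff)+
    then show ?thesis using False by (simp add: q_def)
  qed
  have "(\<lambda>n. LINT x|lborel. q n x) \<longlonglongrightarrow> (LINT x|lborel. f' x b)"
  proof (rule integral_dominated_convergence)
    show "integrable lborel (\<lambda>x::'a. B * indicator (cball 0 (R + norm b)) x)"
      using emeasure_bounded_finite[of "cball (0::'a) (R + norm b)"]
      by (intro integrable_mult_right integrable_real_indicator) auto
    show "q n \<in> borel_measurable lborel" for n unfolding q_def[abs_def] by measurable
    have "(\<lambda>x. f' x b) \<in> borel_measurable borel"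
      by (rule borel_measurable_LIMSEQ_real[OF qlim]) (unfold q_def[abs_def], measurable)
    then show "(\<lambda>x. f' x b) \<in> borel_measurable lborel" by simp
  qed (use qlim qbound in auto)
  moreover have "(LINT x|lborel. q n x) = 0" for n
  proof -
    have i: "integrable lborel f"
      by (rule integrable_continuous_bounded_support[OF cont \<open>bounded K\<close> supp])
    have i2: "integrable lborel (\<lambda>x. f ((1 / Suc n) *\<^sub>R b + x))"
    proof (rule integrable_continuous_bounded_support)
      show "continuous_on UNIV (\<lambda>x. f ((1 / Suc n) *\<^sub>R b + x))"
        by (rule continuous_on_compose2[OF cont]) (auto intro!: continuous_intros)
      show "bounded ((\<lambda>x. x - (1 / Suc n) *\<^sub>R b) ` K)"
        using \<open>bounded K\<close> bounded_translation_minus by blast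
      show "f ((1 / Suc n) *\<^sub>R b + x) = 0" if "x \<notin> (\<lambda>x. x - (1 / Suc n) *\<^sub>R b) ` K" for x
      proof (rule supp)
        show "(1 / Suc n) *\<^sub>R b + x \<notin> K"
          using that by (metis add_diff_cancel_left' image_eqI)
      qed
    qed
    have "q n x = (f ((1 / Suc n) *\<^sub>R b + x) - f x) * Suc n" for x
      by (simp add: q_def add.commute)
    then show ?thesis
      using i i2 lborel_integral_translate[of f "(1 / Suc n) *\<^sub>R b"] by simp
  qed
  ultimately show ?thesis by (simp add: LIMSEQ_const_iff)
qed

section \<open>Convolution and mollification\<close>

lemma linear_eq_sum_Basis:
  fixes f :: "'a::euclidean_space \<Rightarrow> real"
  assumes "linear f"
  shows "f h = (\<Sum>b\<in>Basis. (h \<bullet> b) * f b)"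
proof -
  have "f h = f (\<Sum>b\<in>Basis. (h \<bullet> b) *\<^sub>R b)" by (simp add: euclidean_representation)
  then show ?thesis using assms by (simp add: linear_sum linear_cmul)
qed

lemma sum_inner_Basis:
  fixes c :: "'a::euclidean_space \<Rightarrow> real"
  assumes "b \<in> Basis"
  shows "(\<Sum>b'\<in>Basis. (b \<bullet> b') * c b') = c b"
proof -
  have "(\<Sum>b'\<in>Basis. (b \<bullet> b') * c b') = (\<Sum>b'\<in>Basis. if b' = b then c b' else 0)"
    using assms by (intro sum.cong) (auto simp: inner_Basis)
  then show ?thesis using assms by simp
qed

lemma smooth_frechet_derivative:
  assumes "smooth f" "b \<in> Basis"
  shows "smooth (\<lambda>x. frechet_derivative f (at x) b)"
proof
  fix k
  have "Ck (Suc k) f" using assms by blast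
  then show "Ck k (\<lambda>x. frechet_derivative f (at x) b)" using assms(2) by simp
qed

text \<open>Differentiation under the integral sign puts every derivative on the kernel.
  \<open>leibniz_rule\<close> takes the derivative as a bounded linear map, hence the detour through
  \<open>blinfun_inner_left\<close> and the evaluation of the integral at h. The induction passes
  from the kernel to its partial derivatives, so \<open>D\<close> is stated for all smooth
  kernels.\<close>

lemma Ck_convolution:
  fixes f \<psi> :: "'a::euclidean_space \<Rightarrow> real"
  assumes f: "continuous_on UNIV f" and "smooth \<psi>"
  shows "Ck k (\<lambda>x. integral (cbox a c) (\<lambda>y. f y * \<psi> (x - y)))"
proof -
  have D: "((\<lambda>x. integral (cbox a c) (\<lambda>y. f y * \<psi> (x - y))) has_derivative
     (\<lambda>h. \<Sum>b\<in>Basis. (h \<bullet> b) * integral (cbox a c) (\<lambda>y. f y * frechet_derivative \<psi> (at (x - y)) b))) (at x)"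
    if \<psi>: "smooth \<psi>" for \<psi> x
  proof -
    have Ck: "Ck (Suc 0) \<psi>" using \<psi> by blast
    note D\<psi> = Ck_Suc_has_derivative[OF Ck]
    have cont\<psi>: "continuous_on UNIV \<psi>" using \<psi> Ck.simps(1) by blast
    have cont': "continuous_on UNIV (\<lambda>x. frechet_derivative \<psi> (at x) b)" if "b \<in> Basis" for b
      using Ck that by simp
    let ?g = "\<lambda>x y. \<Sum>b\<in>Basis. (f y * frechet_derivative \<psi> (at (x - y)) b) *\<^sub>R blinfun_inner_left b"
    have "((\<lambda>x. integral (cbox a c) (\<lambda>y. f y * \<psi> (x - y))) has_derivative integral (cbox a c) (?g x))
      (at x within UNIV)"
    proof (rule leibniz_rule)
      fix x t :: 'a
      have "((\<lambda>x. f t * \<psi> (x - t)) has_derivative (\<lambda>h. f t * frechet_derivative \<psi> (at (x - t)) h)) (at x)"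
        using has_derivative_mult_right[OF has_derivative_compose[OF
            has_derivative_diff[OF has_derivative_ident has_derivative_const] D\<psi>]] by simp
      moreover have "(\<lambda>h. f t * frechet_derivative \<psi> (at (x - t)) h) = blinfun_apply (?g x t)"
      proof
        fix h
        have "frechet_derivative \<psi> (at (x - t)) h = (\<Sum>b\<in>Basis. (h \<bullet> b) * frechet_derivative \<psi> (at (x - t)) b)"
          by (rule linear_eq_sum_Basis[OF has_derivative_linear[OF D\<psi>]])
        then show "f t * frechet_derivative \<psi> (at (x - t)) h = blinfun_apply (?g x t) h"
          by (simp add: blinfun.sum_left blinfun.scaleR_left sum_distrib_left mult_ac)
      qed
      ultimately show "((\<lambda>x. f t * \<psi> (x - t)) has_derivative blinfun_apply (?g x t)) (at x within UNIV)"
        by (simp only:)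
    next
      fix x :: 'a
      show "(\<lambda>y. f y * \<psi> (x - y)) integrable_on cbox a c"
        by (intro integrable_continuous continuous_intros continuous_on_subset[OF f]
            continuous_on_compose2[OF cont\<psi>]) auto
    next
      show "continuous_on (UNIV \<times> cbox a c) (\<lambda>(x, t). ?g x t)"
        unfolding split_beta
        by (intro continuous_intros continuous_on_compose2[OF f] continuous_on_compose2[OF cont']) auto
    qed auto
    moreover have "blinfun_apply (integral (cbox a c) (?g x)) =
        (\<lambda>h. \<Sum>b\<in>Basis. (h \<bullet> b) * integral (cbox a c) (\<lambda>y. f y * frechet_derivative \<psi> (at (x - y)) b))"
    proof
      fix h
      have I: "(\<lambda>y. f y * frechet_derivative \<psi> (at (x - y)) b) integrable_on cbox a c" if "b \<in> Basis" for b
        using that by (intro integrable_continuous continuous_intros continuous_on_subset[OF f]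
            continuous_on_compose2[OF cont']) auto
      have "?g x integrable_on cbox a c"
        using I by (intro integrable_sum) (auto intro: integrable_on_scaleR_left)
      then have "blinfun_apply (integral (cbox a c) (?g x)) h = integral (cbox a c) (\<lambda>y. blinfun_apply (?g x y) h)"
        by (rule blinfun_apply_integral)
      also have "\<dots> = integral (cbox a c) (\<lambda>y. \<Sum>b\<in>Basis. (h \<bullet> b) * (f y * frechet_derivative \<psi> (at (x - y)) b))"
        by (simp add: blinfun.sum_left blinfun.scaleR_left mult_ac)
      also have "\<dots> = (\<Sum>b\<in>Basis. integral (cbox a c) (\<lambda>y. (h \<bullet> b) * (f y * frechet_derivative \<psi> (at (x - y)) b)))"
        by (rule integral_sum) (auto intro: I integrable_on_mult_right)
      finally show "blinfun_apply (integral (cbox a c) (?g x)) h =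
        (\<Sum>b\<in>Basis. (h \<bullet> b) * integral (cbox a c) (\<lambda>y. f y * frechet_derivative \<psi> (at (x - y)) b))"
        by simp
    qed
    ultimately show ?thesis by (simp only:)
  qed
  \<comment> \<open>Starting at \<open>Suc k\<close> lets \<open>D\<close> serve every level: it
    yields differentiability, and in the base case also continuity of the partial
    derivatives.\<close>
  have "Ck (Suc k) (\<lambda>x. integral (cbox a c) (\<lambda>y. f y * \<psi> (x - y)))" using \<open>smooth \<psi>\<close>
  proof (induction k arbitrary: \<psi>)
    case 0
    have cont: "continuous_on UNIV (\<lambda>x. integral (cbox a c) (\<lambda>y. f y * \<phi> (x - y)))" if "smooth \<phi>" for \<phi>
      using has_derivative_continuous_on[OF has_derivative_at_withinI[OF D[OF that]]] by blast
    from cont[OF smooth_frechet_derivative[OF 0]] show ?case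
      by (intro Ck_SucI[OF D[OF 0]]) (simp add: sum_inner_Basis)
  next
    case (Suc k)
    note IH = Suc.IH[OF smooth_frechet_derivative[OF Suc.prems]]
    show ?case
    proof (rule Ck_SucI[OF D[OF Suc.prems]])
      fix b :: 'a assume "b \<in> Basis"
      from IH[OF this] this
      show "Ck (Suc k) (\<lambda>x. \<Sum>b'\<in>Basis. (b \<bullet> b') * integral (cbox a c) (\<lambda>y. f y * frechet_derivative \<psi> (at (x - y)) b'))"
        by (simp only: sum_inner_Basis)
    qed
  qed
  then show ?thesis by (rule Ck_Suc_imp_Ck)
qed

text \<open>The bump of \<epsilon>^2 - |y|^2 is divided by its integral, which is nonzero because
  the function is continuous, nonnegative and positive at 0. Evenness serves to rewrite a
  convolution as an average of \<open>f (x + y)\<close>.\<close>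

lemma mollifier_exists:
  fixes \<epsilon> :: real
  assumes "0 < \<epsilon>"
  obtains \<eta> :: "'a::euclidean_space \<Rightarrow> real"
  where "smooth \<eta>" "\<And>y. 0 \<le> \<eta> y" "\<And>y. \<eta> (- y) = \<eta> y" "\<And>y. \<epsilon> \<le> norm y \<Longrightarrow> \<eta> y = 0"
    "(LINT y|lborel. \<eta> y) = 1"
proof -
  define h :: "'a \<Rightarrow> real" where "h y = bump 0 (\<epsilon>\<^sup>2 - (\<Sum>b\<in>Basis. (y \<bullet> b) * (y \<bullet> b)))" for y
  have h: "h y = bump 0 (\<epsilon>\<^sup>2 - (norm y)\<^sup>2)" for y
    unfolding h_def power2_norm_eq_inner by (simp add: euclidean_inner[symmetric])
  have sm: "smooth h"
    unfolding h_def[abs_def]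
    by (intro allI Ck_bump Ck_diff Ck_const Ck_sum Ck_mult Ck_inner)
  then have cont: "continuous_on UNIV h" using Ck.simps(1) by blast
  have nn: "0 \<le> h y" for y by (simp add: h bump_0)
  have supp: "h y = 0" if "\<epsilon> \<le> norm y" for y
  proof -
    have "\<epsilon>\<^sup>2 \<le> (norm y)\<^sup>2" using that \<open>0 < \<epsilon>\<close> by (intro power_mono) auto
    then show ?thesis by (simp add: h bump_0)
  qed
  obtain a where a: "ball (0::'a) (\<epsilon> + 1) \<subseteq> cbox (- a) a"
    using bounded_subset_cbox_symmetric[of "ball (0::'a) (\<epsilon> + 1)"] by auto
  define c where "c = (LINT y|lborel. h y)"
  have int: "integrable lborel h"
    by (rule integrable_continuous_bounded_support[OF cont bounded_ball[of 0 \<epsilon>]]) (auto intro: supp)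
  have "c \<noteq> 0"
  proof
    assume "c = 0"
    have "(h has_integral 0) UNIV"
      using has_integral_integral_lborel[OF int] \<open>c = 0\<close> c_def by simp
    moreover have "(\<lambda>x. if x \<in> cbox (- a) a then h x else 0) = h"
    proof (intro ext)
      fix x
      have "h x = 0" if "x \<notin> cbox (- a) a"
        using a that by (intro supp) (force simp: subset_iff not_less)
      then show "(if x \<in> cbox (- a) a then h x else 0) = h x" by simp
    qed
    ultimately have "(h has_integral 0) (cbox (- a) a)"
      by (metis has_integral_restrict_UNIV)
    moreover have "(0::'a) \<in> box (- a) a"
      using a interior_mono[OF a] \<open>0 < \<epsilon>\<close> by (auto simp: interior_cbox)
    ultimately have "h 0 = 0"
      using has_integral_0_cbox_imp_0[of "- a" a h 0] nn cont box_subset_cbox continuous_on_subset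
      by (metis empty_iff subset_UNIV subset_iff)
    then show False using \<open>0 < \<epsilon>\<close> by (simp add: h bump_0)
  qed
  moreover have "0 \<le> c" unfolding c_def using nn by simp
  ultimately have "0 < c" by simp
  show ?thesis
  proof
    show "smooth (\<lambda>y. (1 / c) * h y)" using sm Ck_cmult by blast
    show "(LINT y|lborel. (1 / c) * h y) = 1" using \<open>c \<noteq> 0\<close> c_def by simp
  qed (use nn \<open>0 < c\<close> supp in \<open>auto simp: h\<close>)
qed

text \<open>Mollification, localised to a ball so that no integrability of the function at infinity is needed.\<close>

lemma smooth_approximation:
  fixes f :: "'a::euclidean_space \<Rightarrow> real"
  assumes f: "continuous_on UNIV f" and "0 < \<epsilon>" "\<epsilon> \<le> 1"
  obtains g where "smooth g"
    "\<And>x v e. x \<in> ball 0 R \<Longrightarrow> (\<And>y. dist x y < \<epsilon> \<Longrightarrow> \<bar>f y - v\<bar> \<le> e) \<Longrightarrow> \<bar>g x - v\<bar> \<le> e"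
    "\<And>L x y. L-lipschitz_on UNIV f \<Longrightarrow> x \<in> ball 0 R \<Longrightarrow> y \<in> ball 0 R \<Longrightarrow> \<bar>g x - g y\<bar> \<le> L * dist x y"
proof -
  obtain \<eta> :: "'a \<Rightarrow> real" where \<eta>: "smooth \<eta>" "\<And>y. 0 \<le> \<eta> y" "\<And>y. \<eta> (- y) = \<eta> y"
    "\<And>y. \<epsilon> \<le> norm y \<Longrightarrow> \<eta> y = 0" "(LINT y|lborel. \<eta> y) = 1"
    using mollifier_exists[OF \<open>0 < \<epsilon>\<close>] by metis
  have cont\<eta>: "continuous_on UNIV \<eta>" using \<eta>(1) Ck.simps(1) by blast
  have int\<eta>: "integrable lborel (\<lambda>y. u y * \<eta> y)" if "continuous_on UNIV u" for u
    by (rule integrable_continuous_bounded_support[where K = "ball 0 \<epsilon>"])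
       (use that cont\<eta> \<eta>(4) in \<open>auto intro!: continuous_intros\<close>)
  have fx: "continuous_on UNIV (\<lambda>y. f (x + y))" for x
    by (rule continuous_on_compose2[OF f]) (auto intro!: continuous_intros)
  obtain a where a: "ball (0::'a) (R + 1) \<subseteq> cbox (- a) a"
    using bounded_subset_cbox_symmetric[of "ball (0::'a) (R + 1)"] by auto
  define g where "g x = integral (cbox (- a) a) (\<lambda>y. f y * \<eta> (x - y))" for x
  \<comment> \<open>For x in \<open>ball 0 R\<close> the kernel centred at x is supported in
    \<open>ball 0 (R + 1)\<close> because \<epsilon> \<le> 1, so the box may be replaced by the
    whole space.\<close>
  have g: "g x = (LINT y|lborel. f (x + y) * \<eta> y)" if "x \<in> ball 0 R" for x
  proof -
    let ?h = "\<lambda>y. f y * \<eta> (x - y)"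
    have supp: "?h y = 0" if "y \<notin> cbox (- a) a" for y
    proof -
      have "R + 1 \<le> norm y" using that a by (auto simp: subset_iff not_less)
      then have "\<epsilon> \<le> norm (x - y)"
        using \<open>x \<in> ball 0 R\<close> \<open>\<epsilon> \<le> 1\<close> norm_triangle_ineq2[of y x] by (simp add: norm_minus_commute)
      then show ?thesis using \<eta>(4) by simp
    qed
    have cont: "continuous_on UNIV ?h"
      by (intro continuous_intros f continuous_on_compose2[OF cont\<eta>]) auto
    have int: "integrable lborel ?h"
      by (rule integrable_continuous_bounded_support[OF cont bounded_cbox supp])
    have "g x = integral UNIV (\<lambda>y. if y \<in> cbox (- a) a then ?h y else 0)"
      unfolding g_def by (rule integral_restrict_UNIV[symmetric])
    also have "(\<lambda>y. if y \<in> cbox (- a) a then ?h y else 0) = ?h" using supp by auto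
    also have "integral UNIV ?h = (LINT y|lborel. ?h y)" by (rule integral_lborel[OF int])
    also have "\<dots> = (LINT y|lborel. ?h (x + y))"
      by (rule lborel_integral_translate[symmetric]) (rule borel_measurable_continuous_onI[OF cont])
    finally show ?thesis by (simp add: \<eta>(3))
  qed
  show ?thesis
  proof
    show "smooth g" unfolding g_def[abs_def] using Ck_convolution[OF f \<eta>(1)] by blast
  next
    \<comment> \<open>The free choice of \<open>v\<close> and \<open>e\<close> gives several
      estimates at once: v = f x an approximation error, v = 0 a bound on absolute values, and v = e
      = 0 vanishing away from the support of \<open>f\<close>.\<close>
    fix x v e assume x: "x \<in> ball 0 R" and le: "\<And>y. dist x y < \<epsilon> \<Longrightarrow> \<bar>f y - v\<bar> \<le> e"
    have "g x - v = (LINT y|lborel. f (x + y) * \<eta> y) - (LINT y|lborel. v * \<eta> y)"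
      using \<eta>(5) by (simp only: g[OF x] integral_mult_right_zero mult_1_right)
    also have "\<dots> = (LINT y|lborel. f (x + y) * \<eta> y - v * \<eta> y)"
      by (rule Bochner_Integration.integral_diff[symmetric]) (intro int\<eta> fx continuous_on_const)+
    also have "\<bar>\<dots>\<bar> \<le> (LINT y|lborel. e * \<eta> y)"
    proof (rule integral_abs_bound_integral)
      fix y
      show "\<bar>f (x + y) * \<eta> y - v * \<eta> y\<bar> \<le> e * \<eta> y"
      proof (cases "norm y < \<epsilon>")
        case True
        then have "\<bar>f (x + y) - v\<bar> \<le> e" by (intro le) (simp add: dist_norm)
        then show ?thesis using \<eta>(2)[of y] by (simp add: left_diff_distrib[symmetric] abs_mult mult_right_mono)
      qed (simp add: \<eta>(4))
    qed (intro int\<eta> fx continuous_on_const Bochner_Integration.integrable_diff)+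
    also have "\<dots> = e" using \<eta>(5) by (simp only: integral_mult_right_zero mult_1_right)
    finally show "\<bar>g x - v\<bar> \<le> e" .
  next
    fix L and x y :: 'a assume L: "L-lipschitz_on UNIV f" and xy: "x \<in> ball 0 R" "y \<in> ball 0 R"
    have "g x - g y = (LINT z|lborel. f (x + z) * \<eta> z - f (y + z) * \<eta> z)"
      unfolding g[OF xy(1)] g[OF xy(2)]
      by (rule Bochner_Integration.integral_diff[symmetric]) (intro int\<eta> fx continuous_on_const)+
    also have "\<bar>\<dots>\<bar> \<le> (LINT z|lborel. (L * dist x y) * \<eta> z)"
    proof (rule integral_abs_bound_integral)
      fix z
      have "\<bar>f (x + z) - f (y + z)\<bar> \<le> L * dist x y"
        using lipschitz_onD[OF L, of "x + z" "y + z"] by (simp add: dist_real_def)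
      then show "\<bar>f (x + z) * \<eta> z - f (y + z) * \<eta> z\<bar> \<le> (L * dist x y) * \<eta> z"
        using \<eta>(2)[of z] by (simp add: left_diff_distrib[symmetric] abs_mult mult_right_mono)
    qed (intro int\<eta> fx continuous_on_const Bochner_Integration.integrable_diff)+
    also have "\<dots> = L * dist x y" using \<eta>(5) by (simp only: integral_mult_right_zero mult_1_right)
    finally show "\<bar>g x - g y\<bar> \<le> L * dist x y" .
  qed
qed

subsection \<open>Integrals over compact sets\<close>

lemma finite_measure_compact:
  fixes K :: "'a::euclidean_space set"
  assumes "compact K"
  shows "finite_measure (lebesgue_on K)"
  using assms finite_measure_lebesgue_on lmeasurable_compact by blast

lemma compact_sets_lebesgue:
  fixes K :: "'a::euclidean_space set"
  shows "compact K \<Longrightarrow> K \<in> sets lebesgue"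
  using lmeasurable_compact fmeasurableD by blast

lemma measurable_continuous_compact:
  fixes f :: "'a::euclidean_space \<Rightarrow> 'b::euclidean_space"
  assumes "compact K" "continuous_on K f"
  shows "f \<in> borel_measurable (lebesgue_on K)"
  using continuous_imp_measurable_on_sets_lebesgue compact_sets_lebesgue assms by blast

lemma integrable_bounded_compact:
  fixes f :: "'a::euclidean_space \<Rightarrow> 'b::euclidean_space"
  assumes "compact K" "f \<in> borel_measurable (lebesgue_on K)" "\<And>x. x \<in> K \<Longrightarrow> norm (f x) \<le> B"
  shows "integrable (lebesgue_on K) f"
  using assms by (intro finite_measure.integrable_const_bound[OF finite_measure_compact, of _ _ B]) auto

lemma integrable_continuous_compact:
  fixes f :: "'a::euclidean_space \<Rightarrow> 'b::euclidean_space"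
  assumes "compact K" "continuous_on K f"
  shows "integrable (lebesgue_on K) f"
proof -
  have "bounded (f ` K)" using assms compact_continuous_image compact_imp_bounded by blast
  then obtain B where "\<And>x. x \<in> K \<Longrightarrow> norm (f x) \<le> B" by (auto simp: bounded_iff)
  then show ?thesis
    using integrable_bounded_compact[OF assms(1) measurable_continuous_compact[OF assms]] by blast
qed

lemma bounded_convergence_compact:
  fixes f :: "'a::euclidean_space \<Rightarrow> real"
  assumes "compact K" "\<And>n. s n \<in> borel_measurable (lebesgue_on K)"
    "f \<in> borel_measurable (lebesgue_on K)"
    "\<And>n x. x \<in> K \<Longrightarrow> \<bar>s n x\<bar> \<le> B" "AE x in lebesgue_on K. (\<lambda>n. s n x) \<longlonglongrightarrow> f x"
  shows "(\<lambda>n. \<integral>x. s n x \<partial>lebesgue_on K) \<longlonglongrightarrow> (\<integral>x. f x \<partial>lebesgue_on K)"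
proof (rule integral_dominated_convergence[where w = "\<lambda>_. B"])
  show "integrable (lebesgue_on K) (\<lambda>_. B)"
    using finite_measure.integrable_const[OF finite_measure_compact[OF assms(1)]] by blast
qed (use assms in auto)

lemma set_integral_eq_compact:
  fixes f :: "'a::euclidean_space \<Rightarrow> 'b::euclidean_space"
  assumes "compact K" "K \<subseteq> S" "\<And>x. x \<notin> K \<Longrightarrow> f x = 0"
  shows "(LINT x:S|lebesgue. f x) = (\<integral>x. f x \<partial>lebesgue_on K)"
proof -
  have "(\<lambda>x. indicator S x *\<^sub>R f x) = (\<lambda>x. indicator K x *\<^sub>R f x)"
    using assms(2,3) by (auto simp: indicator_def fun_eq_iff)
  then show ?thesis
    using compact_sets_lebesgue[OF assms(1)]
    by (simp add: set_lebesgue_integral_def integral_restrict_space)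
qed

lemma integrable_mult_continuous:
  fixes g :: "'a::euclidean_space \<Rightarrow> 'b::euclidean_space" and f :: "'a \<Rightarrow> real"
  assumes "compact K" "g absolutely_integrable_on K" "f \<in> borel_measurable (lebesgue_on K)"
    "\<And>x. x \<in> K \<Longrightarrow> \<bar>f x\<bar> \<le> B"
  shows "integrable (lebesgue_on K) (\<lambda>x. f x *\<^sub>R g x)"
proof -
  have "bilinear (\<lambda>(a::real) (v::'b). a *\<^sub>R v)"
    by (simp add: bilinear_conv_bounded_bilinear bounded_bilinear_scaleR)
  moreover have "bounded (f ` K)" using assms(4) by (auto simp: bounded_iff)
  ultimately show ?thesis
    using absolutely_integrable_bounded_measurable_product[of "\<lambda>a v. a *\<^sub>R v" f K g] assms
      absolutely_integrable_imp_integrable compact_sets_lebesgue by blast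
qed

subsection \<open>Integration by parts against test functions\<close>

lemma frechet_derivative_eq_0:
  assumes "closed K" "\<And>x. x \<notin> K \<Longrightarrow> \<phi> x = (0::real)" "x \<notin> K"
  shows "frechet_derivative \<phi> (at x) = (\<lambda>_. 0)"
proof -
  have "(\<phi> has_derivative (\<lambda>_. 0)) (at x)"
    by (rule has_derivative_transform_within_open[where s = "- K" and f = "\<lambda>_. 0"])
       (use assms in auto)
  then show ?thesis using frechet_derivative_at by metis
qed

lemma grad_inner_Basis: "b \<in> Basis \<Longrightarrow> grad f x \<bullet> b = frechet_derivative f (at x) b"
  unfolding grad_def
  using sum_inner_Basis[of b "\<lambda>b. frechet_derivative f (at x) b"]
  by (simp add: inner_sum_left inner_sum_right inner_commute mult.commute)

lemma smooth_continuous: "smooth f \<Longrightarrow> continuous_on S f"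
  using Ck.simps(1) continuous_on_subset by blast

lemma smooth_continuous_frechet:
  "smooth f \<Longrightarrow> b \<in> Basis \<Longrightarrow> continuous_on S (\<lambda>x. frechet_derivative f (at x) b)"
  using smooth_continuous smooth_frechet_derivative by blast

lemma smooth_has_derivative:
  "smooth f \<Longrightarrow> (f has_derivative frechet_derivative f (at x)) (at x)"
  using Ck_Suc_has_derivative by blast

lemma smooth_continuous_grad: "smooth f \<Longrightarrow> continuous_on S (grad f)"
  unfolding grad_def[abs_def] by (intro continuous_intros smooth_continuous_frechet)

lemma test_functionI:
  assumes "smooth \<phi>" "compact K" "K \<subseteq> S" "\<And>x. x \<notin> K \<Longrightarrow> \<phi> x = 0"
  shows "test_function S \<phi>"
proof -
  have "closure {x. \<phi> x \<noteq> 0} \<subseteq> K"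
    using assms by (intro closure_minimal compact_imp_closed) auto
  moreover have "bounded {x. \<phi> x \<noteq> 0}"
    using assms by (intro bounded_subset[OF compact_imp_bounded[OF assms(2)]]) auto
  ultimately show ?thesis using assms by (auto simp: test_function_def)
qed

lemma weak_gradient_component:
  fixes u :: "'a::euclidean_space \<Rightarrow> real"
  assumes W: "weak_gradient S u G" and \<phi>: "smooth \<phi>" "\<And>x. x \<notin> K \<Longrightarrow> \<phi> x = 0"
    and K: "compact K" "K \<subseteq> S" and b: "b \<in> Basis"
  shows "(\<integral>x. frechet_derivative \<phi> (at x) b * u x \<partial>lebesgue_on K) =
    - (\<integral>x. \<phi> x * (G x \<bullet> b) \<partial>lebesgue_on K)"
proof -
  have u: "u absolutely_integrable_on K" and G: "G absolutely_integrable_on K"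
    using W K by (auto simp: weak_gradient_def locally_integrable_def)
  have bnd: "\<exists>B. \<forall>x\<in>K. norm (f x) \<le> B" if "continuous_on K f" for f :: "'a \<Rightarrow> 'b::euclidean_space"
    using compact_continuous_image[OF that K(1)] compact_imp_bounded by (fastforce simp: bounded_iff)
  have D0: "frechet_derivative \<phi> (at x) = (\<lambda>_. 0)" if "x \<notin> K" for x
    using frechet_derivative_eq_0[OF compact_imp_closed[OF K(1)] \<phi>(2) that] .
  have grad0: "grad \<phi> x = 0" if "x \<notin> K" for x using D0[OF that] by (simp add: grad_def)
  have "bilinear (\<lambda>(v::'a) (a::real). a *\<^sub>R v)"
    using bounded_bilinear.flip[OF bounded_bilinear_scaleR]
    by (simp add: bilinear_conv_bounded_bilinear)
  moreover have "bounded (grad \<phi> ` K)"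
    using bnd[OF smooth_continuous_grad[OF \<phi>(1)]] by (auto simp: bounded_iff)
  moreover note measurable_continuous_compact[OF K(1) smooth_continuous_grad[OF \<phi>(1)]]
  ultimately have I1: "integrable (lebesgue_on K) (\<lambda>x. u x *\<^sub>R grad \<phi> x)"
    using absolutely_integrable_bounded_measurable_product[of "\<lambda>v a. a *\<^sub>R v" "grad \<phi>" K u] u
      absolutely_integrable_imp_integrable compact_sets_lebesgue[OF K(1)] by blast
  obtain B where "\<forall>x\<in>K. norm (\<phi> x) \<le> B" using bnd[OF smooth_continuous[OF \<phi>(1)]] by blast
  then have I2: "integrable (lebesgue_on K) (\<lambda>x. \<phi> x *\<^sub>R G x)"
    using integrable_mult_continuous[OF K(1) G measurable_continuous_compact[OF K(1) smooth_continuous[OF \<phi>(1)]], of B]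
    by auto
  have "(LINT x:S|lebesgue. u x *\<^sub>R grad \<phi> x) = - (LINT x:S|lebesgue. \<phi> x *\<^sub>R G x)"
    using W test_functionI[OF \<phi>(1) K \<phi>(2)] by (auto simp: weak_gradient_def)
  then have "(\<integral>x. u x *\<^sub>R grad \<phi> x \<partial>lebesgue_on K) = - (\<integral>x. \<phi> x *\<^sub>R G x \<partial>lebesgue_on K)"
    using set_integral_eq_compact[OF K, of "\<lambda>x. u x *\<^sub>R grad \<phi> x"] grad0
      set_integral_eq_compact[OF K, of "\<lambda>x. \<phi> x *\<^sub>R G x"] \<phi>(2) by simp
  then have "(\<integral>x. u x *\<^sub>R grad \<phi> x \<partial>lebesgue_on K) \<bullet> b = - ((\<integral>x. \<phi> x *\<^sub>R G x \<partial>lebesgue_on K) \<bullet> b)"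
    by simp
  then have "(\<integral>x. (u x *\<^sub>R grad \<phi> x) \<bullet> b \<partial>lebesgue_on K) = - (\<integral>x. (\<phi> x *\<^sub>R G x) \<bullet> b \<partial>lebesgue_on K)"
    using I1 I2 by (simp only: integral_inner_left)
  then show ?thesis by (simp add: grad_inner_Basis[OF b] mult.commute)
qed

text \<open>The product, extended by zero off \<open>D\<close>, is differentiable everywhere, and
  its derivative in direction \<open>b\<close> is bounded because it is continuous on
  \<open>K\<close> and 0 elsewhere. The local hypothesis on \<open>v\<close> is made for the
  components of the flux, which are differentiated only where the gradient of the comparison
  function is nonzero.\<close>

lemma integration_by_parts:
  fixes \<phi> v :: "'a::euclidean_space \<Rightarrow> real"
  assumes \<phi>: "smooth \<phi>" "\<And>x. x \<notin> K \<Longrightarrow> \<phi> x = 0" and K: "compact K" "K \<subseteq> D" "open D"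
    and v: "\<And>x. x \<in> D \<Longrightarrow> (v has_derivative v' x) (at x)"
      "continuous_on K (\<lambda>x. v' x b)" and b: "b \<in> Basis"
  shows "(\<integral>x. frechet_derivative \<phi> (at x) b * v x \<partial>lebesgue_on K) =
    - (\<integral>x. \<phi> x * v' x b \<partial>lebesgue_on K)"
proof -
  define f where "f x = (if x \<in> D then \<phi> x * v x else 0)" for x
  define f' where "f' x h = (if x \<in> D then \<phi> x * v' x h + frechet_derivative \<phi> (at x) h * v x else 0)" for x h
  have contv: "continuous_on K v"
    using has_derivative_continuous_on[OF has_derivative_at_withinI[OF v(1)]] K(2) continuous_on_subset by blast
  have cont: "continuous_on K (\<lambda>x. frechet_derivative \<phi> (at x) b * v x)" "continuous_on K (\<lambda>x. \<phi> x * v' x b)"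
    by (intro continuous_intros contv v(2) smooth_continuous_frechet smooth_continuous \<phi> b)+
  have D0: "frechet_derivative \<phi> (at x) = (\<lambda>_. 0)" if "x \<notin> K" for x
    using frechet_derivative_eq_0[OF compact_imp_closed[OF K(1)] \<phi>(2) that] .
  have f'0: "f' x b = 0" if "x \<notin> K" for x using D0[OF that] \<phi>(2)[OF that] by (simp add: f'_def)
  have f'K: "f' x b = frechet_derivative \<phi> (at x) b * v x + \<phi> x * v' x b" if "x \<in> K" for x
    using that K(2) by (auto simp: f'_def)
  have contf': "continuous_on K (\<lambda>x. f' x b)"
    using continuous_on_add[OF cont] by (rule continuous_on_eq) (simp add: f'K)
  then have "bounded ((\<lambda>x. f' x b) ` K)" using K(1) compact_continuous_image compact_imp_bounded by blast
  then obtain B where B: "\<And>x. x \<in> K \<Longrightarrow> \<bar>f' x b\<bar> \<le> B" by (auto simp: bounded_iff)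
  have "(LINT x|lborel. f' x b) = 0"
  proof (rule integral_partial_derivative_eq_0)
    show "(f has_derivative f' x) (at x)" for x
    proof (cases "x \<in> D")
      case True
      have "((\<lambda>x. \<phi> x * v x) has_derivative (\<lambda>h. \<phi> x * v' x h + frechet_derivative \<phi> (at x) h * v x)) (at x)"
        by (rule has_derivative_mult[OF smooth_has_derivative[OF \<phi>(1)] v(1)[OF True]])
      then have "(f has_derivative (\<lambda>h. \<phi> x * v' x h + frechet_derivative \<phi> (at x) h * v x)) (at x)"
        by (rule has_derivative_transform_within_open[OF _ K(3) True]) (simp add: f_def)
      then show ?thesis using True by (simp add: f'_def[abs_def])
    next
      case False
      have "(f has_derivative (\<lambda>_. 0)) (at x)"
        by (rule has_derivative_transform_within_open[where s = "- K" and f = "\<lambda>_. 0"])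
           (use K False \<phi>(2) compact_imp_closed in \<open>auto simp: f_def\<close>)
      then show ?thesis using False by (simp add: f'_def[abs_def])
    qed
    show "bounded K" using K(1) compact_imp_bounded by blast
    show "\<And>x. x \<notin> K \<Longrightarrow> f x = 0" using \<phi>(2) by (simp add: f_def)
    show "\<bar>f' x b\<bar> \<le> max B 0" for x using B[of x] f'0[of x] by (cases "x \<in> K") auto
  qed
  also have "(LINT x|lborel. f' x b) = (LINT x|lborel. indicator K x *\<^sub>R f' x b)"
    using f'0 by (intro Bochner_Integration.integral_cong) (auto simp: indicator_def)
  also have "\<dots> = (LINT x|lebesgue. indicator K x *\<^sub>R f' x b)"
    using borel_measurable_continuous_on_indicator[OF _ contf'] compact_imp_closed[OF K(1)]
    by (intro integral_completion[symmetric]) auto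
  also have "\<dots> = (\<integral>x. f' x b \<partial>lebesgue_on K)"
    using compact_sets_lebesgue[OF K(1)] by (simp add: integral_restrict_space)
  also have "\<dots> = (\<integral>x. frechet_derivative \<phi> (at x) b * v x + \<phi> x * v' x b \<partial>lebesgue_on K)"
    by (intro Bochner_Integration.integral_cong) (auto simp: f'K)
  also have "\<dots> = (\<integral>x. frechet_derivative \<phi> (at x) b * v x \<partial>lebesgue_on K) + (\<integral>x. \<phi> x * v' x b \<partial>lebesgue_on K)"
    by (intro Bochner_Integration.integral_add integrable_continuous_compact K cont)
  finally show ?thesis by simp
qed

subsection \<open>Weak convergence of gradients of smooth approximations\<close>

text \<open>McShane's extension: the infimum of the upward cones of slope \<open>L\<close> over the
  graph. It keeps the constant and makes mollification possible up to the boundary of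
  \<open>S\<close>.\<close>

lemma lipschitz_extension:
  fixes u :: "'a::metric_space \<Rightarrow> real"
  assumes "L-lipschitz_on S u" "S \<noteq> {}"
  obtains v where "L-lipschitz_on UNIV v" "\<And>x. x \<in> S \<Longrightarrow> v x = u x"
proof -
  have L: "0 \<le> L" using assms(1) lipschitz_on_nonneg by blast
  define v where "v x = (INF z\<in>S. u z + L * dist x z)" for x
  obtain z0 where z0: "z0 \<in> S" using assms(2) by blast
  have Lip: "\<bar>u a - u b\<bar> \<le> L * dist a b" if "a \<in> S" "b \<in> S" for a b
    using lipschitz_onD[OF assms(1) that] by (simp add: dist_real_def)
  have bdd: "bdd_below ((\<lambda>z. u z + L * dist x z) ` S)" for x
  proof (rule bdd_belowI2)
    fix z assume "z \<in> S"
    have "L * dist z z0 \<le> L * dist x z + L * dist x z0"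
      using mult_left_mono[OF dist_triangle[of z z0 x] L] by (simp add: dist_commute distrib_left)
    then show "u z0 - L * dist x z0 \<le> u z + L * dist x z"
      using Lip[OF \<open>z \<in> S\<close> z0] by simp
  qed
  show ?thesis
  proof
    have "v x \<le> v y + L * dist x y" for x y
    proof -
      have "v x - L * dist x y \<le> v y"
        unfolding v_def[of y]
      proof (rule cINF_greatest[OF assms(2)])
        fix z assume "z \<in> S"
        then have "v x \<le> u z + L * dist x z" unfolding v_def by (rule cINF_lower[OF bdd])
        moreover have "L * dist x z \<le> L * dist x y + L * dist y z"
          using mult_left_mono[OF dist_triangle[of x z y] L] by (simp add: distrib_left)
        ultimately show "v x - L * dist x y \<le> u z + L * dist y z" by simp
      qed
      then show ?thesis by simp
    qed
    then have "\<bar>v x - v y\<bar> \<le> L * dist x y" for x y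
      by (smt (verit) dist_commute)
    then show "L-lipschitz_on UNIV v" using L by (intro lipschitz_onI) (auto simp: dist_real_def)
    show "v x = u x" if "x \<in> S" for x
    proof (rule antisym)
      show "v x \<le> u x" unfolding v_def using cINF_lower[OF bdd that, of x] by simp
      show "u x \<le> v x" unfolding v_def
        by (rule cINF_greatest[OF assms(2)]) (use Lip[OF that] in \<open>smt (verit)\<close>)
    qed
  qed
qed

lemma frechet_derivative_bound:
  fixes f :: "'a::euclidean_space \<Rightarrow> real"
  assumes D: "(f has_derivative f') (at x)" and "open U" "x \<in> U"
    and Lip: "\<And>y. y \<in> U \<Longrightarrow> \<bar>f y - f x\<bar> \<le> L * dist y x" and b: "norm b = 1"
  shows "\<bar>f' b\<bar> \<le> L"
proof -
  have "((\<lambda>s. f (x + s *\<^sub>R b)) has_derivative (\<lambda>h. f' (h *\<^sub>R b))) (at 0)"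
    by (rule has_derivative_compose[where g = f]) (use D in \<open>auto intro!: derivative_eq_intros\<close>)
  then have "((\<lambda>s. f (x + s *\<^sub>R b)) has_real_derivative f' b) (at 0)"
    using linear_cmul[OF has_derivative_linear[OF D], of _ b]
    by (simp add: has_field_derivative_def mult_commute_abs)
  then have lim: "((\<lambda>h. \<bar>(f (x + h *\<^sub>R b) - f x) / h\<bar>) \<longlongrightarrow> \<bar>f' b\<bar>) (at 0)"
    by (intro tendsto_rabs) (simp add: DERIV_def)
  obtain e where e: "e > 0" "ball x e \<subseteq> U" using assms(2,3) open_contains_ball by blast
  show ?thesis
  proof (rule tendsto_upperbound[OF lim])
    show "\<forall>\<^sub>F h in at 0. \<bar>(f (x + h *\<^sub>R b) - f x) / h\<bar> \<le> L"
      unfolding eventually_at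
    proof (intro exI[of _ e] conjI ballI impI)
      fix h :: real assume h: "h \<noteq> 0 \<and> dist h 0 < e"
      then have "x + h *\<^sub>R b \<in> U" using e(2) b by (auto simp: dist_norm subset_iff)
      then show "\<bar>(f (x + h *\<^sub>R b) - f x) / h\<bar> \<le> L"
        using Lip[of "x + h *\<^sub>R b"] h b by (simp add: dist_norm divide_simps abs_divide)
    qed (rule e)
  qed simp
qed

text \<open>Mollifying the Lipschitz extension at radius \<open>1 / Suc n\<close> costs at most
  \<open>L / Suc n\<close> and preserves the constant \<open>L\<close>. The bound on the partial
  derivatives, uniform in n, is what makes their weak convergence available later.\<close>

lemma lipschitz_smooth_approximation:
  fixes u :: "'a::euclidean_space \<Rightarrow> real"
  assumes "L-lipschitz_on S u" "S \<noteq> {}"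
  obtains v where "\<And>n. smooth (v n)"
    "\<And>n x. x \<in> S \<inter> ball 0 R \<Longrightarrow> \<bar>v n x - u x\<bar> \<le> L / Suc n"
    "\<And>n x b. x \<in> ball 0 R \<Longrightarrow> b \<in> Basis \<Longrightarrow> \<bar>frechet_derivative (v n) (at x) b\<bar> \<le> L"
proof -
  obtain w where w: "L-lipschitz_on UNIV w" "\<And>x. x \<in> S \<Longrightarrow> w x = u x"
    using lipschitz_extension[OF assms] by blast
  have L: "0 \<le> L" using assms(1) lipschitz_on_nonneg by blast
  have cont: "continuous_on UNIV w" using w(1) lipschitz_on_continuous_on by blast
  have "\<exists>g. smooth g \<and> (\<forall>x\<in>ball 0 R. \<bar>g x - w x\<bar> \<le> L / Suc n) \<and>
     (\<forall>x\<in>ball 0 R. \<forall>y\<in>ball 0 R. \<bar>g x - g y\<bar> \<le> L * dist x y)" for n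
  proof -
    obtain g where g: "smooth g"
      "\<And>x v e. x \<in> ball 0 R \<Longrightarrow> (\<And>y. dist x y < 1 / Suc n \<Longrightarrow> \<bar>w y - v\<bar> \<le> e) \<Longrightarrow> \<bar>g x - v\<bar> \<le> e"
      "\<And>L x y. L-lipschitz_on UNIV w \<Longrightarrow> x \<in> ball 0 R \<Longrightarrow> y \<in> ball 0 R \<Longrightarrow> \<bar>g x - g y\<bar> \<le> L * dist x y"
      using smooth_approximation[OF cont, of "1 / Suc n" R] by auto
    have "\<bar>g x - w x\<bar> \<le> L / Suc n" if "x \<in> ball 0 R" for x
    proof (rule g(2)[OF that])
      fix y assume y: "dist x y < 1 / Suc n"
      have "\<bar>w y - w x\<bar> \<le> L * dist x y"
        using lipschitz_onD[OF w(1), of y x] by (simp add: dist_real_def dist_commute)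
      also have "\<dots> \<le> L * (1 / Suc n)" using y L by (intro mult_left_mono) auto
      finally show "\<bar>w y - w x\<bar> \<le> L / Suc n" by simp
    qed
    then show ?thesis using g(1,3) w(1) by blast
  qed
  then obtain v where v: "\<And>n. smooth (v n)" "\<And>n x. x \<in> ball 0 R \<Longrightarrow> \<bar>v n x - w x\<bar> \<le> L / Suc n"
    "\<And>n x y. x \<in> ball 0 R \<Longrightarrow> y \<in> ball 0 R \<Longrightarrow> \<bar>v n x - v n y\<bar> \<le> L * dist x y"
    by metis
  show ?thesis
  proof
    show "smooth (v n)" for n by (rule v(1))
    show "\<bar>v n x - u x\<bar> \<le> L / Suc n" if "x \<in> S \<inter> ball 0 R" for n x
      using v(2)[of x n] w(2)[of x] that by auto
    show "\<bar>frechet_derivative (v n) (at x) b\<bar> \<le> L" if "x \<in> ball 0 R" "b \<in> Basis" for n x b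
      using frechet_derivative_bound[OF smooth_has_derivative[OF v(1)] open_ball that(1)] v(3) that by auto
  qed
qed

text \<open>The passage from test functions to bounded measurable multipliers: the approximants
  share the bound \<open>B\<close> and one compact support \<open>K'\<close> in \<open>D\<close>, so
  dominated convergence applies. Continuous approximants of \<open>H\<close> are truncated at level
  \<open>B\<close>, cut off near \<open>K\<close> and mollified.\<close>

lemma bounded_measurable_test_approximation:
  fixes H :: "'a::euclidean_space \<Rightarrow> real"
  assumes K: "compact K" "K \<subseteq> D" "open D"
    and H: "H \<in> borel_measurable (lebesgue_on K)" "\<And>x. x \<in> K \<Longrightarrow> \<bar>H x\<bar> \<le> B" and "0 \<le> B"
  obtains K' \<psi> where "compact K'" "K \<subseteq> K'" "K' \<subseteq> D" "\<And>n. smooth (\<psi> n)"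
    "\<And>n x. x \<notin> K' \<Longrightarrow> \<psi> n x = 0" "\<And>n x. \<bar>\<psi> n x\<bar> \<le> B"
    "AE x in lebesgue_on K'. (\<lambda>n. \<psi> n x) \<longlonglongrightarrow> (if x \<in> K then H x else 0)"
proof (cases "K = {}")
  case True
  show ?thesis
    by (rule that[of "{}" "\<lambda>_ _. 0"]) (use True \<open>0 \<le> B\<close> in \<open>auto intro: Ck_const\<close>)
next
  case False
  obtain e0 where e0: "e0 > 0" "(\<Union>x\<in>K. cball x e0) \<subseteq> D"
    using compact_subset_open_imp_cball_epsilon_subset[OF K(1,3,2)] by blast
  \<comment> \<open>Half of the available room \<open>e0\<close> is for the cut-off, the other half
    for the spreading caused by mollification.\<close>
  define e where "e = e0 / 2"
  have "e > 0" using e0 by (simp add: e_def)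
  define K' where "K' = {x. infdist x K \<le> e0}"
  have near: "\<exists>k\<in>K. dist x k \<le> e0" if x: "x \<in> K'" for x
  proof -
    obtain k where "k \<in> K" "infdist x K = dist x k"
      using infdist_attains_inf[OF compact_imp_closed[OF K(1)] False] by blast
    then show ?thesis using x unfolding K'_def by (metis mem_Collect_eq)
  qed
  have K'D: "K' \<subseteq> D" using near e0(2) by (metis UN_I dist_commute mem_cball subset_eq)
  have KK': "K \<subseteq> K'" using e0 by (auto simp: K'_def)
  obtain R0 where R0: "\<And>x. x \<in> K \<Longrightarrow> norm x \<le> R0"
    using compact_imp_bounded[OF K(1)] by (auto simp: bounded_iff)
  define R where "R = R0 + e0 + 1"
  have K'R: "K' \<subseteq> ball 0 R"
  proof
    fix x assume "x \<in> K'"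
    then obtain k where k: "k \<in> K" "dist x k \<le> e0" using near by blast
    have "norm x \<le> norm k + dist x k" by (metis dist_norm norm_triangle_sub add.commute)
    then show "x \<in> ball 0 R" using R0[OF k(1)] k(2) by (simp add: R_def)
  qed
  have "closed K'" unfolding K'_def
    by (intro closed_Collect_le continuous_intros)
  then have cK': "compact K'" using K'R bounded_ball bounded_subset compact_eq_bounded_closed by blast
  have "(\<lambda>x. if x \<in> K then H x else 0) \<in> borel_measurable lebesgue"
    using H(1) borel_measurable_if[OF compact_sets_lebesgue[OF K(1)]] by blast
  then have "(\<lambda>x. if x \<in> K then H x else 0) measurable_on UNIV"
    by (rule lebesgue_measurable_imp_measurable_on) simp
  then obtain N g where N: "negligible N" and g: "\<And>n. continuous_on UNIV (g n)"
    "\<And>x. x \<notin> N \<Longrightarrow> (\<lambda>n. g n x) \<longlonglongrightarrow> (if x \<in> K then H x else 0)"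
    unfolding measurable_on_def by auto
  define cut where "cut x = max 0 (1 - infdist x K / e)" for x
  define f where "f n x = max (- B) (min B (g n x)) * cut x" for n x
  have cont: "continuous_on UNIV (f n)" for n
    unfolding f_def[abs_def] cut_def using \<open>e > 0\<close> by (intro continuous_intros g) auto
  have cut01: "0 \<le> cut x" "cut x \<le> 1" for x using \<open>e > 0\<close> by (auto simp: cut_def infdist_nonneg)
  have fB: "\<bar>f n x\<bar> \<le> B" for n x
  proof -
    have "\<bar>max (- B) (min B (g n x))\<bar> \<le> B" using \<open>0 \<le> B\<close> by auto
    then show ?thesis unfolding f_def abs_mult
      using mult_mono[of "\<bar>max (- B) (min B (g n x))\<bar>" B "\<bar>cut x\<bar>" 1] cut01[of x] \<open>0 \<le> B\<close> by simp
  qed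
  have flim: "(\<lambda>n. f n x) \<longlonglongrightarrow> (if x \<in> K then H x else 0)" if "x \<notin> N" for x
  proof -
    let ?h = "if x \<in> K then H x else 0"
    have "(\<lambda>n. f n x) \<longlonglongrightarrow> max (- B) (min B ?h) * cut x"
      unfolding f_def by (intro tendsto_intros g(2)[OF that])
    moreover have "max (- B) (min B ?h) = ?h" using H(2)[of x] \<open>0 \<le> B\<close> by auto
    moreover have "?h * cut x = ?h" by (simp add: cut_def)
    ultimately show ?thesis by simp
  qed
  have f0: "f n x = 0" if "e \<le> infdist x K" for n x
    using that \<open>e > 0\<close> by (simp add: f_def cut_def)
  have "\<exists>\<psi>. smooth \<psi> \<and> (\<forall>x. x \<notin> K' \<longrightarrow> \<psi> x = 0) \<and> (\<forall>x. \<bar>\<psi> x\<bar> \<le> B) \<and>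
     (\<forall>x\<in>K'. \<bar>\<psi> x - f n x\<bar> \<le> 1 / Suc n)" for n
  proof -
    have "uniformly_continuous_on (cball 0 (R + 1)) (f n)"
      using compact_uniformly_continuous cont continuous_on_subset by (metis compact_cball top_greatest)
    then obtain d where d: "d > 0"
      "\<And>x y. x \<in> cball 0 (R + 1) \<Longrightarrow> y \<in> cball 0 (R + 1) \<Longrightarrow> dist y x < d \<Longrightarrow> dist (f n y) (f n x) < 1 / Suc n"
      unfolding uniformly_continuous_on_def by (metis zero_less_divide_1_iff of_nat_0_less_iff zero_less_Suc)
    define \<epsilon> where "\<epsilon> = min (min d 1) e"
    have \<epsilon>: "0 < \<epsilon>" "\<epsilon> \<le> 1" "\<epsilon> \<le> d" "\<epsilon> \<le> e" using d(1) \<open>e > 0\<close> by (auto simp: \<epsilon>_def)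
    obtain h where h: "smooth h"
      "\<And>x v c. x \<in> ball 0 R \<Longrightarrow> (\<And>y. dist x y < \<epsilon> \<Longrightarrow> \<bar>f n y - v\<bar> \<le> c) \<Longrightarrow> \<bar>h x - v\<bar> \<le> c"
      using smooth_approximation[OF cont \<epsilon>(1,2), of R] by metis
    have h0: "h x = 0" if "x \<in> ball 0 R - K'" for x
    proof -
      have "\<bar>h x - 0\<bar> \<le> 0"
      proof (rule h(2))
        fix y assume "dist x y < \<epsilon>"
        then have "e \<le> infdist y K"
          using that infdist_triangle[of x K y] \<epsilon>(4) by (auto simp: K'_def e_def)
        then show "\<bar>f n y - 0\<bar> \<le> 0" using f0 by simp
      qed (use that in auto)
      then show ?thesis by simp
    qed
    \<comment> \<open>The estimates on \<open>h\<close> hold only in \<open>ball 0 R\<close>. Since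
      \<open>h\<close> vanishes on the part of this ball outside \<open>K'\<close>, cutting it off
      there preserves smoothness.\<close>
    let ?\<psi> = "\<lambda>x. if x \<in> ball 0 R then h x else 0"
    have "smooth ?\<psi>"
      by (intro allI Ck_restrict[where f = h, OF open_ball \<open>closed K'\<close> K'R h0]) (use h(1) in blast)+
    moreover have "?\<psi> x = 0" if "x \<notin> K'" for x using h0 that by auto
    moreover have "\<bar>?\<psi> x\<bar> \<le> B" for x
      using h(2)[of x 0 B] fB \<open>0 \<le> B\<close> by auto
    moreover have "\<bar>?\<psi> x - f n x\<bar> \<le> 1 / Suc n" if "x \<in> K'" for x
    proof -
      have xR: "x \<in> ball 0 R" using that K'R by blast
      have "\<bar>h x - f n x\<bar> \<le> 1 / Suc n"
      proof (rule h(2)[OF xR])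
        fix y assume y: "dist x y < \<epsilon>"
        have "norm y \<le> norm x + dist x y" by (metis dist_norm norm_triangle_sub dist_commute)
        then have "y \<in> cball 0 (R + 1)" using xR y \<epsilon> by simp
        then have "dist (f n y) (f n x) < 1 / Suc n"
          using xR y \<epsilon> by (intro d(2)) (auto simp: dist_commute)
        then show "\<bar>f n y - f n x\<bar> \<le> 1 / Suc n" by (simp add: dist_real_def)
      qed
      then show ?thesis using xR by simp
    qed
    ultimately show ?thesis by blast
  qed
  then obtain \<psi> where \<psi>: "\<And>n. smooth (\<psi> n)" "\<And>n x. x \<notin> K' \<Longrightarrow> \<psi> n x = 0" "\<And>n x. \<bar>\<psi> n x\<bar> \<le> B"
    "\<And>n x. x \<in> K' \<Longrightarrow> \<bar>\<psi> n x - f n x\<bar> \<le> 1 / Suc n"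
    by metis
  have lim: "(\<lambda>n. \<psi> n x) \<longlonglongrightarrow> (if x \<in> K then H x else 0)" if "x \<in> K'" "x \<notin> N" for x
  proof -
    have "(\<lambda>n. \<psi> n x - f n x) \<longlonglongrightarrow> 0"
      by (rule tendsto_rabs_zero_cancel, rule tendsto_sandwich[OF _ _ tendsto_const LIMSEQ_inverse_real_of_nat])
         (use \<psi>(4)[OF that(1)] in \<open>auto simp: inverse_eq_divide\<close>)
    from tendsto_add[OF this flim[OF that(2)]] show ?thesis by simp
  qed
  have "AE x in lebesgue. x \<notin> N"
    using N by (simp add: negligible_iff_null_sets AE_not_in)
  then have "AE x in lebesgue. x \<in> K' \<longrightarrow> (\<lambda>n. \<psi> n x) \<longlonglongrightarrow> (if x \<in> K then H x else 0)"
    by eventually_elim (use lim in blast)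
  then have "AE x in lebesgue_on K'. (\<lambda>n. \<psi> n x) \<longlonglongrightarrow> (if x \<in> K then H x else 0)"
    using compact_sets_lebesgue[OF cK'] by (subst AE_restrict_space_iff) auto
  with cK' KK' K'D \<psi>(1,2,3) show ?thesis by (rule that)
qed

lemma integral_compact_superset:
  fixes f :: "'a::euclidean_space \<Rightarrow> real"
  assumes "compact K" "compact K'" "K \<subseteq> K'"
  shows "(\<integral>x. (if x \<in> K then f x else 0) \<partial>lebesgue_on K') = (\<integral>x. f x \<partial>lebesgue_on K)"
proof -
  have "(\<lambda>x. indicator K' x *\<^sub>R (if x \<in> K then f x else 0)) = (\<lambda>x. indicator K x *\<^sub>R f x)"
    using assms(3) by (auto simp: indicator_def fun_eq_iff)
  then show ?thesis
    using compact_sets_lebesgue[OF assms(1)] compact_sets_lebesgue[OF assms(2)]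
    by (simp add: integral_restrict_space)
qed

section \<open>Weak gradients of Lipschitz functions\<close>

context
  fixes S :: "'a::euclidean_space set" and u :: "'a \<Rightarrow> real" and G :: "'a \<Rightarrow> 'a" and L :: real and b :: 'a
  assumes S: "open S" and u: "L-lipschitz_on S u" and W: "weak_gradient S u G" and b: "b \<in> Basis"
begin

lemma weak_gradient_component_integrable:
  assumes "compact K" "K \<subseteq> S"
  shows "integrable (lebesgue_on K) (\<lambda>x. G x \<bullet> b)"
proof -
  have "G absolutely_integrable_on K" using W assms by (auto simp: weak_gradient_def locally_integrable_def)
  then show ?thesis
    using absolutely_integrable_imp_integrable compact_sets_lebesgue assms integrable_inner_left by blast
qed

text \<open>The derivative is moved onto \<phi> on both sides, classically for \<open>v n\<close>
  and by the definition of the weak gradient for \<open>u\<close>; what remains is uniform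
  convergence of \<open>v n\<close> on \<open>K\<close>.\<close>

lemma weak_gradient_test_convergence:
  assumes v: "\<And>n. smooth (v n)" "\<And>n x. x \<in> K \<Longrightarrow> \<bar>v n x - u x\<bar> \<le> L / Suc n"
    and K: "compact K" "K \<subseteq> S" and \<phi>: "smooth \<phi>" "\<And>x. x \<notin> K \<Longrightarrow> \<phi> x = 0"
  shows "(\<lambda>n. \<integral>x. \<phi> x * frechet_derivative (v n) (at x) b \<partial>lebesgue_on K)
    \<longlonglongrightarrow> (\<integral>x. \<phi> x * (G x \<bullet> b) \<partial>lebesgue_on K)"
proof -
  let ?d = "\<lambda>x. frechet_derivative \<phi> (at x) b"
  have contu: "continuous_on K u"
    using lipschitz_on_continuous_on[OF u] continuous_on_subset K(2) by blast
  have bnd: "\<exists>B. \<forall>x\<in>K. \<bar>f x\<bar> \<le> B" if "continuous_on K f" for f :: "'a \<Rightarrow> real"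
    using compact_continuous_image[OF that K(1)] compact_imp_bounded by (fastforce simp: bounded_iff)
  obtain C1 where C1: "\<forall>x\<in>K. \<bar>?d x\<bar> \<le> C1" using bnd[OF smooth_continuous_frechet[OF \<phi>(1) b]] by blast
  obtain C2 where C2: "\<forall>x\<in>K. \<bar>u x\<bar> \<le> C2" using bnd[OF contu] by blast
  have L: "0 \<le> L" using u lipschitz_on_nonneg by blast
  have "(\<lambda>n. \<integral>x. ?d x * v n x \<partial>lebesgue_on K) \<longlonglongrightarrow> (\<integral>x. ?d x * u x \<partial>lebesgue_on K)"
  proof (rule bounded_convergence_compact[OF K(1), where B = "C1 * (C2 + L)"])
    show "(\<lambda>x. ?d x * v n x) \<in> borel_measurable (lebesgue_on K)" for n
      by (intro measurable_continuous_compact K continuous_intros smooth_continuous_frechet \<phi> b smooth_continuous v(1))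
    show "(\<lambda>x. ?d x * u x) \<in> borel_measurable (lebesgue_on K)"
      by (intro measurable_continuous_compact K continuous_intros smooth_continuous_frechet \<phi> b contu)
    show "\<bar>?d x * v n x\<bar> \<le> C1 * (C2 + L)" if x: "x \<in> K" for n x
    proof -
      have "L / Suc n \<le> L" using L by (simp add: divide_simps mult_le_cancel_left1)
      then have "\<bar>v n x\<bar> \<le> C2 + L" using v(2)[OF x, of n] C2 x by (smt (verit))
      then show ?thesis unfolding abs_mult using C1 x by (intro mult_mono) auto
    qed
    have "(\<lambda>n. ?d x * v n x) \<longlonglongrightarrow> ?d x * u x" if x: "x \<in> K" for x
    proof -
      have "(\<lambda>n. v n x - u x) \<longlonglongrightarrow> 0"
      proof (rule tendsto_rabs_zero_cancel, rule tendsto_sandwich[OF _ _ tendsto_const])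
        show "(\<lambda>n. L * inverse (real (Suc n))) \<longlonglongrightarrow> 0"
          using tendsto_mult_left[OF LIMSEQ_inverse_real_of_nat, of L] by simp
      qed (use v(2)[OF x] in \<open>auto simp: divide_inverse\<close>)
      then have "(\<lambda>n. v n x) \<longlonglongrightarrow> u x" by (rule LIM_zero_cancel)
      then show ?thesis by (intro tendsto_intros)
    qed
    then show "AE x in lebesgue_on K. (\<lambda>n. ?d x * v n x) \<longlonglongrightarrow> ?d x * u x" by (intro AE_I2) auto
  qed
  moreover have "(\<integral>x. ?d x * v n x \<partial>lebesgue_on K) = - (\<integral>x. \<phi> x * frechet_derivative (v n) (at x) b \<partial>lebesgue_on K)" for n
    by (rule integration_by_parts[OF \<phi> K(1) subset_UNIV open_UNIV smooth_has_derivative[OF v(1)]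
          smooth_continuous_frechet[OF v(1) b] b])
  moreover have "(\<integral>x. ?d x * u x \<partial>lebesgue_on K) = - (\<integral>x. \<phi> x * (G x \<bullet> b) \<partial>lebesgue_on K)"
    by (rule weak_gradient_component[OF W \<phi> K b])
  ultimately show ?thesis by (simp add: tendsto_minus_cancel_left)
qed

text \<open>Duality. Smooth approximations with derivatives at most \<open>L\<close> show that the
  integral of \<psi> g is at most \<open>L\<close> times that of |\<psi>| for test functions \<psi>,
  where g is the component of \<open>G\<close>. By density this extends to the sign of g on the set
  where |g| > L; there \<open>h x * ?g x - L * \<bar>h x\<bar>\<close> is |g| - L > 0, so the set is
  null.\<close>

lemma weak_gradient_bound:
  assumes K: "compact K" "K \<subseteq> S"
  shows "AE x in lebesgue_on K. \<bar>G x \<bullet> b\<bar> \<le> L"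
proof -
  let ?g = "\<lambda>x. G x \<bullet> b"
  have L: "0 \<le> L" using u lipschitz_on_nonneg by blast
  obtain R where R: "K \<subseteq> ball 0 R"
    using bounded_subset_ballD[OF compact_imp_bounded[OF K(1)]] by blast
  have [measurable]: "?g \<in> borel_measurable (lebesgue_on K)"
    using weak_gradient_component_integrable[OF K] by (rule borel_measurable_integrable)
  define H where "H x = (if L < \<bar>?g x\<bar> then sgn (?g x) else 0)" for x
  have Hm: "H \<in> borel_measurable (lebesgue_on K)" unfolding H_def[abs_def] by measurable
  have H1: "\<bar>H x\<bar> \<le> 1" for x by (simp add: H_def sgn_if)
  obtain K' \<psi> where K': "compact K'" "K \<subseteq> K'" "K' \<subseteq> S \<inter> ball 0 R"
    and \<psi>: "\<And>n::nat. smooth (\<psi> n)" "\<And>n x. x \<notin> K' \<Longrightarrow> \<psi> n x = 0" "\<And>n x. \<bar>\<psi> n x\<bar> \<le> 1"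
    and lim: "AE x in lebesgue_on K'. (\<lambda>n. \<psi> n x) \<longlonglongrightarrow> (if x \<in> K then H x else 0)"
    by (rule bounded_measurable_test_approximation[OF K(1) Int_greatest[OF K(2) R]
          open_Int[OF S open_ball] Hm H1 zero_le_one]) (rule that; assumption)
  have K'S: "K' \<subseteq> S" using K' by blast
  define h where "h x = (if x \<in> K then H x else 0)" for x
  have "h \<in> borel_measurable lebesgue"
    unfolding h_def[abs_def]
    by (rule iffD2[OF borel_measurable_if[OF compact_sets_lebesgue[OF K(1)]] Hm])
  then have hm[measurable]: "h \<in> borel_measurable (lebesgue_on K')" by (rule measurable_restrict_space1)
  have gi: "integrable (lebesgue_on K') ?g" by (rule weak_gradient_component_integrable[OF K'(1) K'S])
  then have gm[measurable]: "?g \<in> borel_measurable (lebesgue_on K')" by (rule borel_measurable_integrable)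
  have \<psi>m[measurable]: "\<psi> n \<in> borel_measurable (lebesgue_on K')" for n
    by (rule measurable_continuous_compact[OF K'(1) smooth_continuous[OF \<psi>(1)]])
  have bound: "(\<integral>x. \<psi> n x * ?g x \<partial>lebesgue_on K') \<le> L * (\<integral>x. \<bar>\<psi> n x\<bar> \<partial>lebesgue_on K')" for n
  proof (cases "S = {}")
    case True
    then show ?thesis using K'S by simp
  next
    case False
    obtain v where v: "\<And>n. smooth (v n)"
      "\<And>n x. x \<in> S \<inter> ball 0 R \<Longrightarrow> \<bar>v n x - u x\<bar> \<le> L / Suc n"
      "\<And>n x b. x \<in> ball 0 R \<Longrightarrow> b \<in> Basis \<Longrightarrow> \<bar>frechet_derivative (v n) (at x) b\<bar> \<le> L"
      using lipschitz_smooth_approximation[OF u False, of R] by metis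
    have "(\<lambda>k. \<integral>x. \<psi> n x * frechet_derivative (v k) (at x) b \<partial>lebesgue_on K')
      \<longlonglongrightarrow> (\<integral>x. \<psi> n x * ?g x \<partial>lebesgue_on K')"
      by (rule weak_gradient_test_convergence[OF v(1) v(2)[OF subsetD[OF K'(3)]] K'(1) K'S \<psi>(1,2)])
    moreover have "(\<integral>x. \<psi> n x * frechet_derivative (v k) (at x) b \<partial>lebesgue_on K')
      \<le> (\<integral>x. L * \<bar>\<psi> n x\<bar> \<partial>lebesgue_on K')" for k
    proof (rule integral_mono)
      show "integrable (lebesgue_on K') (\<lambda>x. \<psi> n x * frechet_derivative (v k) (at x) b)"
        by (intro integrable_continuous_compact K' continuous_intros smooth_continuous_frechet v(1) b smooth_continuous \<psi>(1))
      show "integrable (lebesgue_on K') (\<lambda>x. L * \<bar>\<psi> n x\<bar>)"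
        by (intro integrable_continuous_compact K' continuous_intros smooth_continuous \<psi>(1))
      fix x assume "x \<in> space (lebesgue_on K')"
      then have "\<bar>frechet_derivative (v k) (at x) b\<bar> \<le> L" using K'(3) b by (intro v(3)) auto
      then have "\<bar>\<psi> n x * frechet_derivative (v k) (at x) b\<bar> \<le> L * \<bar>\<psi> n x\<bar>"
        using mult_right_mono[of "\<bar>frechet_derivative (v k) (at x) b\<bar>" L "\<bar>\<psi> n x\<bar>"]
        by (simp add: abs_mult mult.commute)
      then show "\<psi> n x * frechet_derivative (v k) (at x) b \<le> L * \<bar>\<psi> n x\<bar>" by linarith
    qed
    ultimately have "(\<integral>x. \<psi> n x * ?g x \<partial>lebesgue_on K') \<le> (\<integral>x. L * \<bar>\<psi> n x\<bar> \<partial>lebesgue_on K')"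
      by (intro LIMSEQ_le_const2) auto
    then show ?thesis by simp
  qed
  \<comment> \<open>At this stage g is only known to be integrable, so |g| itself is the dominating
    function.\<close>
  have "(\<lambda>n. \<integral>x. \<psi> n x * ?g x \<partial>lebesgue_on K') \<longlonglongrightarrow> (\<integral>x. h x * ?g x \<partial>lebesgue_on K')"
  proof (rule integral_dominated_convergence[where w = "\<lambda>x. \<bar>?g x\<bar>"])
    show "integrable (lebesgue_on K') (\<lambda>x. \<bar>?g x\<bar>)" using gi by simp
    show "AE x in lebesgue_on K'. (\<lambda>n. \<psi> n x * ?g x) \<longlonglongrightarrow> h x * ?g x"
      using lim by eventually_elim (unfold h_def, intro tendsto_intros)
    show "AE x in lebesgue_on K'. norm (\<psi> n x * ?g x) \<le> \<bar>?g x\<bar>" for n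
      using \<psi>(3)[of n] by (auto simp: abs_mult intro!: mult_left_le_one_le)
  qed measurable
  moreover have "(\<lambda>n. \<integral>x. \<bar>\<psi> n x\<bar> \<partial>lebesgue_on K') \<longlonglongrightarrow> (\<integral>x. \<bar>h x\<bar> \<partial>lebesgue_on K')"
  proof (rule bounded_convergence_compact[OF K'(1), where B = 1])
    show "AE x in lebesgue_on K'. (\<lambda>n. \<bar>\<psi> n x\<bar>) \<longlonglongrightarrow> \<bar>h x\<bar>"
      using lim by eventually_elim (unfold h_def, intro tendsto_intros)
  qed (use \<psi>(3) in auto)
  ultimately have "(\<integral>x. h x * ?g x \<partial>lebesgue_on K') \<le> L * (\<integral>x. \<bar>h x\<bar> \<partial>lebesgue_on K')"
    using bound by (intro LIMSEQ_le[OF _ tendsto_mult_left]) auto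
  moreover have h1: "\<bar>h x\<bar> \<le> 1" for x using H1 by (simp add: h_def)
  have hi: "integrable (lebesgue_on K') (\<lambda>x. L * \<bar>h x\<bar>)"
    by (intro integrable_mult_right integrable_bounded_compact[OF K'(1), where B = 1]) (use h1 in auto)
  have hgi: "integrable (lebesgue_on K') (\<lambda>x. h x * ?g x)"
    by (rule Bochner_Integration.integrable_bound[OF gi]) (use h1 in \<open>auto simp: abs_mult intro!: mult_left_le_one_le\<close>)
  ultimately have le0: "(\<integral>x. h x * ?g x - L * \<bar>h x\<bar> \<partial>lebesgue_on K') \<le> 0"
    using hi by (subst Bochner_Integration.integral_diff[OF hgi hi]) simp
  have eq: "h x * ?g x - L * \<bar>h x\<bar> = (if x \<in> K \<and> L < \<bar>?g x\<bar> then \<bar>?g x\<bar> - L else 0)" for x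
    using L by (auto simp: h_def H_def sgn_if)
  have "(\<integral>x. h x * ?g x - L * \<bar>h x\<bar> \<partial>lebesgue_on K') = 0"
    using le0 by (intro antisym Bochner_Integration.integral_nonneg) (auto simp: eq)
  then have "AE x in lebesgue_on K'. h x * ?g x - L * \<bar>h x\<bar> = 0"
    using integral_nonneg_eq_0_iff_AE[OF Bochner_Integration.integrable_diff[OF hgi hi]] by (simp add: eq)
  then have "AE x in lebesgue. x \<in> K' \<longrightarrow> h x * ?g x - L * \<bar>h x\<bar> = 0"
    using compact_sets_lebesgue[OF K'(1)] by (subst (asm) AE_restrict_space_iff) auto
  then have "AE x in lebesgue. x \<in> K \<longrightarrow> \<bar>?g x\<bar> \<le> L"
    by eventually_elim (use K'(2) in \<open>auto simp: eq split: if_splits\<close>)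
  then show ?thesis using compact_sets_lebesgue[OF K(1)] by (subst AE_restrict_space_iff) auto
qed

text \<open>The multiplier \<open>H\<close> is approximated in L^1 by test functions. The resulting
  error is at most \<open>L\<close> times the L^1 distance, for every \<open>v k\<close> as well as
  for the limit, because all these derivatives are bounded by \<open>L\<close>. Hence a single test
  function serves all large k.\<close>

lemma weak_gradient_convergence:
  assumes v: "\<And>n. smooth (v n)" "\<And>n x. x \<in> S \<inter> ball 0 R \<Longrightarrow> \<bar>v n x - u x\<bar> \<le> L / Suc n"
      "\<And>n x. x \<in> ball 0 R \<Longrightarrow> \<bar>frechet_derivative (v n) (at x) b\<bar> \<le> L"
    and K: "compact K" "K \<subseteq> S \<inter> ball 0 R"
    and H: "H \<in> borel_measurable (lebesgue_on K)" "\<And>x. x \<in> K \<Longrightarrow> \<bar>H x\<bar> \<le> B" "0 \<le> B"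
  shows "(\<lambda>n. \<integral>x. H x * frechet_derivative (v n) (at x) b \<partial>lebesgue_on K)
    \<longlonglongrightarrow> (\<integral>x. H x * (G x \<bullet> b) \<partial>lebesgue_on K)"
proof -
  let ?g = "\<lambda>x. G x \<bullet> b" and ?d = "\<lambda>k x. frechet_derivative (v k) (at x) b"
  have L: "0 \<le> L" using u lipschitz_on_nonneg by blast
  obtain K' \<psi> where K': "compact K'" "K \<subseteq> K'" "K' \<subseteq> S \<inter> ball 0 R"
    and \<psi>: "\<And>n::nat. smooth (\<psi> n)" "\<And>n x. x \<notin> K' \<Longrightarrow> \<psi> n x = 0" "\<And>n x. \<bar>\<psi> n x\<bar> \<le> B"
    and lim: "AE x in lebesgue_on K'. (\<lambda>n. \<psi> n x) \<longlonglongrightarrow> (if x \<in> K then H x else 0)"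
    by (rule bounded_measurable_test_approximation[OF K open_Int[OF S open_ball] H])
      (assumption, (rule that; assumption))
  have K'S: "K' \<subseteq> S" using K' by blast
  define h where "h x = (if x \<in> K then H x else 0)" for x
  have "h \<in> borel_measurable lebesgue"
    unfolding h_def[abs_def]
    by (rule iffD2[OF borel_measurable_if[OF compact_sets_lebesgue[OF K(1)]] H(1)])
  then have hm[measurable]: "h \<in> borel_measurable (lebesgue_on K')" by (rule measurable_restrict_space1)
  have hB: "\<bar>h x\<bar> \<le> B" for x using H by (simp add: h_def)
  have gi: "integrable (lebesgue_on K') ?g" by (rule weak_gradient_component_integrable[OF K'(1) K'S])
  have gL: "AE x in lebesgue_on K'. \<bar>?g x\<bar> \<le> L" by (rule weak_gradient_bound[OF K'(1) K'S])
  have \<psi>m[measurable]: "\<psi> n \<in> borel_measurable (lebesgue_on K')" for n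
    by (rule measurable_continuous_compact[OF K'(1) smooth_continuous[OF \<psi>(1)]])
  have di: "integrable (lebesgue_on K') (?d k)" for k
    by (intro integrable_continuous_compact K' smooth_continuous_frechet v(1) b)
  have dL: "AE x in lebesgue_on K'. \<bar>?d k x\<bar> \<le> L" for k
    by (intro AE_I2 v(3)) (use K'(3) in auto)
  have prod: "integrable (lebesgue_on K') (\<lambda>x. f x * w x)"
    if "f \<in> borel_measurable (lebesgue_on K')" "\<And>x. \<bar>f x\<bar> \<le> 2 * B" "integrable (lebesgue_on K') w" for f w :: "'a \<Rightarrow> real"
    by (rule Bochner_Integration.integrable_bound[of _ "\<lambda>x. 2 * B * w x"])
       (use that borel_measurable_integrable[OF that(3)] H(3) in \<open>auto simp: abs_mult intro!: mult_right_mono\<close>)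
  define c where "c n = (\<integral>x. \<bar>h x - \<psi> n x\<bar> \<partial>lebesgue_on K')" for n
  have "c \<longlonglongrightarrow> (\<integral>x. 0 \<partial>lebesgue_on K')" unfolding c_def[abs_def]
  proof (rule bounded_convergence_compact[OF K'(1), where B = "2 * B"])
    show "AE x in lebesgue_on K'. (\<lambda>n. \<bar>h x - \<psi> n x\<bar>) \<longlonglongrightarrow> 0"
      using lim
    proof eventually_elim
      case (elim x)
      then have "(\<lambda>n. \<bar>h x - \<psi> n x\<bar>) \<longlonglongrightarrow> \<bar>h x - h x\<bar>"
        unfolding h_def by (intro tendsto_intros)
      then show ?case by simp
    qed
    show "\<bar>\<bar>h x - \<psi> n x\<bar>\<bar> \<le> 2 * B" for n x using hB[of x] \<psi>(3)[of n x] by linarith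
  qed auto
  then have c0: "c \<longlonglongrightarrow> 0" by simp
  have err: "\<bar>(\<integral>x. h x * w x \<partial>lebesgue_on K') - (\<integral>x. \<psi> n x * w x \<partial>lebesgue_on K')\<bar> \<le> L * c n"
    if w: "integrable (lebesgue_on K') w" "AE x in lebesgue_on K'. \<bar>w x\<bar> \<le> L" for w :: "'a \<Rightarrow> real" and n
  proof -
    note [measurable] = borel_measurable_integrable[OF w(1)]
    have i: "integrable (lebesgue_on K') (\<lambda>x. h x * w x)" "integrable (lebesgue_on K') (\<lambda>x. \<psi> n x * w x)"
      by (rule prod[OF _ _ w(1)], use hB \<psi>(3) H(3) in \<open>auto intro: order_trans[of _ B]\<close>)+
    have i': "integrable (lebesgue_on K') (\<lambda>x. \<bar>h x - \<psi> n x\<bar>)"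
    proof (rule integrable_bounded_compact[OF K'(1)])
      show "norm \<bar>h x - \<psi> n x\<bar> \<le> 2 * B" for x using hB[of x] \<psi>(3)[of n x] unfolding real_norm_def by linarith
    qed measurable
    have "(\<integral>x. h x * w x \<partial>lebesgue_on K') - (\<integral>x. \<psi> n x * w x \<partial>lebesgue_on K') =
      (\<integral>x. h x * w x - \<psi> n x * w x \<partial>lebesgue_on K')"
      by (rule Bochner_Integration.integral_diff[OF i, symmetric])
    also have "\<bar>\<dots>\<bar> \<le> (\<integral>x. \<bar>h x * w x - \<psi> n x * w x\<bar> \<partial>lebesgue_on K')"
      by (rule integral_abs_bound)
    also have "\<dots> \<le> (\<integral>x. L * \<bar>h x - \<psi> n x\<bar> \<partial>lebesgue_on K')"
    proof (rule integral_mono_AE)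
      show "AE x in lebesgue_on K'. \<bar>h x * w x - \<psi> n x * w x\<bar> \<le> L * \<bar>h x - \<psi> n x\<bar>"
        using w(2)
      proof eventually_elim
        case (elim x)
        have "\<bar>h x * w x - \<psi> n x * w x\<bar> = \<bar>w x\<bar> * \<bar>h x - \<psi> n x\<bar>"
          by (metis abs_mult left_diff_distrib mult.commute)
        then show ?case using elim by (simp add: mult_right_mono)
      qed
    qed (use i i' in auto)
    finally show ?thesis by (simp add: c_def)
  qed
  have "(\<lambda>k. \<integral>x. h x * ?d k x \<partial>lebesgue_on K') \<longlonglongrightarrow> (\<integral>x. h x * ?g x \<partial>lebesgue_on K')"
  proof (rule LIMSEQ_I)
    fix e :: real assume "0 < e"
    have "(\<lambda>n. L * c n) \<longlonglongrightarrow> 0" using tendsto_mult_left[OF c0, of L] by simp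
    from LIMSEQ_D[OF this, of "e / 3"] \<open>0 < e\<close> obtain n where "norm (L * c n - 0) < e / 3" by auto
    then have n: "L * c n < e / 3" by simp
    have "(\<lambda>k. \<integral>x. \<psi> n x * ?d k x \<partial>lebesgue_on K') \<longlonglongrightarrow> (\<integral>x. \<psi> n x * ?g x \<partial>lebesgue_on K')"
      by (rule weak_gradient_test_convergence[OF v(1) v(2)[OF subsetD[OF K'(3)]] K'(1) K'S \<psi>(1,2)])
    from LIMSEQ_D[OF this, of "e / 3"] \<open>0 < e\<close> obtain k0 where
      k0: "\<And>k. k \<ge> k0 \<Longrightarrow> \<bar>(\<integral>x. \<psi> n x * ?d k x \<partial>lebesgue_on K') - (\<integral>x. \<psi> n x * ?g x \<partial>lebesgue_on K')\<bar> < e / 3"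
      by auto
    have "\<bar>(\<integral>x. h x * ?d k x \<partial>lebesgue_on K') - (\<integral>x. h x * ?g x \<partial>lebesgue_on K')\<bar> < e" if "k \<ge> k0" for k
      using err[OF di dL, of k n] err[OF gi gL, of n] k0[OF that] n by linarith
    then show "\<exists>k0. \<forall>k\<ge>k0. norm ((\<integral>x. h x * ?d k x \<partial>lebesgue_on K') - (\<integral>x. h x * ?g x \<partial>lebesgue_on K')) < e"
      by auto
  qed
  moreover have "(\<integral>x. h x * w x \<partial>lebesgue_on K') = (\<integral>x. H x * w x \<partial>lebesgue_on K)" for w
    using integral_compact_superset[OF K(1) K'(1,2), of "\<lambda>x. H x * w x"]
    by (simp add: h_def if_distrib[of "\<lambda>t. t * _"] cong: if_cong)
  ultimately show ?thesis by simp
qed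

end

subsection \<open>The comparison principle\<close>

text \<open>Cauchy-Schwarz on the mixed term reduces the claim to monotonicity of t powr (p - 1) on
  the two norms. The identity \<open>pow\<close> holds at v = 0 too, so zero vectors need no
  separate treatment.\<close>

lemma flux_monotone:
  fixes a b :: "'a::real_inner"
  assumes "1 < p"
  shows "0 \<le> (norm a powr (p - 2) *\<^sub>R a - norm b powr (p - 2) *\<^sub>R b) \<bullet> (a - b)"
proof -
  define A B where "A = norm a powr (p - 2)" and "B = norm b powr (p - 2)"
  have AB: "0 \<le> A" "0 \<le> B" by (auto simp: A_def B_def)
  have pow: "norm v powr (p - 2) * norm v = norm v powr (p - 1)" for v :: 'a
    using powr_mult_base[of "norm v" "p - 2"] by (simp add: mult.commute)
  have "0 \<le> (norm a powr (p - 1) - norm b powr (p - 1)) * (norm a - norm b)"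
  proof (cases "norm a \<le> norm b")
    case True
    then have "norm a powr (p - 1) \<le> norm b powr (p - 1)" using assms by (intro powr_mono2) auto
    then show ?thesis using True by (intro mult_nonpos_nonpos) auto
  next
    case False
    then have "norm b powr (p - 1) \<le> norm a powr (p - 1)" using assms by (intro powr_mono2) auto
    then show ?thesis using False by (intro mult_nonneg_nonneg) auto
  qed
  also have "\<dots> = A * (norm a)\<^sup>2 + B * (norm b)\<^sup>2 - (A + B) * (norm a * norm b)"
    unfolding pow[symmetric] A_def B_def by (simp add: algebra_simps power2_eq_square)
  also have "\<dots> \<le> A * (norm a)\<^sup>2 + B * (norm b)\<^sup>2 - (A + B) * (a \<bullet> b)"
    using mult_left_mono[OF norm_cauchy_schwarz[of a b], of "A + B"] AB by simp
  also have "\<dots> = (A *\<^sub>R a - B *\<^sub>R b) \<bullet> (a - b)"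
    by (simp add: power2_norm_eq_inner inner_diff_left inner_diff_right inner_commute algebra_simps)
  finally show ?thesis by (simp add: A_def B_def)
qed

lemma bump_pos_iff: "0 < bump 0 t \<longleftrightarrow> 0 < t"
  by (simp add: bump_0)

lemma bump_nonneg: "0 \<le> bump 0 t"
  by (simp add: bump_0)

lemma tendsto_bump: "X \<longlonglongrightarrow> a \<Longrightarrow> (\<lambda>n. bump j (X n)) \<longlonglongrightarrow> bump j a"
  using isCont_tendsto_compose[OF DERIV_isCont[OF bump_DERIV]] .

lemma bump_bounded: "\<exists>B. \<forall>t. \<bar>t\<bar> \<le> C \<longrightarrow> \<bar>bump j t\<bar> \<le> B"
proof -
  have "bounded (bump j ` {- C..C})"
    by (intro compact_imp_bounded compact_continuous_image continuous_on_bump continuous_on_id) auto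
  then obtain B where "\<forall>t\<in>{- C..C}. \<bar>bump j t\<bar> \<le> B" by (auto simp: bounded_iff)
  then show ?thesis by (intro exI[of _ B]) (simp add: abs_le_iff)
qed

text \<open>The inequality w \<le> v at the boundary is expressed through compact sets: for every c
  > 0, w - v is below c off a compact part of \<open>D\<close>. The same compact sets carry the test
  functions.\<close>

lemma comparison_strict_subsolution:
  fixes v w :: "'a::euclidean_space \<Rightarrow> real" and p :: real
  defines "V \<equiv> \<lambda>x. norm (grad w x) powr (p - 2) *\<^sub>R grad w x"
  assumes p: "1 < p" and S: "open S" and harm: "p_harmonic_on p S v" and lip: "L-lipschitz_on S v"
    and D: "open D" "D \<subseteq> S" "bounded D" and w: "smooth w"
    and V': "\<And>x. x \<in> D \<Longrightarrow> (V has_derivative V' x) (at x)"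
      "\<And>b. b \<in> Basis \<Longrightarrow> continuous_on D (\<lambda>x. V' x b)"
      "\<And>x. x \<in> D \<Longrightarrow> 0 < (\<Sum>b\<in>Basis. V' x b \<bullet> b)"
    and boundary: "\<And>c. 0 < c \<Longrightarrow> \<exists>K. compact K \<and> K \<subseteq> D \<and> (\<forall>x\<in>D - K. w x - v x < c)"
    and x: "x \<in> D"
  shows "w x \<le> v x"
proof (rule ccontr)
  assume "\<not> w x \<le> v x"
  \<comment> \<open>Half of the excess, so w - v = 2c at \<open>x\<close>. The test functions live
    where w - vs n > 5/4 c; as vs n is within c/4 of v, this forces w - v > c, hence membership in
    \<open>K\<close>. The limit threshold 5/4 c is still exceeded at \<open>x\<close>.\<close>
  define c where "c = (w x - v x) / 2"
  have "0 < c" using \<open>\<not> w x \<le> v x\<close> by (simp add: c_def)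
  obtain K where K: "compact K" "K \<subseteq> D" "\<And>y. y \<in> D - K \<Longrightarrow> w y - v y < c"
    using boundary[OF \<open>0 < c\<close>] by blast
  obtain G where G: "weak_gradient S v G"
    and eq: "\<And>\<phi>. test_function S \<phi> \<Longrightarrow> (LINT x:S|lebesgue. (norm (G x) powr (p - 2) *\<^sub>R G x) \<bullet> grad \<phi> x) = 0"
    using harm by (auto simp: p_harmonic_on_def)
  have KS: "K \<subseteq> S" using K D by blast
  have "S \<noteq> {}" using x D by blast
  have L: "0 \<le> L" using lip lipschitz_on_nonneg by blast
  obtain R where R: "D \<subseteq> ball 0 R" using bounded_subset_ballD[OF D(3)] by blast
  have DSR: "D \<subseteq> S \<inter> ball 0 R" using D R by blast
  have KR: "K \<subseteq> S \<inter> ball 0 R" using R K KS by blast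
  obtain v0 where v0: "\<And>n::nat. smooth (v0 n)"
      "\<And>n x. x \<in> S \<inter> ball 0 R \<Longrightarrow> \<bar>v0 n x - v x\<bar> \<le> L / Suc n"
      "\<And>n x b. x \<in> ball 0 R \<Longrightarrow> b \<in> Basis \<Longrightarrow> \<bar>frechet_derivative (v0 n) (at x) b\<bar> \<le> L"
    using lipschitz_smooth_approximation[OF lip \<open>S \<noteq> {}\<close>, of R] by metis
  \<comment> \<open>Dropping the first \<open>N\<close> approximations brings every remaining one
    within c/4 of \<open>v\<close>, while the rate \<open>L / Suc n\<close> persists.\<close>
  obtain N :: nat where N: "4 * L / c < N" using reals_Archimedean2 by blast
  define vs where "vs n = v0 (n + N)" for n
  have vs_smooth: "smooth (vs n)" for n unfolding vs_def by (rule v0(1))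
  have vs_D: "\<bar>frechet_derivative (vs n) (at x) b\<bar> \<le> L" if "x \<in> ball 0 R" "b \<in> Basis" for n x b
    unfolding vs_def by (rule v0(3)[OF that])
  have vs_close: "\<bar>vs n x - v x\<bar> \<le> L / Suc n" "\<bar>vs n x - v x\<bar> < c / 4" if "x \<in> S \<inter> ball 0 R" for n x
  proof -
    have *: "\<bar>vs n x - v x\<bar> \<le> L / Suc (n + N)" unfolding vs_def by (rule v0(2)[OF that])
    moreover have "L / Suc (n + N) \<le> L / Suc n" using L by (intro divide_left_mono) auto
    ultimately show "\<bar>vs n x - v x\<bar> \<le> L / Suc n" by linarith
    have "4 * L < N * c" using N \<open>0 < c\<close> by (simp add: divide_simps mult.commute)
    also have "N * c \<le> Suc (n + N) * c" using \<open>0 < c\<close> by (intro mult_right_mono) auto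
    finally have "L / Suc (n + N) < c / 4" by (simp add: divide_simps mult.commute)
    with * show "\<bar>vs n x - v x\<bar> < c / 4" by linarith
  qed
  have vs_lim: "(\<lambda>n. vs n y) \<longlonglongrightarrow> v y" if "y \<in> S \<inter> ball 0 R" for y
  proof (rule LIM_zero_cancel, rule tendsto_rabs_zero_cancel, rule tendsto_sandwich[OF _ _ tendsto_const])
    show "(\<lambda>n. L * inverse (real (Suc n))) \<longlonglongrightarrow> 0"
      using tendsto_mult_left[OF LIMSEQ_inverse_real_of_nat, of L] by simp
  qed (use vs_close(1)[OF that] in \<open>auto simp: divide_inverse\<close>)
  have contv: "continuous_on K v" using lipschitz_on_continuous_on[OF lip] continuous_on_subset KS by blast
  have bnd: "\<exists>B. \<forall>x\<in>K. \<bar>f x\<bar> \<le> B" if "continuous_on K f" for f :: "'a \<Rightarrow> real"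
    using compact_continuous_image[OF that K(1)] compact_imp_bounded by (fastforce simp: bounded_iff)

  define \<phi> where "\<phi> n y = (if y \<in> D then bump 0 (w y - vs n y - 5/4 * c) else 0)" for n y
  have \<phi>_smooth: "smooth (\<phi> n)" for n
    unfolding \<phi>_def[abs_def]
  proof (intro allI Ck_restrict[OF D(1) compact_imp_closed[OF K(1)] K(2)])
    fix k
    show "Ck k (\<lambda>y. bump 0 (w y - vs n y - 5/4 * c))"
      using w vs_smooth by (intro Ck_bump Ck_diff Ck_const) auto
  next
    fix y assume y: "y \<in> D - K"
    then have "w y - v y < c" "\<bar>vs n y - v y\<bar> < c / 4" using K(3) vs_close(2) DSR by blast+
    then have "\<not> 0 < w y - vs n y - 5/4 * c" by linarith
    then show "bump 0 (w y - vs n y - 5/4 * c) = 0" by (simp only: bump_0 if_False)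
  qed
  have \<phi>0: "\<phi> n y = 0" if "y \<notin> K" for n y
  proof (cases "y \<in> D")
    case True
    then have "w y - v y < c" "\<bar>vs n y - v y\<bar> < c / 4" using that K(3) vs_close(2) DSR by blast+
    then have "\<not> 0 < w y - vs n y - 5/4 * c" by linarith
    then show ?thesis by (simp only: bump_0 \<phi>_def if_False) simp
  qed (simp add: \<phi>_def)
  \<comment> \<open>\<open>P n\<close> is the factor that multiplies the difference of gradients in
    the derivative of \<open>\<phi> n\<close>; \<open>Q\<close> is its limit, with \<open>v\<close>
    in place of \<open>vs n\<close>.\<close>
  define P where "P n y = bump (Suc 0) (w y - vs n y - 5/4 * c)" for n y
  define Q where "Q y = bump (Suc 0) (w y - v y - 5/4 * c)" for y
  let ?Dw = "\<lambda>b x. frechet_derivative w (at x) b" and ?Dv = "\<lambda>n b x. frechet_derivative (vs n) (at x) b"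
  have D\<phi>: "frechet_derivative (\<phi> n) (at y) b = P n y * (?Dw b y - ?Dv n b y)" if "y \<in> D" for n y b
  proof -
    have "((\<lambda>y. bump 0 (w y - vs n y - 5/4 * c)) has_derivative
        (\<lambda>h. bump (Suc 0) (w y - vs n y - 5/4 * c) * (?Dw h y - ?Dv n h y - 0))) (at y)"
      by (rule has_derivative_compose[OF has_derivative_diff[OF has_derivative_diff[OF
            smooth_has_derivative[OF w] smooth_has_derivative[OF vs_smooth]] has_derivative_const]
            bump_DERIV[unfolded has_field_derivative_def]])
    then have "(\<phi> n has_derivative (\<lambda>h. bump (Suc 0) (w y - vs n y - 5/4 * c) * (?Dw h y - ?Dv n h y - 0))) (at y)"
      by (rule has_derivative_transform_within_open[OF _ D(1) that]) (simp add: \<phi>_def)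
    from fun_cong[OF frechet_derivative_at[OF this], of b, symmetric] show ?thesis
      by (simp only: P_def diff_zero)
  qed

  define M where "M = real DIM('a) * L"
  have "AE x in lebesgue_on K. \<forall>b\<in>Basis. \<bar>G x \<bullet> b\<bar> \<le> L"
    by (rule AE_finite_allI) (use weak_gradient_bound[OF S lip G _ K(1) KS] in auto)
  then have GM: "AE x in lebesgue_on K. norm (G x) \<le> M"
  proof eventually_elim
    case (elim x)
    have "norm (G x) \<le> (\<Sum>b\<in>Basis. \<bar>G x \<bullet> b\<bar>)" by (rule norm_le_l1)
    also have "\<dots> \<le> (\<Sum>b\<in>(Basis::'a set). L)" using elim by (intro sum_mono) auto
    finally show ?case by (simp add: M_def)
  qed
  have Gm[measurable]: "G \<in> borel_measurable (lebesgue_on K)"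
  proof (rule borel_measurable_integrable, rule absolutely_integrable_imp_integrable)
    show "G absolutely_integrable_on K"
      using G K(1) KS by (auto simp: weak_gradient_def locally_integrable_def)
  qed (rule compact_sets_lebesgue[OF K(1)])
  \<comment> \<open>The bound on \<open>G\<close> holds only almost everywhere, so its flux is
    truncated to be bounded everywhere. It is bounded for p < 2 as well, its norm being a power with
    exponent p - 1 > 0.\<close>
  define F where "F y = (if norm (G y) \<le> M then norm (G y) powr (p - 2) *\<^sub>R G y else 0)" for y
  have Fm[measurable]: "F \<in> borel_measurable (lebesgue_on K)" unfolding F_def[abs_def] by measurable
  have FM: "norm (F y) \<le> M powr (p - 1)" for y
  proof (cases "norm (G y) \<le> M")
    case True
    then have "norm (F y) = norm (G y) powr (p - 1)"
      using powr_mult_base[of "norm (G y)" "p - 2"] by (simp add: F_def mult.commute)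
    also have "\<dots> \<le> M powr (p - 1)" using True p by (intro powr_mono2) auto
    finally show ?thesis .
  qed (simp add: F_def)
  have contV: "continuous_on K V"
    using has_derivative_continuous_on[OF has_derivative_at_withinI[OF V'(1)]] K(2) continuous_on_subset by blast
  have contVb: "continuous_on K (\<lambda>x. V x \<bullet> b)" for b by (intro continuous_intros contV)
  have contV': "continuous_on K (\<lambda>x. V' x b \<bullet> b)" if "b \<in> Basis" for b
    by (intro continuous_intros continuous_on_subset[OF V'(2)[OF that] K(2)])
  have cont\<phi>: "continuous_on K (\<lambda>x. frechet_derivative (\<phi> n) (at x) b)" if "b \<in> Basis" for b n
    by (rule smooth_continuous_frechet[OF \<phi>_smooth that])
  define H where "H b y = V y \<bullet> b - F y \<bullet> b" for b y
  have Hm[measurable]: "H b \<in> borel_measurable (lebesgue_on K)" for b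
  proof -
    have [measurable]: "(\<lambda>y. V y \<bullet> b) \<in> borel_measurable (lebesgue_on K)"
      by (rule measurable_continuous_compact[OF K(1) contVb])
    show ?thesis unfolding H_def[abs_def] by measurable
  qed
  obtain BV where BV: "\<forall>x\<in>K. \<bar>norm (V x)\<bar> \<le> BV" using bnd[OF continuous_on_norm[OF contV]] by blast
  define BH where "BH = max BV 0 + M powr (p - 1)"
  have BH0: "0 \<le> BH" by (simp add: BH_def)
  have HB: "\<bar>H b y\<bar> \<le> BH" if "y \<in> K" "b \<in> Basis" for b y
  proof -
    have "\<bar>V y \<bullet> b\<bar> \<le> BV" "\<bar>F y \<bullet> b\<bar> \<le> M powr (p - 1)"
      using Basis_le_norm[OF that(2), of "V y"] Basis_le_norm[OF that(2), of "F y"] BV FM[of y] that(1)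
      by (auto intro: order_trans)
    then show ?thesis by (simp add: H_def BH_def)
  qed
  have integ: "integrable (lebesgue_on K) (\<lambda>x. f x * g x)"
    if f: "continuous_on K f" and g: "g \<in> borel_measurable (lebesgue_on K)" "\<And>x. x \<in> K \<Longrightarrow> \<bar>g x\<bar> \<le> B"
    for f g and B :: real
  proof -
    obtain Bf where Bf: "\<forall>x\<in>K. \<bar>f x\<bar> \<le> Bf" using bnd[OF f] by blast
    note [measurable] = measurable_continuous_compact[OF K(1) f] g(1)
    show ?thesis
    proof (rule integrable_bounded_compact[OF K(1), where B = "Bf * B"])
      show "norm (f x * g x) \<le> Bf * B" if "x \<in> K" for x
        using Bf that g(2)[OF that] by (auto simp: abs_mult intro!: mult_mono)
    qed measurable
  qed
  have FB: "\<bar>F y \<bullet> b\<bar> \<le> M powr (p - 1)" if "b \<in> Basis" for b y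
    using Basis_le_norm[OF that, of "F y"] FM[of y] by linarith

  have weak: "(\<Sum>b\<in>Basis. \<integral>x. frechet_derivative (\<phi> n) (at x) b * (F x \<bullet> b) \<partial>lebesgue_on K) = 0" for n
  proof -
    have "0 = (LINT x:S|lebesgue. (norm (G x) powr (p - 2) *\<^sub>R G x) \<bullet> grad (\<phi> n) x)"
      using eq[OF test_functionI[OF \<phi>_smooth K(1) KS \<phi>0]] by simp
    also have "\<dots> = (\<integral>x. (norm (G x) powr (p - 2) *\<^sub>R G x) \<bullet> grad (\<phi> n) x \<partial>lebesgue_on K)"
      using frechet_derivative_eq_0[OF compact_imp_closed[OF K(1)] \<phi>0]
      by (intro set_integral_eq_compact[OF K(1) KS]) (simp add: grad_def)
    also have "\<dots> = (\<integral>x. (\<Sum>b\<in>Basis. frechet_derivative (\<phi> n) (at x) b * (F x \<bullet> b)) \<partial>lebesgue_on K)"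
    proof (rule integral_cong_AE)
      show "AE x in lebesgue_on K. (norm (G x) powr (p - 2) *\<^sub>R G x) \<bullet> grad (\<phi> n) x =
          (\<Sum>b\<in>Basis. frechet_derivative (\<phi> n) (at x) b * (F x \<bullet> b))"
        using GM
      proof eventually_elim
        case (elim x)
        then show ?case by (simp add: F_def grad_def inner_sum_right)
      qed
      have [measurable]: "grad (\<phi> n) \<in> borel_measurable (lebesgue_on K)"
        by (rule measurable_continuous_compact[OF K(1) smooth_continuous_grad[OF \<phi>_smooth]])
      show "(\<lambda>x. (norm (G x) powr (p - 2) *\<^sub>R G x) \<bullet> grad (\<phi> n) x) \<in> borel_measurable (lebesgue_on K)"
        by measurable
      show "(\<lambda>x. \<Sum>b\<in>Basis. frechet_derivative (\<phi> n) (at x) b * (F x \<bullet> b)) \<in> borel_measurable (lebesgue_on K)"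
      proof (rule borel_measurable_sum)
        fix b :: 'a assume b: "b \<in> Basis"
        note [measurable] = measurable_continuous_compact[OF K(1) cont\<phi>[OF b, of n]]
        show "(\<lambda>x. frechet_derivative (\<phi> n) (at x) b * (F x \<bullet> b)) \<in> borel_measurable (lebesgue_on K)"
          by measurable
      qed
    qed
    also have "\<dots> = (\<Sum>b\<in>Basis. \<integral>x. frechet_derivative (\<phi> n) (at x) b * (F x \<bullet> b) \<partial>lebesgue_on K)"
      by (intro Bochner_Integration.integral_sum integ[OF cont\<phi> _ FB]) auto
    finally show ?thesis by simp
  qed
  have classical: "(\<integral>x. frechet_derivative (\<phi> n) (at x) b * (V x \<bullet> b) \<partial>lebesgue_on K) =
      - (\<integral>x. \<phi> n x * (V' x b \<bullet> b) \<partial>lebesgue_on K)" if b: "b \<in> Basis" for n b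
  proof (rule integration_by_parts[OF \<phi>_smooth \<phi>0 K(1,2) D(1) _ _ b, where v = "\<lambda>x. V x \<bullet> b" and v' = "\<lambda>x h. V' x h \<bullet> b"])
    show "((\<lambda>x. V x \<bullet> b) has_derivative (\<lambda>h. V' x h \<bullet> b)) (at x)" if "x \<in> D" for x
      by (rule has_derivative_inner_left[OF V'(1)[OF that]])
  qed (assumption | rule contV'[OF b])+
  define dV where "dV x = (\<Sum>b\<in>Basis. V' x b \<bullet> b)" for x
  have contdV: "continuous_on K dV" unfolding dV_def[abs_def] by (intro continuous_on_sum contV')
  \<comment> \<open>The weak equation for \<open>v\<close> is subtracted from the classical formula
    for the flux of \<open>w\<close>. The derivatives of \<open>vs n\<close> enter only linearly, in
    the last factor, and \<open>H\<close> does not depend on n.\<close>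
  have identity: "(\<Sum>b\<in>Basis. \<integral>x. P n x * H b x * (?Dw b x - ?Dv n b x) \<partial>lebesgue_on K) =
      - (\<integral>x. \<phi> n x * dV x \<partial>lebesgue_on K)" for n
  proof -
    have "(\<integral>x. P n x * H b x * (?Dw b x - ?Dv n b x) \<partial>lebesgue_on K) =
       (\<integral>x. frechet_derivative (\<phi> n) (at x) b * (V x \<bullet> b) \<partial>lebesgue_on K) -
       (\<integral>x. frechet_derivative (\<phi> n) (at x) b * (F x \<bullet> b) \<partial>lebesgue_on K)" if b: "b \<in> Basis" for b
    proof -
      have "(\<integral>x. P n x * H b x * (?Dw b x - ?Dv n b x) \<partial>lebesgue_on K) =
        (\<integral>x. frechet_derivative (\<phi> n) (at x) b * (V x \<bullet> b) - frechet_derivative (\<phi> n) (at x) b * (F x \<bullet> b) \<partial>lebesgue_on K)"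
        using K(2) by (intro Bochner_Integration.integral_cong) (auto simp: D\<phi> H_def algebra_simps)
      also have "\<dots> = (\<integral>x. frechet_derivative (\<phi> n) (at x) b * (V x \<bullet> b) \<partial>lebesgue_on K) -
       (\<integral>x. frechet_derivative (\<phi> n) (at x) b * (F x \<bullet> b) \<partial>lebesgue_on K)"
        by (intro Bochner_Integration.integral_diff integ[OF cont\<phi>[OF b] _ FB[OF b]]
            integrable_continuous_compact[OF K(1)] continuous_on_mult cont\<phi>[OF b] contVb) auto
      finally show ?thesis .
    qed
    then have "(\<Sum>b\<in>Basis. \<integral>x. P n x * H b x * (?Dw b x - ?Dv n b x) \<partial>lebesgue_on K) =
       (\<Sum>b\<in>Basis. - (\<integral>x. \<phi> n x * (V' x b \<bullet> b) \<partial>lebesgue_on K))"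
      using weak[of n] classical[of _ n] by (simp add: sum_subtractf)
    also have "\<dots> = - (\<integral>x. (\<Sum>b\<in>Basis. \<phi> n x * (V' x b \<bullet> b)) \<partial>lebesgue_on K)"
      unfolding sum_negf
      by (subst Bochner_Integration.integral_sum)
         (auto intro!: integrable_continuous_compact[OF K(1)] continuous_on_mult smooth_continuous[OF \<phi>_smooth] contV')
    finally show ?thesis by (simp add: dV_def sum_distrib_left)
  qed

  obtain Bw where Bw: "\<forall>x\<in>K. \<bar>w x - v x\<bar> \<le> Bw"
    using bnd[OF continuous_on_diff[OF smooth_continuous[OF w] contv]] by blast
  have arg: "\<bar>w y - vs n y - 5/4 * c\<bar> \<le> Bw + 2 * c" "\<bar>w y - v y - 5/4 * c\<bar> \<le> Bw + 2 * c" if "y \<in> K" for n y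
  proof -
    have "\<bar>vs n y - v y\<bar> < c / 4" "\<bar>w y - v y\<bar> \<le> Bw" using vs_close(2) KR that Bw by blast+
    then show "\<bar>w y - vs n y - 5/4 * c\<bar> \<le> Bw + 2 * c" "\<bar>w y - v y - 5/4 * c\<bar> \<le> Bw + 2 * c"
      using \<open>0 < c\<close> by arith+
  qed
  obtain B0 where B0: "\<And>t. \<bar>t\<bar> \<le> Bw + 2 * c \<Longrightarrow> \<bar>bump 0 t\<bar> \<le> B0" using bump_bounded by blast
  obtain B1 where B1: "\<And>t. \<bar>t\<bar> \<le> Bw + 2 * c \<Longrightarrow> \<bar>bump (Suc 0) t\<bar> \<le> B1" using bump_bounded by blast
  have PB: "\<bar>P n y\<bar> \<le> B1" "\<bar>Q y\<bar> \<le> B1" if "y \<in> K" for n y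
    using arg[OF that] B1 by (auto simp: P_def Q_def)
  have contP: "continuous_on K (P n)" for n unfolding P_def[abs_def]
    by (intro continuous_intros smooth_continuous w vs_smooth)
  have contQ: "continuous_on K Q" unfolding Q_def[abs_def]
    by (intro continuous_intros smooth_continuous w contv)
  have Pm[measurable]: "P n \<in> borel_measurable (lebesgue_on K)" for n by (rule measurable_continuous_compact[OF K(1) contP])
  have Qm[measurable]: "Q \<in> borel_measurable (lebesgue_on K)" by (rule measurable_continuous_compact[OF K(1) contQ])
  have Plim: "(\<lambda>n. P n y) \<longlonglongrightarrow> Q y" if "y \<in> K" for y
    unfolding P_def Q_def using KR that by (intro tendsto_bump tendsto_intros vs_lim) auto
  have lhs: "(\<lambda>n. \<integral>x. P n x * H b x * (?Dw b x - ?Dv n b x) \<partial>lebesgue_on K) \<longlonglongrightarrow>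
     (\<integral>x. Q x * H b x * (?Dw b x - G x \<bullet> b) \<partial>lebesgue_on K)" if b: "b \<in> Basis" for b
  proof -
    have contDw: "continuous_on K (?Dw b)" by (rule smooth_continuous_frechet[OF w b])
    have contDv: "continuous_on K (?Dv n b)" for n by (rule smooth_continuous_frechet[OF vs_smooth b])
    have [measurable]: "?Dw b \<in> borel_measurable (lebesgue_on K)" "?Dv n b \<in> borel_measurable (lebesgue_on K)" for n
      by (rule measurable_continuous_compact[OF K(1)], rule contDw contDv)+
    obtain Bd where Bd: "\<forall>x\<in>K. \<bar>?Dw b x\<bar> \<le> Bd" using bnd[OF contDw] by blast
    have dB: "\<bar>?Dw b x - ?Dv n b x\<bar> \<le> Bd + L" if "x \<in> K" for x n
    proof -
      have "\<bar>?Dw b x\<bar> \<le> Bd" "\<bar>?Dv n b x\<bar> \<le> L" using Bd that vs_D[of x b n] KR b by auto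
      then show ?thesis by linarith
    qed
    have QHm: "(\<lambda>x. Q x * H b x) \<in> borel_measurable (lebesgue_on K)" by measurable
    have QHB: "\<bar>Q x * H b x\<bar> \<le> B1 * BH" if "x \<in> K" for x
      unfolding abs_mult using PB(2)[OF that] HB[OF that b] by (intro mult_mono) auto
    have B1: "0 \<le> B1"
    proof -
      have "x \<in> K"
        using K(3)[of x] x \<open>0 < c\<close> by (auto simp: c_def)
      from PB(2)[OF this] show ?thesis by linarith
    qed
    \<comment> \<open>Replacing \<open>P n\<close> by \<open>Q\<close> has vanishing cost, as all
      other factors are bounded uniformly in n. Then \<open>Q x * H b x\<close> is a fixed bounded
      multiplier, to which weak convergence of the derivatives applies.\<close>
    have "(\<lambda>n. \<integral>x. (P n x - Q x) * H b x * (?Dw b x - ?Dv n b x) \<partial>lebesgue_on K) \<longlonglongrightarrow> (\<integral>x. 0 \<partial>lebesgue_on K)"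
    proof (rule bounded_convergence_compact[OF K(1), where B = "2 * B1 * BH * (Bd + L)"])
      show "\<bar>(P n x - Q x) * H b x * (?Dw b x - ?Dv n b x)\<bar> \<le> 2 * B1 * BH * (Bd + L)" if "x \<in> K" for n x
      proof -
        have "\<bar>P n x - Q x\<bar> \<le> 2 * B1" using PB(1)[OF that, of n] PB(2)[OF that] by linarith
        then show ?thesis unfolding abs_mult
          using HB[OF that b] dB[OF that, of n] B1 BH0 by (intro mult_mono) auto
      qed
      have "(\<lambda>n. (P n x - Q x) * H b x * (?Dw b x - ?Dv n b x)) \<longlonglongrightarrow> 0" if xK: "x \<in> K" for x
      proof (rule tendsto_rabs_zero_cancel, rule tendsto_sandwich[OF _ _ tendsto_const])
        show "(\<lambda>n. \<bar>P n x - Q x\<bar> * (BH * (Bd + L))) \<longlonglongrightarrow> 0"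
          using tendsto_mult_right[OF tendsto_rabs[OF LIM_zero[OF Plim[OF xK]]], of "BH * (Bd + L)"] by simp
        show "\<forall>\<^sub>F n in sequentially. \<bar>(P n x - Q x) * H b x * (?Dw b x - ?Dv n b x)\<bar> \<le> \<bar>P n x - Q x\<bar> * (BH * (Bd + L))"
          unfolding abs_mult mult.assoc
          using HB[OF xK b] dB[OF xK] BH0 by (intro always_eventually allI mult_left_mono mult_mono) auto
      qed auto
      then show "AE x in lebesgue_on K. (\<lambda>n. (P n x - Q x) * H b x * (?Dw b x - ?Dv n b x)) \<longlonglongrightarrow> 0"
        by (intro AE_I2) auto
    qed measurable
    then have l1: "(\<lambda>n. \<integral>x. (P n x - Q x) * H b x * (?Dw b x - ?Dv n b x) \<partial>lebesgue_on K) \<longlonglongrightarrow> 0" by simp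
    have l2: "(\<lambda>n. \<integral>x. (Q x * H b x) * ?Dv n b x \<partial>lebesgue_on K) \<longlonglongrightarrow> (\<integral>x. (Q x * H b x) * (G x \<bullet> b) \<partial>lebesgue_on K)"
      using weak_gradient_convergence[OF S lip G b vs_smooth vs_close(1) vs_D[OF _ b] K(1) KR QHm QHB] B1 BH0 by simp
    have i0: "integrable (lebesgue_on K) (\<lambda>x. (Q x * H b x) * ?Dw b x)"
      using integ[OF contDw QHm QHB] by (simp add: mult.commute)
    have i1: "integrable (lebesgue_on K) (\<lambda>x. (Q x * H b x) * ?Dv n b x)" for n
      using integ[OF contDv QHm QHB] by (simp add: mult.commute)
    have i2: "integrable (lebesgue_on K) (\<lambda>x. (P n x - Q x) * H b x * (?Dw b x - ?Dv n b x))" for n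
      using integ[OF continuous_on_mult[OF continuous_on_diff[OF contP contQ] continuous_on_diff[OF contDw contDv]] Hm HB[OF _ b]]
      by (simp add: mult_ac)
    have i3: "integrable (lebesgue_on K) (\<lambda>x. (Q x * H b x) * (G x \<bullet> b))"
    proof (rule Bochner_Integration.integrable_bound)
      show "integrable (lebesgue_on K) (\<lambda>x. (B1 * BH) * (G x \<bullet> b))"
        using weak_gradient_component_integrable[OF S lip G b K(1) KS] by simp
      show "AE x in lebesgue_on K. norm (Q x * H b x * (G x \<bullet> b)) \<le> norm (B1 * BH * (G x \<bullet> b))"
        using QHB B1 BH0 by (intro AE_I2) (auto simp: abs_mult intro!: mult_right_mono)
    qed measurable
    have "(\<integral>x. P n x * H b x * (?Dw b x - ?Dv n b x) \<partial>lebesgue_on K) =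
       (\<integral>x. (P n x - Q x) * H b x * (?Dw b x - ?Dv n b x) \<partial>lebesgue_on K) +
       ((\<integral>x. (Q x * H b x) * ?Dw b x \<partial>lebesgue_on K) - (\<integral>x. (Q x * H b x) * ?Dv n b x \<partial>lebesgue_on K))" for n
    proof -
      have "P n x * H b x * (?Dw b x - ?Dv n b x) = (P n x - Q x) * H b x * (?Dw b x - ?Dv n b x) +
         ((Q x * H b x) * ?Dw b x - (Q x * H b x) * ?Dv n b x)" for x
        by (simp add: algebra_simps)
      then show ?thesis
        using i0 i1[of n] i2[of n] by (simp only: Bochner_Integration.integral_add Bochner_Integration.integral_diff
            Bochner_Integration.integrable_diff)
    qed
    moreover have "(\<lambda>n. (\<integral>x. (P n x - Q x) * H b x * (?Dw b x - ?Dv n b x) \<partial>lebesgue_on K) +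
       ((\<integral>x. (Q x * H b x) * ?Dw b x \<partial>lebesgue_on K) - (\<integral>x. (Q x * H b x) * ?Dv n b x \<partial>lebesgue_on K)))
      \<longlonglongrightarrow> 0 + ((\<integral>x. (Q x * H b x) * ?Dw b x \<partial>lebesgue_on K) - (\<integral>x. (Q x * H b x) * (G x \<bullet> b) \<partial>lebesgue_on K))"
      by (intro tendsto_intros l1 l2)
    moreover have "(\<integral>x. (Q x * H b x) * ?Dw b x \<partial>lebesgue_on K) - (\<integral>x. (Q x * H b x) * (G x \<bullet> b) \<partial>lebesgue_on K)
      = (\<integral>x. Q x * H b x * (?Dw b x - G x \<bullet> b) \<partial>lebesgue_on K)"
      by (simp only: Bochner_Integration.integral_diff[OF i0 i3, symmetric] right_diff_distrib)
    ultimately show ?thesis by simp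
  qed
  define \<phi>\<^sub>0 where "\<phi>\<^sub>0 y = bump 0 (w y - v y - 5/4 * c)" for y
  have cont\<phi>0: "continuous_on K \<phi>\<^sub>0" unfolding \<phi>\<^sub>0_def[abs_def]
    by (intro continuous_intros smooth_continuous w contv)
  have rhs: "(\<lambda>n. \<integral>x. \<phi> n x * dV x \<partial>lebesgue_on K) \<longlonglongrightarrow> (\<integral>x. \<phi>\<^sub>0 x * dV x \<partial>lebesgue_on K)"
  proof -
    obtain Bd where Bd: "\<forall>x\<in>K. \<bar>dV x\<bar> \<le> Bd" using bnd[OF contdV] by blast
    show ?thesis
    proof (rule bounded_convergence_compact[OF K(1), where B = "B0 * Bd"])
      show "(\<lambda>x. \<phi> n x * dV x) \<in> borel_measurable (lebesgue_on K)" for n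
        by (intro measurable_continuous_compact K continuous_on_mult contdV smooth_continuous[OF \<phi>_smooth])
      show "(\<lambda>x. \<phi>\<^sub>0 x * dV x) \<in> borel_measurable (lebesgue_on K)"
        by (intro measurable_continuous_compact K continuous_on_mult contdV cont\<phi>0)
      show "\<bar>\<phi> n x * dV x\<bar> \<le> B0 * Bd" if "x \<in> K" for n x
      proof -
        have "\<bar>\<phi> n x\<bar> \<le> B0" using that K(2) B0[OF arg(1)[OF that]] by (auto simp: \<phi>_def)
        then show ?thesis unfolding abs_mult using Bd that by (intro mult_mono) auto
      qed
      have "(\<lambda>n. \<phi> n x * dV x) \<longlonglongrightarrow> \<phi>\<^sub>0 x * dV x" if "x \<in> K" for x
      proof -
        have "(\<lambda>n. bump 0 (w x - vs n x - 5/4 * c)) \<longlonglongrightarrow> bump 0 (w x - v x - 5/4 * c)"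
          using KR that by (intro tendsto_bump tendsto_intros vs_lim) auto
        then show ?thesis using that K(2) by (auto simp: \<phi>_def \<phi>\<^sub>0_def intro!: tendsto_intros)
      qed
      then show "AE x in lebesgue_on K. (\<lambda>n. \<phi> n x * dV x) \<longlonglongrightarrow> \<phi>\<^sub>0 x * dV x" by (intro AE_I2) auto
    qed
  qed
  have "(\<lambda>n. \<Sum>b\<in>Basis. \<integral>x. P n x * H b x * (?Dw b x - ?Dv n b x) \<partial>lebesgue_on K) \<longlonglongrightarrow>
     (\<Sum>b\<in>Basis. \<integral>x. Q x * H b x * (?Dw b x - G x \<bullet> b) \<partial>lebesgue_on K)"
    by (intro tendsto_sum lhs)
  then have limit_identity: "(\<Sum>b\<in>Basis. \<integral>x. Q x * H b x * (?Dw b x - G x \<bullet> b) \<partial>lebesgue_on K) =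
      - (\<integral>x. \<phi>\<^sub>0 x * dV x \<partial>lebesgue_on K)"
    unfolding identity using tendsto_minus[OF rhs] LIMSEQ_unique by blast
  have i4: "integrable (lebesgue_on K) (\<lambda>x. Q x * H b x * (?Dw b x - G x \<bullet> b))" if b: "b \<in> Basis" for b
  proof -
    have QHm: "(\<lambda>x. Q x * H b x) \<in> borel_measurable (lebesgue_on K)" by measurable
    have QHB: "\<bar>Q x * H b x\<bar> \<le> B1 * BH" if "x \<in> K" for x
      unfolding abs_mult using PB(2)[OF that] HB[OF that b] by (intro mult_mono) auto
    have "integrable (lebesgue_on K) (\<lambda>x. ?Dw b x - G x \<bullet> b)"
      by (intro Bochner_Integration.integrable_diff integrable_continuous_compact[OF K(1)] smooth_continuous_frechet[OF w b]
          weak_gradient_component_integrable[OF S lip G b K(1) KS])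
    from integrable_mult_right[OF this, of "B1 * BH"] show ?thesis
    proof (rule Bochner_Integration.integrable_bound)
      have [measurable]: "?Dw b \<in> borel_measurable (lebesgue_on K)"
        by (rule measurable_continuous_compact[OF K(1) smooth_continuous_frechet[OF w b]])
      show "(\<lambda>x. Q x * H b x * (?Dw b x - G x \<bullet> b)) \<in> borel_measurable (lebesgue_on K)" by measurable
      show "AE x in lebesgue_on K. norm (Q x * H b x * (?Dw b x - G x \<bullet> b)) \<le> norm (B1 * BH * (?Dw b x - G x \<bullet> b))"
      proof (intro AE_I2)
        fix x assume "x \<in> space (lebesgue_on K)"
        then have "\<bar>Q x * H b x\<bar> \<le> \<bar>B1 * BH\<bar>" using QHB by fastforce
        then show "norm (Q x * H b x * (?Dw b x - G x \<bullet> b)) \<le> norm (B1 * BH * (?Dw b x - G x \<bullet> b))"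
          unfolding real_norm_def abs_mult by (intro mult_right_mono) (auto simp: abs_mult)
      qed
    qed
  qed
  \<comment> \<open>In the limit the integrand is \<open>Q\<close> times the monotonicity expression
    of the flux, so the left side of the identity is nonnegative, whereas the right side is
    nonpositive because the divergence \<open>dV\<close> is positive.\<close>
  have "0 \<le> (\<integral>x. (\<Sum>b\<in>Basis. Q x * H b x * (?Dw b x - G x \<bullet> b)) \<partial>lebesgue_on K)"
  proof (rule integral_nonneg_AE)
    show "AE x in lebesgue_on K. 0 \<le> (\<Sum>b\<in>Basis. Q x * H b x * (?Dw b x - G x \<bullet> b))"
      using GM
    proof eventually_elim
      case (elim x)
      have "(\<Sum>b\<in>Basis. H b x * (?Dw b x - G x \<bullet> b)) = (\<Sum>b\<in>Basis. ((V x - F x) \<bullet> b) * ((grad w x - G x) \<bullet> b))"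
        by (intro sum.cong) (auto simp: H_def inner_diff_left grad_inner_Basis)
      also have "\<dots> = (V x - F x) \<bullet> (grad w x - G x)" by (rule euclidean_inner[symmetric])
      also have "0 \<le> \<dots>" using elim flux_monotone[OF p, of "grad w x" "G x"] by (simp add: V_def F_def)
      finally have "0 \<le> Q x * (\<Sum>b\<in>Basis. H b x * (?Dw b x - G x \<bullet> b))"
        unfolding Q_def by (intro mult_nonneg_nonneg bump_1_nonneg)
      then show ?case by (simp add: sum_distrib_left mult.assoc)
    qed
  qed
  then have "(\<integral>x. \<phi>\<^sub>0 x * dV x \<partial>lebesgue_on K) \<le> 0"
    using limit_identity by (subst (asm) Bochner_Integration.integral_sum) (use i4 in auto)
  moreover have nn: "0 \<le> \<phi>\<^sub>0 x * dV x" if "x \<in> K" for x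
    unfolding \<phi>\<^sub>0_def dV_def using V'(3)[of x] that K(2) by (intro mult_nonneg_nonneg bump_nonneg) auto
  moreover have "0 \<le> (\<integral>x. \<phi>\<^sub>0 x * dV x \<partial>lebesgue_on K)"
    using nn by (intro Bochner_Integration.integral_nonneg) auto
  moreover have "integrable (lebesgue_on K) (\<lambda>x. \<phi>\<^sub>0 x * dV x)"
    by (intro integrable_continuous_compact K continuous_on_mult contdV cont\<phi>0)
  ultimately have "AE x in lebesgue_on K. \<phi>\<^sub>0 x * dV x = 0"
    using integral_nonneg_eq_0_iff_AE[of "lebesgue_on K" "\<lambda>x. \<phi>\<^sub>0 x * dV x"] by force
  then have "AE x in lebesgue. x \<in> K \<longrightarrow> \<phi>\<^sub>0 x * dV x = 0"
    using compact_sets_lebesgue[OF K(1)] by (subst (asm) AE_restrict_space_iff) auto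
  then obtain Z where Z: "Z \<in> null_sets lebesgue" "{x. \<not> (x \<in> K \<longrightarrow> \<phi>\<^sub>0 x * dV x = 0)} \<subseteq> Z"
    by (auto simp: eventually_ae_filter)
  \<comment> \<open>Both factors of \<open>\<phi>\<^sub>0 x * dV x\<close> are positive on this
    nonempty open set, which would therefore have to be null.\<close>
  let ?U = "{y \<in> D. 5/4 * c < w y - v y}"
  have "continuous_on D (\<lambda>y. w y - v y)"
    using continuous_on_subset[OF lipschitz_on_continuous_on[OF lip] D(2)] smooth_continuous[OF w]
    by (intro continuous_on_diff)
  from continuous_open_preimage[OF this D(1) open_greaterThan, of "5/4 * c"]
  have "open ?U" by (simp add: vimage_def Int_def)
  moreover have "x \<in> ?U" using x \<open>0 < c\<close> by (simp add: c_def field_simps)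
  moreover have "?U \<subseteq> Z"
  proof
    fix y assume y: "y \<in> ?U"
    then have "y \<in> K" using K(3)[of y] \<open>0 < c\<close> by force
    moreover have "0 < \<phi>\<^sub>0 y * dV y"
      using y V'(3)[of y] by (simp add: \<phi>\<^sub>0_def dV_def bump_pos_iff)
    ultimately show "y \<in> Z" using Z(2) by force
  qed
  moreover have "negligible Z" using Z(1) by (simp add: negligible_iff_null_sets)
  ultimately have "open ?U" "?U \<noteq> {}" "negligible ?U" using negligible_subset by blast+
  then show False using open_not_negligible by blast
qed

subsection \<open>Barriers on ellipsoids\<close>

lemma flux_has_derivative:
  fixes W :: "'a::real_inner \<Rightarrow> 'b::real_inner"
  assumes "(W has_derivative W') (at x)" "W x \<noteq> 0"
  shows "((\<lambda>x. norm (W x) powr (p - 2) *\<^sub>R W x) has_derivative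
    (\<lambda>h. norm (W x) powr (p - 2) *\<^sub>R (W' h + ((p - 2) * (W' h \<bullet> W x) / (norm (W x))\<^sup>2) *\<^sub>R W x))) (at x)"
proof -
  have "((\<lambda>x. norm (W x)) has_derivative (\<lambda>h. W' h \<bullet> sgn (W x))) (at x)"
    using has_derivative_compose[OF assms(1) has_derivative_norm[OF assms(2)]] by (simp add: inner_commute)
  from has_derivative_powr[OF this has_derivative_const, of "p - 2"] assms(2)
  have "((\<lambda>x. norm (W x) powr (p - 2)) has_derivative
      (\<lambda>h. norm (W x) powr (p - 2) * ((W' h \<bullet> sgn (W x)) * (p - 2) / norm (W x)))) (at x)"
    by simp
  from has_derivative_scaleR[OF this assms(1)] show ?thesis
    by (rule has_derivative_eq_rhs)
       (simp add: fun_eq_iff sgn_div_norm scaleR_add_right power2_eq_square divide_inverse mult_ac)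
qed

lemma grad_eqI:
  assumes "(f has_derivative (\<lambda>h. h \<bullet> v)) (at x)"
  shows "grad f x = v"
  unfolding grad_def frechet_derivative_at[OF assms, symmetric]
  using euclidean_representation[of v] by (simp add: inner_commute)

text \<open>At \<open>x0\<close> the form \<open>q\<close> below has gradient
  \<open>- (2 * tau) *\<^sub>R e\<close> by \<open>M_center\<close> and, with \<open>height\<close>,
  the value \<open>tau\<^sup>2\<close>; this is the tangency of the ellipsoid. \<open>lam\<close>
  and \<open>Lam\<close> bound the eccentricity and are parameters so that estimates can be uniform
  over a family of ellipsoids.\<close>

locale barrier_geometry =
  fixes M :: "'a::euclidean_space \<Rightarrow> 'a" and lam Lam tau :: real and x0 z e :: 'a
  assumes M_linear: "linear M" and M_sym: "\<And>v w. M v \<bullet> w = v \<bullet> M w"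
    and lam_pos: "0 < lam" and M_lower: "\<And>v. lam * (norm v)\<^sup>2 \<le> M v \<bullet> v"
    and M_upper: "\<And>v. norm (M v) \<le> Lam * norm v"
    and M_center: "M (z - x0) = tau *\<^sub>R e" and height: "(z - x0) \<bullet> e = tau" and tau_pos: "0 < tau"
begin

definition q :: "'a \<Rightarrow> real" where "q x = M (x - z) \<bullet> (x - z)"

text \<open>The ellipsoid centred at \<open>z\<close> which touches the hyperplane through \<open>x0\<close> orthogonal to \<open>e\<close> at \<open>x0\<close>.\<close>

definition ellipsoid :: "'a set" where "ellipsoid = {x. q x < tau\<^sup>2}"

definition barrier :: "real \<Rightarrow> real \<Rightarrow> real \<Rightarrow> 'a \<Rightarrow> real" where
  "barrier \<mu> A g x = \<mu> * ((x - x0) \<bullet> e) + A * (exp (- g * q x) - exp (- g * tau\<^sup>2))"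

definition barrier_grad :: "real \<Rightarrow> real \<Rightarrow> real \<Rightarrow> 'a \<Rightarrow> 'a" where
  "barrier_grad \<mu> A g x = \<mu> *\<^sub>R e - (2 * g * A * exp (- g * q x)) *\<^sub>R M (x - z)"

text \<open>Expansion about the contact point: x is in the ellipsoid exactly when the form of x - x0
  is less than \<open>2 * tau * ((x - x0) \<bullet> e)\<close>. With \<open>M_lower\<close> this is
  the control of |x - x0|^2 by the height over the hyperplane.\<close>

lemma q_shift: "q x = M (x - x0) \<bullet> (x - x0) - 2 * tau * ((x - x0) \<bullet> e) + tau\<^sup>2"
proof -
  define X Z where "X = x - x0" and "Z = z - x0"
  have "x - z = X - Z" by (simp add: X_def Z_def)
  then have "q x = M X \<bullet> X - M X \<bullet> Z - M Z \<bullet> X + M Z \<bullet> Z"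
    by (simp add: q_def linear_diff[OF M_linear] inner_diff_left inner_diff_right)
  also have "M X \<bullet> Z = M Z \<bullet> X" using M_sym[of X Z] by (simp add: inner_commute)
  also have "M Z = tau *\<^sub>R e" using M_center by (simp add: Z_def)
  finally show ?thesis
    using height by (simp add: X_def Z_def inner_commute power2_eq_square)
qed

lemma q_lower: "lam * (norm (x - z))\<^sup>2 \<le> q x"
  unfolding q_def by (rule M_lower)

lemma q_nonneg: "0 \<le> q x"
  using q_lower[of x] lam_pos by (smt (verit) mult_nonneg_nonneg zero_le_power2)

lemma M_norm_lower: "lam * norm v \<le> norm (M v)"
proof (cases "v = 0")
  case False
  have "lam * norm v * norm v \<le> norm (M v) * norm v"
    using M_lower[of v] norm_cauchy_schwarz[of "M v" v] by (simp add: power2_eq_square mult.assoc)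
  then show ?thesis using False by simp
qed simp

lemma M_has_derivative: "((\<lambda>x. M (x - z)) has_derivative M) (at x)"
proof -
  have "((\<lambda>x. x - z) has_derivative (\<lambda>h. h)) (at x)" by (auto intro!: derivative_eq_intros)
  from bounded_linear.has_derivative[OF linear_conv_bounded_linear[THEN iffD1, OF M_linear] this]
  show ?thesis .
qed

lemma q_has_derivative: "(q has_derivative (\<lambda>h. 2 * (M (x - z) \<bullet> h))) (at x)"
proof -
  from has_derivative_inner[OF M_has_derivative has_derivative_diff[OF has_derivative_ident has_derivative_const], of z]
  show ?thesis unfolding q_def[abs_def]
    by (rule has_derivative_eq_rhs) (simp add: fun_eq_iff M_sym inner_commute)
qed

lemma exp_q_has_derivative:
  "((\<lambda>x. exp (- g * q x)) has_derivative (\<lambda>h. exp (- g * q x) * (- g * (2 * (M (x - z) \<bullet> h))))) (at x)"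
  by (rule has_derivative_compose[OF has_derivative_mult_right[OF q_has_derivative]
        DERIV_exp[unfolded has_field_derivative_def]])

lemma barrier_smooth: "smooth (barrier \<mu> A g)"
proof -
  have q: "q = (\<lambda>x. \<Sum>b\<in>Basis. (x \<bullet> M b - z \<bullet> M b) * (x \<bullet> b - z \<bullet> b))"
  proof
    fix x
    have "q x = (\<Sum>b\<in>Basis. (M (x - z) \<bullet> b) * ((x - z) \<bullet> b))" unfolding q_def by (rule euclidean_inner)
    then show "q x = (\<Sum>b\<in>Basis. (x \<bullet> M b - z \<bullet> M b) * (x \<bullet> b - z \<bullet> b))"
      by (simp only: M_sym inner_diff_left)
  qed
  have lin: "smooth (\<lambda>x. x \<bullet> v - a)" for v :: 'a and a by (intro allI Ck_diff Ck_inner Ck_const)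
  have "smooth q" unfolding q using lin by (intro allI Ck_sum Ck_mult) blast+
  then show ?thesis
    unfolding barrier_def[abs_def] inner_diff_left using lin
    by (intro allI Ck_add Ck_cmult Ck_diff Ck_exp Ck_const Ck_inner) auto
qed

lemma barrier_has_derivative: "(barrier \<mu> A g has_derivative (\<lambda>h. h \<bullet> barrier_grad \<mu> A g x)) (at x)"
proof -
  have "((\<lambda>x. (x - x0) \<bullet> e) has_derivative (\<lambda>h. h \<bullet> e)) (at x)"
    by (auto intro!: derivative_eq_intros)
  from has_derivative_add[OF has_derivative_mult_right[OF this, of \<mu>]
      has_derivative_mult_right[OF has_derivative_diff[OF exp_q_has_derivative has_derivative_const], of A]]
  show ?thesis unfolding barrier_def[abs_def]
    by (rule has_derivative_eq_rhs) (simp add: fun_eq_iff barrier_grad_def inner_diff_right inner_commute)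
qed

lemma grad_barrier: "grad (barrier \<mu> A g) x = barrier_grad \<mu> A g x"
  by (rule grad_eqI[OF barrier_has_derivative])

lemma barrier_grad_has_derivative:
  "(barrier_grad \<mu> A g has_derivative
    (\<lambda>h. (2 * g * A * exp (- g * q x)) *\<^sub>R ((2 * g * (M (x - z) \<bullet> h)) *\<^sub>R M (x - z) - M h))) (at x)"
proof -
  from has_derivative_diff[OF has_derivative_const[of "\<mu> *\<^sub>R e"] has_derivative_scaleR[OF
      has_derivative_mult_right[OF exp_q_has_derivative[of g x], of "2 * g * A"] M_has_derivative]]
  show ?thesis unfolding barrier_grad_def[abs_def]
    by (rule has_derivative_eq_rhs) (simp add: fun_eq_iff scaleR_diff_right mult_ac)
qed

text \<open>The second derivative of the exponential is, up to a positive factor, the form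
  \<open>2 g (M d \<otimes> M d) - M\<close> with \<open>d = x - z\<close>; for large \<open>g\<close> its first term dominates, whatever the direction of the gradient.\<close>

lemma barrier_divergence_pos:
  fixes W :: 'a and p :: real
  assumes p: "1 < p" and W: "W \<noteq> 0" and k: "0 < k" and g: "0 \<le> g" and s: "0 < s" "s \<le> norm d"
    and large: "(DIM('a) + \<bar>p - 2\<bar>) * Lam < 2 * g * min 1 (p - 1) * lam\<^sup>2 * s\<^sup>2"
  shows "0 < (\<Sum>b\<in>Basis. (norm W powr (p - 2) *\<^sub>R
      (k *\<^sub>R ((2 * g * (M d \<bullet> b)) *\<^sub>R M d - M b) +
        ((p - 2) * ((k *\<^sub>R ((2 * g * (M d \<bullet> b)) *\<^sub>R M d - M b)) \<bullet> W) / (norm W)\<^sup>2) *\<^sub>R W)) \<bullet> b)"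
proof -
  let ?m = "M d" and ?N = "(norm W)\<^sup>2"
  have N: "0 < ?N" using W by simp
  have s1: "(\<Sum>b\<in>Basis. (v \<bullet> b) * (w \<bullet> b)) = v \<bullet> w" for v w :: 'a by (rule euclidean_inner[symmetric])
  have s2: "(\<Sum>b\<in>Basis. (M b \<bullet> W) * (W \<bullet> b)) = M W \<bullet> W"
  proof -
    have "M b \<bullet> W = M W \<bullet> b" for b using M_sym[of b W] by (simp add: inner_commute)
    then have "(\<Sum>b\<in>Basis. (M b \<bullet> W) * (W \<bullet> b)) = (\<Sum>b\<in>Basis. (M W \<bullet> b) * (W \<bullet> b))"
      by (intro sum.cong refl arg_cong2[where f = "(*)"])
    then show ?thesis by (simp only: s1)
  qed
  define tr where "tr = (\<Sum>b\<in>Basis. M b \<bullet> b)"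
  have "(\<Sum>b\<in>Basis. (norm W powr (p - 2) *\<^sub>R
      (k *\<^sub>R ((2 * g * (?m \<bullet> b)) *\<^sub>R ?m - M b) +
        ((p - 2) * ((k *\<^sub>R ((2 * g * (?m \<bullet> b)) *\<^sub>R ?m - M b)) \<bullet> W) / ?N) *\<^sub>R W)) \<bullet> b) =
    (\<Sum>b\<in>Basis. norm W powr (p - 2) * k * (2 * g * ((?m \<bullet> b) * (?m \<bullet> b)) - M b \<bullet> b +
        (p - 2) / ?N * (2 * g * (?m \<bullet> W) * ((?m \<bullet> b) * (W \<bullet> b)) - (M b \<bullet> W) * (W \<bullet> b))))"
  proof (intro sum.cong refl)
    have alg: "n * (k * (2 * g * x * x - y) + (pp * (k * (2 * g * x * w - u)) / N) * v) =
        n * k * (2 * g * (x * x) - y + pp / N * (2 * g * w * (x * v) - u * v))"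
      for n x y w u v N pp :: real
    proof -
      have "pp * (k * (2 * g * x * w - u)) / N * v = k * (pp / N * (2 * g * w * (x * v) - u * v))"
        by (simp add: right_diff_distrib diff_divide_distrib mult_ac)
      then show ?thesis by (simp only: distrib_left[symmetric] mult.assoc)
    qed
    fix b :: 'a
    show "(norm W powr (p - 2) *\<^sub>R
        (k *\<^sub>R ((2 * g * (?m \<bullet> b)) *\<^sub>R ?m - M b) +
          ((p - 2) * ((k *\<^sub>R ((2 * g * (?m \<bullet> b)) *\<^sub>R ?m - M b)) \<bullet> W) / ?N) *\<^sub>R W)) \<bullet> b =
      norm W powr (p - 2) * k * (2 * g * ((?m \<bullet> b) * (?m \<bullet> b)) - M b \<bullet> b +
        (p - 2) / ?N * (2 * g * (?m \<bullet> W) * ((?m \<bullet> b) * (W \<bullet> b)) - (M b \<bullet> W) * (W \<bullet> b)))"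
      by (simp only: inner_scaleR_left inner_add_left inner_diff_left alg)
  qed
  also have "\<dots> = norm W powr (p - 2) * k * (2 * g * (?m \<bullet> ?m) - tr +
        (p - 2) / ?N * (2 * g * (?m \<bullet> W) * (?m \<bullet> W) - M W \<bullet> W))"
    by (simp only: sum_distrib_left[symmetric] sum.distrib sum_subtractf s1 s2 tr_def)
  also have "0 < \<dots>"
  proof -
    define c where "c = (?m \<bullet> W)\<^sup>2 / ?N"
    have c: "0 \<le> c" "c \<le> (norm ?m)\<^sup>2"
    proof -
      show "0 \<le> c" by (simp add: c_def)
      have "(?m \<bullet> W)\<^sup>2 \<le> (norm ?m)\<^sup>2 * ?N"
        using Cauchy_Schwarz_ineq[of ?m W] by (simp add: power2_norm_eq_inner)
      then show "c \<le> (norm ?m)\<^sup>2" unfolding c_def using N by (simp add: divide_le_eq)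
    qed
    \<comment> \<open>The matrix I + (p - 2) W W^T / |W|^2 of the linearised flux has no eigenvalues
      other than 1 and p - 1, whence this lower bound for its form at \<open>M d\<close>.\<close>
    have "min 1 (p - 1) * (norm ?m)\<^sup>2 \<le> (norm ?m)\<^sup>2 + (p - 2) * c"
    proof (cases "2 \<le> p")
      case True
      then show ?thesis using c by (simp add: min_def mult_nonneg_nonneg)
    next
      case False
      have "(2 - p) * c \<le> (2 - p) * (norm ?m)\<^sup>2" using c False by (intro mult_left_mono) auto
      then show ?thesis using False by (simp add: min_def algebra_simps)
    qed
    moreover have "lam\<^sup>2 * s\<^sup>2 \<le> (norm ?m)\<^sup>2"
    proof -
      have "lam * s \<le> lam * norm d" using s lam_pos by (intro mult_left_mono) auto
      then have "lam * s \<le> norm ?m" using M_norm_lower[of d] by linarith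
      then have "(lam * s)\<^sup>2 \<le> (norm ?m)\<^sup>2" using lam_pos s(1) by (intro power_mono) auto
      then show ?thesis by (simp add: power_mult_distrib)
    qed
    ultimately have "min 1 (p - 1) * (lam\<^sup>2 * s\<^sup>2) \<le> (norm ?m)\<^sup>2 + (p - 2) * c"
      using p by (meson diff_gt_0_iff_gt less_eq_real_def min_less_iff_conj mult_left_mono order_trans zero_less_one)
    then have "2 * g * (min 1 (p - 1) * (lam\<^sup>2 * s\<^sup>2)) \<le> 2 * g * ((norm ?m)\<^sup>2 + (p - 2) * c)"
      using g by (intro mult_left_mono) auto
    moreover have "tr \<le> DIM('a) * Lam"
    proof -
      have "M b \<bullet> b \<le> Lam" if "b \<in> Basis" for b
        using norm_cauchy_schwarz[of "M b" b] M_upper[of b] that by simp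
      then show ?thesis unfolding tr_def using sum_bounded_above[of Basis "\<lambda>b. M b \<bullet> b" Lam] by simp
    qed
    moreover have "(p - 2) * (M W \<bullet> W / ?N) \<le> \<bar>p - 2\<bar> * Lam"
    proof -
      have "\<bar>M W \<bullet> W\<bar> \<le> Lam * ?N"
        using Cauchy_Schwarz_ineq2[of "M W" W] mult_right_mono[OF M_upper[of W], of "norm W"]
        by (simp add: power2_eq_square mult.assoc)
      then have "\<bar>M W \<bullet> W / ?N\<bar> \<le> Lam" using N by (simp add: abs_divide divide_le_eq)
      then have "\<bar>p - 2\<bar> * \<bar>M W \<bullet> W / ?N\<bar> \<le> \<bar>p - 2\<bar> * Lam" by (rule mult_left_mono) simp
      then show ?thesis by (metis abs_le_D1 abs_mult)
    qed
    ultimately have "0 < 2 * g * ((norm ?m)\<^sup>2 + (p - 2) * c) - tr - (p - 2) * (M W \<bullet> W / ?N)"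
      using large by (simp add: algebra_simps)
    also have "\<dots> = 2 * g * (?m \<bullet> ?m) - tr + (p - 2) / ?N * (2 * g * (?m \<bullet> W) * (?m \<bullet> W) - M W \<bullet> W)"
      by (simp add: c_def power2_norm_eq_inner power2_eq_square[of "_ \<bullet> _"] algebra_simps diff_divide_distrib)
    finally show ?thesis using W k by (intro mult_pos_pos) auto
  qed
  finally show ?thesis .
qed

lemma bounded_ellipsoid: "bounded ellipsoid"
proof -
  have "norm (x - z) \<le> sqrt (tau\<^sup>2 / lam)" if "x \<in> ellipsoid" for x
  proof (rule real_le_rsqrt)
    show "(norm (x - z))\<^sup>2 \<le> tau\<^sup>2 / lam"
      using q_lower[of x] that lam_pos by (simp add: ellipsoid_def field_simps)
  qed
  then have "ellipsoid \<subseteq> cball z (sqrt (tau\<^sup>2 / lam))" by (auto simp: dist_norm norm_minus_commute)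
  then show ?thesis using bounded_cball bounded_subset by blast
qed

lemma continuous_on_q: "continuous_on S q"
  using has_derivative_continuous_on[OF has_derivative_at_withinI[OF q_has_derivative]] .

lemma open_ellipsoid: "open ellipsoid"
  unfolding ellipsoid_def by (intro open_Collect_less continuous_on_q continuous_intros)

text \<open>Each part of the boundary has its hypothesis: on the surface of the ellipsoid the
  exponential term vanishes and \<open>above\<close> applies, near the centre \<open>inner\<close>
  leaves room for the whole amplitude \<open>A\<close>, and \<open>outside\<close> covers the points
  off \<open>S\<close>. A ball about the centre is removed since the divergence estimate degenerates
  at \<open>x = z\<close>. \<open>inner\<close> reaches up to radius 2 s, so that the critical set
  stays at a positive distance from the removed ball of radius s and is compact in the
  domain.\<close>

lemma barrier_comparison:
  fixes p :: real
  assumes p: "1 < p" and S: "open S" and harm: "p_harmonic_on p S f" and lip: "L-lipschitz_on S f"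
    and cont: "continuous_on ellipsoid f"
    and A: "0 < A" and g: "0 < g" and s: "0 < s"
    and large: "(DIM('a) + \<bar>p - 2\<bar>) * Lam < 2 * g * min 1 (p - 1) * lam\<^sup>2 * s\<^sup>2"
    and grad0: "\<And>x. x \<in> ellipsoid \<Longrightarrow> s < norm (x - z) \<Longrightarrow> barrier_grad \<mu> A g x \<noteq> 0"
    and above: "\<And>x. x \<in> ellipsoid \<Longrightarrow> \<mu> * ((x - x0) \<bullet> e) \<le> f x"
    and inner: "\<And>x. x \<in> ellipsoid \<Longrightarrow> norm (x - z) < 2 * s \<Longrightarrow> \<mu> * ((x - x0) \<bullet> e) + A \<le> f x"
    and outside: "\<And>x. x \<in> ellipsoid \<Longrightarrow> x \<notin> S \<Longrightarrow> barrier \<mu> A g x \<le> f x"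
    and x: "x \<in> ellipsoid" "s < norm (x - z)"
  shows "barrier \<mu> A g x \<le> f x"
proof (cases "x \<in> S")
  case False
  then show ?thesis using outside x by blast
next
  case True
  define D where "D = (ellipsoid - cball z s) \<inter> S"
  have D: "open D" "D \<subseteq> S" "bounded D"
    using open_ellipsoid S bounded_ellipsoid by (auto simp: D_def intro: bounded_subset)
  have Dd: "y \<in> ellipsoid" "s < norm (y - z)" "y \<in> S" if "y \<in> D" for y
    using that by (auto simp: D_def dist_norm norm_minus_commute)
  let ?w = "barrier \<mu> A g" and ?W = "barrier_grad \<mu> A g"
  let ?W' = "\<lambda>x h. (2 * g * A * exp (- g * q x)) *\<^sub>R ((2 * g * (M (x - z) \<bullet> h)) *\<^sub>R M (x - z) - M h)"
  let ?V' = "\<lambda>x h. norm (?W x) powr (p - 2) *\<^sub>R (?W' x h + ((p - 2) * (?W' x h \<bullet> ?W x) / (norm (?W x))\<^sup>2) *\<^sub>R ?W x)"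
  have contM: "continuous_on T (\<lambda>x. M (x - z))" for T
    using has_derivative_continuous_on[OF has_derivative_at_withinI[OF M_has_derivative]] .
  have contW: "continuous_on T ?W" for T
    unfolding barrier_grad_def[abs_def] by (intro continuous_intros continuous_on_q contM)
  show ?thesis
  proof (rule comparison_strict_subsolution[OF p S harm lip D barrier_smooth])
    fix y assume y: "y \<in> D"
    have W0: "?W y \<noteq> 0" using grad0 Dd[OF y] by blast
    show "((\<lambda>x. norm (grad ?w x) powr (p - 2) *\<^sub>R grad ?w x) has_derivative ?V' y) (at y)"
      unfolding grad_barrier by (rule flux_has_derivative[OF barrier_grad_has_derivative W0])
    show "0 < (\<Sum>b\<in>Basis. ?V' y b \<bullet> b)"
      using Dd[OF y] A g by (intro barrier_divergence_pos[OF p W0 _ _ s _ large]) auto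
  next
    fix b :: 'a assume "b \<in> Basis"
    show "continuous_on D (\<lambda>x. ?V' x b)"
      using grad0 Dd by (intro continuous_intros contW contM continuous_on_q) auto
  next
    fix c :: real assume c: "0 < c"
    define K0 where "K0 = {y. c \<le> A * (exp (- g * q y) - exp (- g * tau\<^sup>2)) \<and> 2 * s \<le> norm (y - z)}"
    have K0E: "K0 \<subseteq> ellipsoid"
    proof
      fix y assume "y \<in> K0"
      then have "0 < A * (exp (- g * q y) - exp (- g * tau\<^sup>2))" using c by (auto simp: K0_def)
      then have "exp (- g * tau\<^sup>2) < exp (- g * q y)" using A by (simp add: zero_less_mult_iff)
      then show "y \<in> ellipsoid" using g by (simp add: ellipsoid_def)
    qed
    have "closed K0" unfolding K0_def
      by (intro closed_Collect_conj closed_Collect_le continuous_intros continuous_on_q)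
    then have K0: "compact K0"
      using K0E bounded_ellipsoid bounded_subset compact_eq_bounded_closed by blast
    define K where "K = {y \<in> K0. c \<le> ?w y - f y}"
    have "continuous_on K0 (\<lambda>y. ?w y - f y)"
      by (intro continuous_intros smooth_continuous barrier_smooth continuous_on_subset[OF cont K0E])
    from continuous_closed_preimage[OF this \<open>closed K0\<close> closed_atLeast, of c]
    have "closed K" by (simp add: K_def vimage_def Int_def)
    then have "compact K" using K0 compact_Int_closed[of K0 K] by (simp add: K_def Int_def)
    moreover have "K \<subseteq> D"
    proof
      fix y assume y: "y \<in> K"
      then have yE: "y \<in> ellipsoid" and "s < norm (y - z)" using K0E s by (auto simp: K_def K0_def)
      moreover have "y \<in> S"
        using outside[OF yE] y c by (force simp: K_def)
      ultimately show "y \<in> D" by (auto simp: D_def dist_norm norm_minus_commute)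
    qed
    moreover have "?w y - f y < c" if "y \<in> D - K" for y
    proof (rule ccontr)
      assume "\<not> ?w y - f y < c"
      then have wf: "c \<le> ?w y - f y" by simp
      have yE: "y \<in> ellipsoid" using Dd that by blast
      have "c \<le> A * (exp (- g * q y) - exp (- g * tau\<^sup>2))"
        using above[OF yE] wf by (simp add: barrier_def)
      moreover have "2 * s \<le> norm (y - z)"
      proof (rule ccontr)
        assume "\<not> 2 * s \<le> norm (y - z)"
        then have "\<mu> * ((y - x0) \<bullet> e) + A \<le> f y" using inner[OF yE] by simp
        moreover have "A * (exp (- g * q y) - exp (- g * tau\<^sup>2)) \<le> A * 1"
        proof (rule mult_left_mono)
          have "exp (- g * q y) \<le> 1" using g q_nonneg[of y] by simp
          then show "exp (- g * q y) - exp (- g * tau\<^sup>2) \<le> 1" using exp_ge_zero[of "- g * tau\<^sup>2"] by linarith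
        qed (use A in simp)
        ultimately show False using wf c by (simp add: barrier_def)
      qed
      ultimately have "y \<in> K" using wf by (simp add: K_def K0_def)
      then show False using that by blast
    qed
    ultimately show "\<exists>K. compact K \<and> K \<subseteq> D \<and> (\<forall>y\<in>D - K. ?w y - f y < c)" by blast
  next
    show "x \<in> D" using x True by (auto simp: D_def dist_norm norm_minus_commute)
  qed
qed

text \<open>Both are tangent line inequalities for exp at a = g (tau^2 - q x), which by
  \<open>q_shift\<close> is linear in x - x0 up to a quadratic term. The upper bound controls the
  sign of the barrier off \<open>S\<close>; the lower one contains the gain in slope.\<close>

lemma barrier_bounds:
  assumes "0 < A" "0 < g" "x \<in> ellipsoid"
  shows "barrier \<mu> A g x \<le> (\<mu> + 2 * A * g * tau) * ((x - x0) \<bullet> e)"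
    and "\<mu> * ((x - x0) \<bullet> e) + A * g * exp (- g * tau\<^sup>2) * (2 * tau * ((x - x0) \<bullet> e) - Lam * (norm (x - x0))\<^sup>2)
      \<le> barrier \<mu> A g x"
proof -
  define a where "a = g * (tau\<^sup>2 - q x)"
  have qle: "q x \<le> tau\<^sup>2" using assms(3) by (simp add: ellipsoid_def)
  have a0: "0 \<le> a" unfolding a_def using assms(2) qle by (intro mult_nonneg_nonneg) auto
  have aeq: "a = g * (2 * tau * ((x - x0) \<bullet> e) - M (x - x0) \<bullet> (x - x0))"
    by (simp add: a_def q_shift)
  have E: "exp (- g * q x) = exp (- g * tau\<^sup>2) * exp a"
    by (simp add: a_def exp_add[symmetric] algebra_simps)
  have M0: "0 \<le> M (x - x0) \<bullet> (x - x0)"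
    using M_lower[of "x - x0"] lam_pos by (smt (verit) mult_nonneg_nonneg zero_le_power2)
  have M1: "M (x - x0) \<bullet> (x - x0) \<le> Lam * (norm (x - x0))\<^sup>2"
    using norm_cauchy_schwarz[of "M (x - x0)" "x - x0"] mult_right_mono[OF M_upper[of "x - x0"], of "norm (x - x0)"]
    by (simp add: power2_eq_square mult.assoc)
  have "exp (- g * q x) - exp (- g * tau\<^sup>2) \<le> a"
  proof -
    have "exp (- g * q x) * (1 - exp (- a)) \<le> 1 * a"
    proof (rule mult_mono)
      show "exp (- g * q x) \<le> 1" using assms(2) q_nonneg[of x] by simp
      show "1 - exp (- a) \<le> a" using exp_ge_add_one_self[of "- a"] by simp
    qed (use a0 in auto)
    moreover have "exp (- g * q x) * exp (- a) = exp (- g * tau\<^sup>2)"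
      by (simp add: a_def exp_add[symmetric] algebra_simps)
    ultimately show ?thesis by (simp add: right_diff_distrib)
  qed
  also have "a \<le> g * (2 * tau * ((x - x0) \<bullet> e))"
    unfolding aeq using assms(2) M0 by (intro mult_left_mono) auto
  finally have "A * (exp (- g * q x) - exp (- g * tau\<^sup>2)) \<le> A * (g * (2 * tau * ((x - x0) \<bullet> e)))"
    using assms(1) by (intro mult_left_mono) auto
  then show "barrier \<mu> A g x \<le> (\<mu> + 2 * A * g * tau) * ((x - x0) \<bullet> e)"
    by (simp add: barrier_def algebra_simps)
  have "exp (- g * tau\<^sup>2) * a \<le> exp (- g * tau\<^sup>2) * (exp a - 1)"
    using exp_ge_add_one_self[of a] by (intro mult_left_mono) (linarith, simp)
  also have "\<dots> = exp (- g * q x) - exp (- g * tau\<^sup>2)" unfolding E by (simp add: right_diff_distrib)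
  finally have "A * (exp (- g * tau\<^sup>2) * a) \<le> A * (exp (- g * q x) - exp (- g * tau\<^sup>2))"
    using assms(1) by (intro mult_left_mono) auto
  moreover have "g * (2 * tau * ((x - x0) \<bullet> e) - Lam * (norm (x - x0))\<^sup>2) \<le> a"
    unfolding aeq using assms(2) M1 by (intro mult_left_mono) auto
  then have "A * exp (- g * tau\<^sup>2) * (g * (2 * tau * ((x - x0) \<bullet> e) - Lam * (norm (x - x0))\<^sup>2)) \<le> A * exp (- g * tau\<^sup>2) * a"
    using assms(1) by (intro mult_left_mono) auto
  ultimately show "\<mu> * ((x - x0) \<bullet> e) + A * g * exp (- g * tau\<^sup>2) * (2 * tau * ((x - x0) \<bullet> e) - Lam * (norm (x - x0))\<^sup>2)
      \<le> barrier \<mu> A g x"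
    by (simp add: barrier_def mult_ac)
qed

end

subsection \<open>Slopes at the contact point\<close>

text \<open>The shear \<open>T\<close> fixes the hyperplane orthogonal to \<open>e\<close> pointwise
  and sends \<open>Z\<close> to its normal part; \<open>M\<close> is \<open>T\<close> followed by
  its adjoint, so the ellipsoid is the preimage of a ball. \<open>B\<close> bounds the norms of
  \<open>T\<close>, its inverse and its adjoint, whence 1 / B^2 and B^2.\<close>

lemma shear_barrier_geometry:
  fixes e Z x0 :: "'a::euclidean_space"
  assumes e: "norm e = 1" and tau: "0 < tau" "Z \<bullet> e = tau" and B: "norm (Z - tau *\<^sub>R e) \<le> (B - 1) * tau"
  shows "\<exists>M. barrier_geometry M (1 / B\<^sup>2) (B\<^sup>2) tau x0 (x0 + Z) e"
proof -
  define \<zeta> where "\<zeta> = (1 / tau) *\<^sub>R (Z - tau *\<^sub>R e)"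
  have ee: "e \<bullet> e = 1" using e by (simp add: power2_norm_eq_inner[symmetric])
  have \<zeta>e: "\<zeta> \<bullet> e = 0" using tau ee by (simp add: \<zeta>_def inner_diff_left)
  have \<zeta>B: "norm \<zeta> \<le> B - 1" using B tau(1) by (simp add: \<zeta>_def divide_le_eq)
  then have B1: "1 \<le> B" using norm_ge_zero[of \<zeta>] by linarith
  define T where "T v = v - (v \<bullet> e) *\<^sub>R \<zeta>" for v
  define M where "M v = T v - (T v \<bullet> \<zeta>) *\<^sub>R e" for v
  have MT: "M v \<bullet> w = T v \<bullet> T w" for v w
    by (simp add: M_def T_def[of w] inner_diff_left inner_diff_right inner_commute)
  have TZ: "T Z = tau *\<^sub>R e"
    using tau by (simp add: T_def \<zeta>_def)
  \<comment> \<open>One estimate for three maps: \<open>T\<close> itself, its inverse (with the sign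
    of \<zeta> reversed) and its adjoint (with \<open>e\<close> and \<zeta> exchanged).\<close>
  have shear: "norm (v - (v \<bullet> a) *\<^sub>R b) \<le> B * norm v" if "norm a * norm b \<le> B - 1" for v a b :: 'a
  proof -
    have "\<bar>v \<bullet> a\<bar> * norm b \<le> (norm v * norm a) * norm b"
      by (intro mult_right_mono Cauchy_Schwarz_ineq2) simp
    also have "\<dots> \<le> norm v * (B - 1)"
      using mult_left_mono[OF that, of "norm v"] by (simp add: mult.assoc)
    finally show ?thesis
      using norm_triangle_ineq4[of v "(v \<bullet> a) *\<^sub>R b"] by (simp add: algebra_simps)
  qed
  have TB: "norm (T v) \<le> B * norm v" for v
    unfolding T_def using \<zeta>B e by (intro shear) simp
  have Tinv: "norm v \<le> B * norm (T v)" for v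
  proof -
    have "v = T v - (T v \<bullet> e) *\<^sub>R (- \<zeta>)" using \<zeta>e by (simp add: T_def inner_diff_left)
    also have "norm \<dots> \<le> B * norm (T v)" using \<zeta>B e by (intro shear) simp
    finally show ?thesis .
  qed
  have "barrier_geometry M (1 / B\<^sup>2) (B\<^sup>2) tau x0 (x0 + Z) e"
  proof (rule barrier_geometry.intro)
    show "linear M" unfolding M_def T_def
      by (intro linearI) (simp_all add: inner_add_left inner_diff_left algebra_simps)
    show "M v \<bullet> w = v \<bullet> M w" for v w
      using MT[of v w] MT[of w v] by (simp add: inner_commute)
    show "0 < 1 / B\<^sup>2" using B1 by simp
    show "1 / B\<^sup>2 * (norm v)\<^sup>2 \<le> M v \<bullet> v" for v
    proof -
      have "(norm v)\<^sup>2 \<le> (B * norm (T v))\<^sup>2" by (intro power_mono Tinv) simp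
      then show ?thesis using B1 by (simp add: MT power2_norm_eq_inner power_mult_distrib field_simps)
    qed
    show "norm (M v) \<le> B\<^sup>2 * norm v" for v
    proof -
      have "norm (M v) \<le> B * norm (T v)" unfolding M_def using \<zeta>B e by (intro shear) simp
      also have "\<dots> \<le> B * (B * norm v)" using B1 by (intro mult_left_mono TB) auto
      finally show ?thesis by (simp add: power2_eq_square mult.assoc)
    qed
    show "M (x0 + Z - x0) = tau *\<^sub>R e" using \<zeta>e by (simp add: M_def TZ inner_commute)
  qed (use tau in auto)
  then show ?thesis by blast
qed

text \<open>The quadratic error reflects that touching balls and ellipsoids fill the half-space only
  up to second order at the contact point. \<open>K\<close> and \<eta> may depend on the slope; what
  matters is the supremum of the set, which need not be attained.\<close>

definition slopes :: "('a::euclidean_space \<Rightarrow> real) \<Rightarrow> 'a \<Rightarrow> 'a \<Rightarrow> real set" where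
  "slopes f x0 e = {m. \<exists>K\<ge>0. \<exists>\<eta>>0. \<forall>x. norm (x - x0) < \<eta> \<longrightarrow> 0 \<le> (x - x0) \<bullet> e \<longrightarrow>
     m * ((x - x0) \<bullet> e) - K * (norm (x - x0))\<^sup>2 \<le> f x}"

lemma slopesI:
  assumes "0 \<le> K" "0 < \<eta>"
    "\<And>x. norm (x - x0) < \<eta> \<Longrightarrow> 0 \<le> (x - x0) \<bullet> e \<Longrightarrow> m * ((x - x0) \<bullet> e) - K * (norm (x - x0))\<^sup>2 \<le> f x"
  shows "m \<in> slopes f x0 e"
  using assms unfolding slopes_def by blast

lemma slopesE:
  assumes "m \<in> slopes f x0 e"
  obtains K \<eta> where "0 \<le> K" "0 < \<eta>"
    "\<And>x. norm (x - x0) < \<eta> \<Longrightarrow> 0 \<le> (x - x0) \<bullet> e \<Longrightarrow> m * ((x - x0) \<bullet> e) - K * (norm (x - x0))\<^sup>2 \<le> f x"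
  using assms unfolding slopes_def by blast

lemma slopes_mono:
  assumes "m \<in> slopes f x0 e" "m' \<le> m"
  shows "m' \<in> slopes f x0 e"
proof -
  obtain K \<eta> where K: "0 \<le> K" "0 < \<eta>"
    "\<And>x. norm (x - x0) < \<eta> \<Longrightarrow> 0 \<le> (x - x0) \<bullet> e \<Longrightarrow> m * ((x - x0) \<bullet> e) - K * (norm (x - x0))\<^sup>2 \<le> f x"
    using slopesE[OF assms(1)] by blast
  show ?thesis
  proof (rule slopesI[OF K(1,2)])
    fix x assume x: "norm (x - x0) < \<eta>" "0 \<le> (x - x0) \<bullet> e"
    show "m' * ((x - x0) \<bullet> e) - K * (norm (x - x0))\<^sup>2 \<le> f x"
      using K(3)[OF x] mult_right_mono[OF assms(2) x(2)] by linarith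
  qed
qed

text \<open>It suffices to look along the normal ray x0 + s e, where the quadratic error is
  negligible against the linear term as s tends to 0.\<close>

lemma slopes_le:
  assumes m: "m \<in> slopes f x0 e" and e: "norm e = 1" and "0 < \<eta>\<^sub>0"
    and f: "\<And>x. norm (x - x0) < \<eta>\<^sub>0 \<Longrightarrow> f x \<le> C * norm (x - x0)"
  shows "m \<le> C"
proof (rule field_le_epsilon)
  fix d :: real assume "0 < d"
  obtain K \<eta> where K: "0 \<le> K" "0 < \<eta>"
    "\<And>x. norm (x - x0) < \<eta> \<Longrightarrow> 0 \<le> (x - x0) \<bullet> e \<Longrightarrow> m * ((x - x0) \<bullet> e) - K * (norm (x - x0))\<^sup>2 \<le> f x"
    using slopesE[OF m] by blast
  define s' where "s' = min (min \<eta> \<eta>\<^sub>0) (d / (K + 1))"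
  define s where "s = s' / 2"
  have "0 < s'" "s' \<le> \<eta>" "s' \<le> \<eta>\<^sub>0" "s' \<le> d / (K + 1)"
    using K(1,2) \<open>0 < \<eta>\<^sub>0\<close> \<open>0 < d\<close> by (auto simp: s'_def)
  then have s: "0 < s" "s < \<eta>" "s < \<eta>\<^sub>0" "s \<le> d / (K + 1)"
    unfolding s_def by linarith+
  have ee: "e \<bullet> e = 1" using e by (simp add: power2_norm_eq_inner[symmetric])
  have "m * s - K * s\<^sup>2 \<le> f (x0 + s *\<^sub>R e)"
    using K(3)[of "x0 + s *\<^sub>R e"] s e ee by simp
  also have "\<dots> \<le> C * s" using f[of "x0 + s *\<^sub>R e"] s e by simp
  finally have "(m - K * s) * s \<le> C * s" by (simp add: algebra_simps power2_eq_square)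
  then have "m \<le> C + K * s" using s(1) by simp
  moreover have "K * s \<le> d"
  proof -
    have "s * (K + 1) \<le> d" using s(4) K(1) by (simp add: field_simps)
    then show ?thesis using s(1) by (simp add: algebra_simps)
  qed
  ultimately show "m \<le> C + d" by linarith
qed

lemma slopes_lower_bound:
  assumes "\<And>m. m < \<alpha> \<Longrightarrow> m \<in> slopes f x0 e" and e: "norm e = 1" and "0 < \<epsilon>"
  obtains \<eta> where "0 < \<eta>"
    "\<And>x. norm (x - x0) < \<eta> \<Longrightarrow> 0 \<le> (x - x0) \<bullet> e \<Longrightarrow> \<alpha> * ((x - x0) \<bullet> e) - \<epsilon> * norm (x - x0) \<le> f x"
proof -
  \<comment> \<open>\<alpha> itself need not be a slope, but \<alpha> - \<epsilon>/2 is; the other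
    half of \<epsilon> pays for the quadratic term.\<close>
  obtain K \<eta> where K: "0 \<le> K" "0 < \<eta>"
    "\<And>x. norm (x - x0) < \<eta> \<Longrightarrow> 0 \<le> (x - x0) \<bullet> e \<Longrightarrow> (\<alpha> - \<epsilon> / 2) * ((x - x0) \<bullet> e) - K * (norm (x - x0))\<^sup>2 \<le> f x"
    using slopesE[OF assms(1)[of "\<alpha> - \<epsilon> / 2"]] \<open>0 < \<epsilon>\<close> by (metis diff_less_eq half_gt_zero less_add_same_cancel1)
  show ?thesis
  proof
    show "0 < min \<eta> (\<epsilon> / (2 * (K + 1)))" using K \<open>0 < \<epsilon>\<close> by simp
    fix x assume x: "norm (x - x0) < min \<eta> (\<epsilon> / (2 * (K + 1)))" "0 \<le> (x - x0) \<bullet> e"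
    have "(x - x0) \<bullet> e \<le> norm (x - x0)" using norm_cauchy_schwarz[of "x - x0" e] e by simp
    then have 1: "\<epsilon> / 2 * ((x - x0) \<bullet> e) \<le> \<epsilon> / 2 * norm (x - x0)" using \<open>0 < \<epsilon>\<close> by (intro mult_left_mono) auto
    have "(K + 1) * norm (x - x0) \<le> \<epsilon> / 2" using x(1) K(1) by (simp add: field_simps)
    then have "K * norm (x - x0) \<le> \<epsilon> / 2" using norm_ge_zero[of "x - x0"] by (simp only: distrib_right)
    then have 2: "K * (norm (x - x0))\<^sup>2 \<le> \<epsilon> / 2 * norm (x - x0)"
      using mult_right_mono[of "K * norm (x - x0)" "\<epsilon> / 2" "norm (x - x0)"] by (simp add: power2_eq_square mult.assoc)
    have "(\<alpha> - \<epsilon> / 2) * ((x - x0) \<bullet> e) - K * (norm (x - x0))\<^sup>2 \<le> f x" using K(3) x by simp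
    then show "\<alpha> * ((x - x0) \<bullet> e) - \<epsilon> * norm (x - x0) \<le> f x"
      using 1 2 by (simp add: left_diff_distrib)
  qed
qed

text \<open>If \<open>f\<close> exceeded \<open>\<alpha> ((x - x0) \<bullet> e)\<close> by \<open>\<delta> t\<close> at a point at distance \<open>t\<close> from \<open>x0\<close>, a barrier on the
  ellipsoid centred near this point would raise the slope \<open>\<alpha>\<close> by an amount which does not depend on \<open>t\<close>.\<close>

lemma slopes_upper_bound:
  fixes f :: "'a::euclidean_space \<Rightarrow> real" and p :: real
  assumes p: "1 < p" and S: "open S" and harm: "p_harmonic_on p S f" and lipS: "L-lipschitz_on S f"
    and rho: "0 < \<rho>" and lip: "L-lipschitz_on (ball x0 \<rho>) f" and f0: "f x0 = 0" and e: "norm e = 1"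
    and \<alpha>: "\<alpha> \<noteq> 0" and slope: "\<And>m. m < \<alpha> \<Longrightarrow> m \<in> slopes f x0 e" and max: "\<And>m. m \<in> slopes f x0 e \<Longrightarrow> m \<le> \<alpha>"
    and r: "0 < r" and outside: "\<alpha> < 0 \<and> (\<forall>x\<in>ball x0 \<rho> - S. f x = 0) \<or>
      (\<forall>x. (norm (x - x0))\<^sup>2 < 2 * r * ((x - x0) \<bullet> e) \<longrightarrow> x \<in> S)"
    and \<delta>: "0 < \<delta>"
  shows "\<exists>\<eta>>0. \<forall>x. norm (x - x0) < \<eta> \<longrightarrow> 0 \<le> (x - x0) \<bullet> e \<longrightarrow>
    f x \<le> \<alpha> * ((x - x0) \<bullet> e) + \<delta> * norm (x - x0)"
proof (rule ccontr)
  assume contra: "\<not> ?thesis"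
  have L: "0 \<le> L" using lip lipschitz_on_nonneg by blast
  define a where "a = \<bar>\<alpha>\<bar>"
  have a: "0 < a" using \<alpha> by (simp add: a_def)
  have La: "0 < L + a" using L a by simp
  \<comment> \<open>The relative amount by which the bad point is lifted off the hyperplane. Over a
    distance \<kappa> t, \<open>f\<close> and the linear function together change by at most
    \<delta> t / 4, so the excess survives at the lifted centre and near it.\<close>
  define \<kappa> where "\<kappa> = min 1 (\<delta> / (4 * (L + a)))"
  have \<kappa>: "0 < \<kappa>" "\<kappa> \<le> 1" "(L + a) * \<kappa> \<le> \<delta> / 4"
  proof -
    show "0 < \<kappa>" "\<kappa> \<le> 1" using \<delta> La by (auto simp: \<kappa>_def)
    have "(L + a) * \<kappa> \<le> (L + a) * (\<delta> / (4 * (L + a)))" using La by (intro mult_left_mono) (auto simp: \<kappa>_def)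
    also have "\<dots> = \<delta> / 4" using La by (simp add: field_simps)
    finally show "(L + a) * \<kappa> \<le> \<delta> / 4" .
  qed
  \<comment> \<open>The bound for the shear: the tangential part of the centre will be at most 4 t
    and its height at least \<kappa> t.\<close>
  define B where "B = 1 + 4 / \<kappa>"
  have B: "1 \<le> B" using \<kappa> by (simp add: B_def)
  define lam where "lam = 1 / B\<^sup>2"
  have lam: "0 < lam" "lam \<le> 1" using B by (auto simp: lam_def divide_le_eq)
  define Lam where "Lam = B\<^sup>2"
  have Lam: "1 \<le> Lam" using B by (simp add: Lam_def)
  define P where "P = min 1 (p - 1)"
  have P: "0 < P" using p by (simp add: P_def)
  define n where "n = (DIM('a) + \<bar>p - 2\<bar>) * Lam"
  have n: "0 \<le> n" using Lam by (simp add: n_def)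
  \<comment> \<open>The exponent without its scale: for g = \<gamma> / t^2 and s = \<kappa> t / 4
    the condition \<open>large\<close> of \<open>barrier_comparison\<close> no longer contains
    t.\<close>
  define \<gamma> where "\<gamma> = (n + 1) / (2 * P * lam\<^sup>2 * (\<kappa> / 4)\<^sup>2)"
  have \<gamma>: "0 < \<gamma>" "n < 2 * \<gamma> * P * lam\<^sup>2 * (\<kappa> / 4)\<^sup>2"
  proof -
    have pos: "0 < 2 * P * lam\<^sup>2 * (\<kappa> / 4)\<^sup>2" using P lam \<kappa> by simp
    then show "0 < \<gamma>" using n by (simp add: \<gamma>_def)
    have "\<gamma> * (2 * P * lam\<^sup>2 * (\<kappa> / 4)\<^sup>2) = n + 1" unfolding \<gamma>_def using pos by (metis less_numeral_extra(3) nonzero_eq_divide_eq)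
    then show "n < 2 * \<gamma> * P * lam\<^sup>2 * (\<kappa> / 4)\<^sup>2" by (simp add: mult_ac)
  qed
  \<comment> \<open>The amplitude of the barrier will be \<epsilon> t. The first bound lets the
    excess near the centre pay for it; the second keeps the gradient of the exponential part at most
    |\<alpha>| / 4, so that the total gradient cannot vanish, and preserves a negative slope off
    \<open>S\<close>.\<close>
  define \<epsilon> where "\<epsilon> = min (\<delta> / 2) (a * lam / (48 * \<gamma> * Lam))"
  have \<epsilon>: "0 < \<epsilon>" "\<epsilon> \<le> \<delta> / 2" "12 * \<epsilon> * \<gamma> * Lam / lam \<le> a / 4" "4 * \<epsilon> * \<gamma> \<le> a / 4"
  proof -
    show "0 < \<epsilon>" "\<epsilon> \<le> \<delta> / 2" using \<delta> a lam \<gamma> Lam by (auto simp: \<epsilon>_def)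
    have "\<epsilon> \<le> a * lam / (48 * \<gamma> * Lam)" by (simp add: \<epsilon>_def)
    then have *: "\<epsilon> * (48 * \<gamma> * Lam) \<le> a * lam" using \<gamma> Lam by (simp add: pos_le_divide_eq)
    then show "12 * \<epsilon> * \<gamma> * Lam / lam \<le> a / 4" using lam by (simp add: field_simps)
    have "48 * \<epsilon> * \<gamma> * 1 \<le> 48 * \<epsilon> * \<gamma> * Lam" using Lam \<open>0 < \<epsilon>\<close> \<gamma> by (intro mult_left_mono) auto
    also have "\<dots> = \<epsilon> * (48 * \<gamma> * Lam)" by simp
    also have "\<dots> \<le> a * lam" by (rule *)
    also have "\<dots> \<le> a * 1" using lam(2) a by (intro mult_left_mono) auto
    finally have "48 * (\<epsilon> * \<gamma>) \<le> a" by simp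
    moreover have "0 < \<epsilon> * \<gamma>" using \<open>0 < \<epsilon>\<close> \<gamma> by simp
    ultimately have "16 * (\<epsilon> * \<gamma>) \<le> a" by linarith
    then show "4 * \<epsilon> * \<gamma> \<le> a / 4" by simp
  qed
  \<comment> \<open>A lower bound for the slope 2 A g tau exp (- g tau^2) gained at x0, using
    \<kappa> t \<le> tau \<le> 2 t; the scale t cancels.\<close>
  define c where "c = 2 * \<epsilon> * \<gamma> * \<kappa> * exp (- 4 * \<gamma>)"
  have c: "0 < c" using \<epsilon> \<gamma> \<kappa> by (simp add: c_def)
  \<comment> \<open>The total loss of slope will be less than 3/2 h \<le> 3/4 c, which leaves a net
    gain; h \<le> a / 4 keeps the lowered slope \<mu> away from 0.\<close>
  define h where "h = min (c / 2) (a / 4)"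
  have h: "0 < h" using c a by (simp add: h_def)
  define m where "m = \<alpha> - h / 2"
  have m: "m < \<alpha>" "\<alpha> - h < m" using h by (auto simp: m_def)
  obtain K \<eta> where K: "0 \<le> K" "0 < \<eta>"
    "\<And>x. norm (x - x0) < \<eta> \<Longrightarrow> 0 \<le> (x - x0) \<bullet> e \<Longrightarrow> m * ((x - x0) \<bullet> e) - K * (norm (x - x0))\<^sup>2 \<le> f x"
    using slopesE[OF slope[OF m(1)]] by blast
  \<comment> \<open>Points of the ellipsoid are within 4 t / lam of x0. This distance has to stay in
    the range of every hypothesis and be so small that the quadratic error costs at most h / 2 of
    slope.\<close>
  define w where "w = min (min \<eta> \<rho>) (min r (h / (2 * (K + 1))))"
  have "0 < w" using K rho r h by (simp add: w_def)
  define \<eta>\<^sub>0 where "\<eta>\<^sub>0 = lam / 4 * w"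
  have "0 < \<eta>\<^sub>0" using lam \<open>0 < w\<close> by (simp add: \<eta>\<^sub>0_def)
  obtain x\<^sub>1 where x1: "norm (x\<^sub>1 - x0) < \<eta>\<^sub>0" "0 \<le> (x\<^sub>1 - x0) \<bullet> e"
    "\<alpha> * ((x\<^sub>1 - x0) \<bullet> e) + \<delta> * norm (x\<^sub>1 - x0) < f x\<^sub>1"
    using contra \<open>0 < \<eta>\<^sub>0\<close> by (meson not_le)
  define t where "t = norm (x\<^sub>1 - x0)"
  have t0: "0 < t"
  proof (rule ccontr)
    assume "\<not> 0 < t"
    then have "x\<^sub>1 = x0" by (simp add: t_def)
    then show False using x1 f0 by simp
  qed
  have "4 * t / lam < w"
    using x1(1) lam(1) by (simp add: \<eta>\<^sub>0_def t_def field_simps)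
  then have t4: "4 * t / lam < min (min \<eta> \<rho>) (min r (h / (2 * (K + 1))))" by (simp add: w_def)
  have t: "4 * t / lam < \<eta>" "4 * t / lam < \<rho>" "4 * t / lam < r" "4 * t / lam * K \<le> h / 2"
  proof -
    show "4 * t / lam < \<eta>" "4 * t / lam < \<rho>" "4 * t / lam < r" using t4 by auto
    have "4 * t / lam * (K + 1) \<le> h / (2 * (K + 1)) * (K + 1)" using t4 K(1) by (intro mult_right_mono) auto
    also have "\<dots> = h / 2" using K(1) by (simp add: field_simps)
    finally have "4 * t / lam * K + 4 * t / lam \<le> h / 2" by (simp add: distrib_left)
    moreover have "0 < 4 * t / lam" using t0 lam by simp
    ultimately show "4 * t / lam * K \<le> h / 2" by linarith
  qed
  have tlam: "4 * t \<le> 4 * t / lam"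
    using lam t0 by (simp add: pos_le_divide_eq mult_left_le)
  have ee: "e \<bullet> e = 1" using e by (simp add: power2_norm_eq_inner[symmetric])
  define Z where "Z = x\<^sub>1 - x0 + (\<kappa> * t) *\<^sub>R e"
  define z where "z = x0 + Z"
  define tau where "tau = Z \<bullet> e"
  have X1e: "(x\<^sub>1 - x0) \<bullet> e \<le> t" using norm_cauchy_schwarz[of "x\<^sub>1 - x0" e] e by (simp add: t_def)
  have tau_eq: "tau = (x\<^sub>1 - x0) \<bullet> e + \<kappa> * t" by (simp add: tau_def Z_def inner_add_left ee)
  have \<kappa>t: "0 < \<kappa> * t" "\<kappa> * t \<le> t" using \<kappa> t0 by auto
  have tau: "\<kappa> * t \<le> tau" "tau \<le> 2 * t" "0 < tau" using x1(2) X1e \<kappa>t tau_eq by linarith+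
  have Zt: "norm Z \<le> 2 * t"
    using norm_triangle_ineq[of "x\<^sub>1 - x0" "(\<kappa> * t) *\<^sub>R e"] \<kappa>t e by (simp add: Z_def t_def[symmetric])
  have Ztau: "tau \<le> norm Z" using norm_cauchy_schwarz[of Z e] e by (simp add: tau_def)
  have "norm (Z - tau *\<^sub>R e) \<le> norm Z + tau" using norm_triangle_ineq4[of Z "tau *\<^sub>R e"] tau e by simp
  also have "\<dots> \<le> 4 * t" using Zt tau by linarith
  also have "\<dots> = 4 / \<kappa> * (\<kappa> * t)" using \<kappa> by simp
  also have "\<dots> \<le> 4 / \<kappa> * tau" using \<kappa> tau(1) by (intro mult_left_mono) auto
  finally have "norm (Z - tau *\<^sub>R e) \<le> (B - 1) * tau" by (simp add: B_def)
  from shear_barrier_geometry[OF e tau(3) tau_def[symmetric] this]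
  obtain M where "barrier_geometry M lam Lam tau x0 z e" unfolding lam_def Lam_def z_def by blast
  then interpret barrier_geometry M lam Lam tau x0 z e .

  \<comment> \<open>\<open>\<mu>\<close> is \<open>m\<close> lowered by the price of the quadratic
    error: on the ellipsoid |x - x0|^2 is at most 4 t / lam times the height.\<close>
  define s g A \<mu> where "s = \<kappa> / 4 * t" and "g = \<gamma> / t\<^sup>2" and "A = \<epsilon> * t" and "\<mu> = m - 4 * t / lam * K"
  have s: "0 < s" using \<kappa> t0 by (simp add: s_def)
  have g: "0 < g" using \<gamma> t0 by (simp add: g_def)
  have A: "0 < A" using \<epsilon> t0 by (simp add: A_def)
  have \<mu>m: "\<mu> \<le> m" using t0 lam K(1) by (simp add: \<mu>_def)
  have \<mu>\<alpha>: "\<alpha> - 3/2 * h < \<mu>" "\<mu> < \<alpha>" using m t(4) \<mu>m by (auto simp: \<mu>_def)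
  have large: "(DIM('a) + \<bar>p - 2\<bar>) * Lam < 2 * g * min 1 (p - 1) * lam\<^sup>2 * s\<^sup>2"
  proof -
    have "g * s\<^sup>2 = \<gamma> * (\<kappa> / 4)\<^sup>2"
      using t0 by (simp add: g_def s_def power_mult_distrib power_divide)
    then have "\<gamma> * (\<kappa> / 4)\<^sup>2 * (2 * P * lam\<^sup>2) = g * s\<^sup>2 * (2 * P * lam\<^sup>2)" by (simp only:)
    moreover have "2 * \<gamma> * P * lam\<^sup>2 * (\<kappa> / 4)\<^sup>2 = \<gamma> * (\<kappa> / 4)\<^sup>2 * (2 * P * lam\<^sup>2)" by (simp only: mult_ac)
    moreover have "g * s\<^sup>2 * (2 * P * lam\<^sup>2) = 2 * g * P * lam\<^sup>2 * s\<^sup>2" by (simp only: mult_ac)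
    ultimately have "n < 2 * g * P * lam\<^sup>2 * s\<^sup>2" using \<gamma>(2) by linarith
    then show ?thesis unfolding n_def P_def .
  qed
  have Ag: "A * g = \<epsilon> * \<gamma> / t" using t0 by (simp add: A_def g_def power2_eq_square)
  have E: "lam * (norm (x - x0))\<^sup>2 < 2 * tau * ((x - x0) \<bullet> e)" "0 < (x - x0) \<bullet> e" "norm (x - x0) < 4 * t / lam"
    if "x \<in> ellipsoid" for x
  proof -
    have "M (x - x0) \<bullet> (x - x0) < 2 * tau * ((x - x0) \<bullet> e)"
      using that q_shift[of x] by (simp add: ellipsoid_def)
    then show 1: "lam * (norm (x - x0))\<^sup>2 < 2 * tau * ((x - x0) \<bullet> e)"
      using M_lower[of "x - x0"] by linarith
    have "0 \<le> lam * (norm (x - x0))\<^sup>2" using lam by simp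
    then have "0 < 2 * tau * ((x - x0) \<bullet> e)" using 1 by linarith
    then show 2: "0 < (x - x0) \<bullet> e" using tau by (simp add: zero_less_mult_iff)
    have le: "(x - x0) \<bullet> e \<le> norm (x - x0)" using norm_cauchy_schwarz[of "x - x0" e] e by simp
    then have "lam * (norm (x - x0))\<^sup>2 < 2 * tau * norm (x - x0)"
      using 1 mult_left_mono[OF le, of "2 * tau"] tau by linarith
    then have "lam * norm (x - x0) * norm (x - x0) < 2 * tau * norm (x - x0)"
      by (simp add: power2_eq_square mult.assoc)
    then have "lam * norm (x - x0) < 2 * tau"
      using norm_ge_zero[of "x - x0"] by (rule mult_right_less_imp_less)
    also have "\<dots> \<le> 4 * t" using tau by simp
    finally show "norm (x - x0) < 4 * t / lam" using lam(1) by (simp add: field_simps)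
  qed
  have Eball: "x \<in> ball x0 \<rho>" if "x \<in> ellipsoid" for x
    using E(3)[OF that] t(2) by (simp add: dist_norm norm_minus_commute)
  have above: "\<mu> * ((x - x0) \<bullet> e) \<le> f x" if "x \<in> ellipsoid" for x
  proof -
    note Ex = E[OF that]
    have "(norm (x - x0))\<^sup>2 \<le> 2 * tau / lam * ((x - x0) \<bullet> e)" using Ex(1) lam(1) by (simp add: field_simps)
    also have "\<dots> \<le> 4 * t / lam * ((x - x0) \<bullet> e)"
      using tau lam Ex(2) by (intro mult_right_mono divide_right_mono) auto
    finally have "K * (norm (x - x0))\<^sup>2 \<le> K * (4 * t / lam * ((x - x0) \<bullet> e))" using K(1) by (intro mult_left_mono)
    moreover have "m * ((x - x0) \<bullet> e) - K * (norm (x - x0))\<^sup>2 \<le> f x" using K(3)[of x] Ex t(1) by simp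
    ultimately show ?thesis by (simp add: \<mu>_def algebra_simps)
  qed
  have zball: "z \<in> ball x0 \<rho>" "x\<^sub>1 \<in> ball x0 \<rho>"
  proof -
    have "norm Z < \<rho>" "norm (x\<^sub>1 - x0) < \<rho>" using Zt t(2) tlam t0 unfolding t_def by linarith+
    then show "z \<in> ball x0 \<rho>" "x\<^sub>1 \<in> ball x0 \<rho>"
      by (simp_all add: z_def dist_norm norm_minus_commute)
  qed
  have fz: "\<alpha> * tau + 3/4 * \<delta> * t \<le> f z"
  proof -
    have "\<bar>f z - f x\<^sub>1\<bar> \<le> L * (\<kappa> * t)"
      using lipschitz_onD[OF lip zball] \<kappa>t e by (simp add: dist_real_def dist_norm z_def Z_def)
    moreover have "\<alpha> * (tau - \<kappa> * t) + \<delta> * t < f x\<^sub>1" using x1(3) by (simp add: tau_eq t_def)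
    moreover have "\<alpha> * (\<kappa> * t) \<le> a * (\<kappa> * t)" using \<kappa>t(1) by (intro mult_right_mono) (auto simp: a_def)
    moreover have "(L + a) * \<kappa> * t \<le> \<delta> / 4 * t" using \<kappa>(3) t0 by (intro mult_right_mono) auto
    ultimately show ?thesis by (simp add: algebra_simps abs_le_iff) 
  qed
  have inner: "\<mu> * ((x - x0) \<bullet> e) + A \<le> f x" if x: "x \<in> ellipsoid" "norm (x - z) < 2 * s" for x
  proof -
    have "\<bar>f x - f z\<bar> \<le> L * norm (x - z)"
      using lipschitz_onD[OF lip Eball[OF x(1)] zball(1)] by (simp add: dist_real_def dist_norm)
    moreover have "\<alpha> * ((x - x0) \<bullet> e) - \<alpha> * tau \<le> a * norm (x - z)"
    proof -
      have "\<alpha> * ((x - x0) \<bullet> e) - \<alpha> * tau = \<alpha> * ((x - z) \<bullet> e)"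
        by (simp add: tau_def z_def inner_diff_left inner_add_left algebra_simps)
      also have "\<dots> \<le> \<bar>\<alpha>\<bar> * \<bar>(x - z) \<bullet> e\<bar>" by (metis abs_ge_self abs_mult)
      also have "\<dots> \<le> a * norm (x - z)"
        unfolding a_def using Cauchy_Schwarz_ineq2[of "x - z" e] e by (intro mult_left_mono) auto
      finally show ?thesis .
    qed
    moreover have "(L + a) * norm (x - z) \<le> \<delta> / 4 * t"
    proof -
      have "(L + a) * norm (x - z) \<le> (L + a) * (\<kappa> * t)"
        using x(2) La \<kappa>t(1) by (intro mult_left_mono) (auto simp: s_def)
      also have "\<dots> = (L + a) * \<kappa> * t" by simp
      also have "\<dots> \<le> \<delta> / 4 * t" using \<kappa>(3) t0 by (intro mult_right_mono) auto
      finally show ?thesis .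
    qed
    moreover have "\<mu> * ((x - x0) \<bullet> e) \<le> \<alpha> * ((x - x0) \<bullet> e)"
      using \<mu>\<alpha>(2) E(2)[OF x(1)] by (intro mult_right_mono) auto
    moreover have "A \<le> \<delta> / 2 * t" unfolding A_def using \<epsilon>(2) t0 by (intro mult_right_mono) auto
    ultimately show ?thesis using fz by (simp add: algebra_simps abs_le_iff)
  qed
  have \<mu>big: "a / 2 < \<bar>\<mu>\<bar>"
  proof -
    have "h \<le> a / 4" by (simp add: h_def)
    then show ?thesis using \<mu>\<alpha> a unfolding a_def by linarith
  qed
  have grad0: "barrier_grad \<mu> A g x \<noteq> 0" if x: "x \<in> ellipsoid" for x
  proof
    assume "barrier_grad \<mu> A g x = 0"
    then have "norm (\<mu> *\<^sub>R e) = norm ((2 * g * A * exp (- g * q x)) *\<^sub>R M (x - z))"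
      by (simp add: barrier_grad_def)
    then have "\<bar>\<mu>\<bar> = 2 * g * A * exp (- g * q x) * norm (M (x - z))"
      using e g A by (simp add: abs_mult)
    also have "\<dots> \<le> 2 * g * A * 1 * (Lam * (6 * t / lam))"
    proof (intro mult_mono)
      show "exp (- g * q x) \<le> 1" using g q_nonneg[of x] by simp
      have "norm (x - z) \<le> norm (x - x0) + norm Z"
        using norm_triangle_ineq4[of "x - x0" Z] by (simp add: z_def algebra_simps)
      also have "\<dots> \<le> 6 * t / lam" using E(3)[OF x] Zt tlam by (simp add: field_simps)
      finally show "norm (M (x - z)) \<le> Lam * (6 * t / lam)"
        using M_upper[of "x - z"] Lam mult_left_mono[of "norm (x - z)" "6 * t / lam" Lam] by linarith
    qed (use g A in auto)
    also have "\<dots> = 12 * \<epsilon> * \<gamma> * Lam / lam"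
      using t0 by (simp add: g_def A_def power2_eq_square)
    finally show False using \<epsilon>(3) \<mu>big a by linarith
  qed
  have out: "barrier \<mu> A g x \<le> f x" if x: "x \<in> ellipsoid" "x \<notin> S" for x
    using outside
  proof
    assume neg: "\<alpha> < 0 \<and> (\<forall>x\<in>ball x0 \<rho> - S. f x = 0)"
    have "barrier \<mu> A g x \<le> (\<mu> + 2 * A * g * tau) * ((x - x0) \<bullet> e)"
      by (rule barrier_bounds(1)[OF A g x(1)])
    also have "\<dots> \<le> 0"
    proof (rule mult_nonpos_nonneg)
      have "A * g * tau \<le> A * g * (2 * t)" using A g tau by (intro mult_left_mono) auto
      also have "\<dots> = 2 * \<epsilon> * \<gamma>" using t0 by (simp add: Ag)
      finally have "2 * A * g * tau \<le> a / 4" using \<epsilon>(4) by simp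
      then show "\<mu> + 2 * A * g * tau \<le> 0" using \<mu>\<alpha>(2) neg a by (simp add: a_def)
    qed (use E(2)[OF x(1)] in simp)
    also have "0 = f x" using neg x Eball by simp
    finally show ?thesis .
  next
    assume in_S: "\<forall>x. (norm (x - x0))\<^sup>2 < 2 * r * ((x - x0) \<bullet> e) \<longrightarrow> x \<in> S"
    have "(norm (x - x0))\<^sup>2 < 2 * tau / lam * ((x - x0) \<bullet> e)" using E(1)[OF x(1)] lam(1) by (simp add: field_simps)
    also have "\<dots> \<le> 2 * r * ((x - x0) \<bullet> e)"
    proof (intro mult_right_mono)
      have "2 * tau / lam \<le> 4 * t / lam" using tau lam by (intro divide_right_mono) auto
      then show "2 * tau / lam \<le> 2 * r" using t(3) r by linarith
    qed (use E(2)[OF x(1)] in simp)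
    finally show ?thesis using in_S x(2) by blast
  qed
  have cont: "continuous_on ellipsoid f"
    using lipschitz_on_continuous_on[OF lip] Eball continuous_on_subset by (metis subsetI)
  note cmp = barrier_comparison[OF p S harm lipS cont A g s large grad0 above inner out]

  define K\<^sub>1 where "K\<^sub>1 = A * g * Lam + K + c * Lam / (2 * tau)"
  have "\<mu> + c \<in> slopes f x0 e"
  proof (rule slopesI)
    show "0 \<le> K\<^sub>1" using A g Lam K c tau by (simp add: K\<^sub>1_def)
    \<comment> \<open>Within \<kappa> t / 2 of x0 the distance to \<open>z\<close> exceeds \<kappa>
      t / 2 = 2 s, so the ball removed around the centre is avoided.\<close>
    show "0 < min \<eta> (\<kappa> / 2 * t)" using K \<kappa> t0 by simp
    fix x assume x: "norm (x - x0) < min \<eta> (\<kappa> / 2 * t)" "0 \<le> (x - x0) \<bullet> e"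
    show "(\<mu> + c) * ((x - x0) \<bullet> e) - K\<^sub>1 * (norm (x - x0))\<^sup>2 \<le> f x"
    proof (cases "x \<in> ellipsoid")
      case True
      have "norm Z \<le> norm (x - z) + norm (x - x0)"
        using norm_triangle_ineq4[of "x - x0" "x - z"] by (simp add: z_def)
      then have "s < norm (x - z)" using Ztau tau(1) x(1) s by (simp add: s_def)
      then have "barrier \<mu> A g x \<le> f x" using cmp True by blast
      moreover have "\<mu> * ((x - x0) \<bullet> e) + A * g * exp (- g * tau\<^sup>2) * (2 * tau * ((x - x0) \<bullet> e) - Lam * (norm (x - x0))\<^sup>2)
        \<le> barrier \<mu> A g x"
        by (rule barrier_bounds(2)[OF A g True])
      moreover have "c * ((x - x0) \<bullet> e) \<le> A * g * exp (- g * tau\<^sup>2) * (2 * tau * ((x - x0) \<bullet> e))"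
      proof -
        have "tau\<^sup>2 \<le> (2 * t)\<^sup>2" using tau by (intro power_mono) auto
        then have "g * tau\<^sup>2 \<le> g * (2 * t)\<^sup>2" using g by (intro mult_left_mono) auto
        also have "\<dots> = 4 * \<gamma>" using t0 by (simp add: g_def power_mult_distrib)
        finally have ex: "exp (- 4 * \<gamma>) \<le> exp (- g * tau\<^sup>2)" by simp
        have "c * ((x - x0) \<bullet> e) = A * g * exp (- 4 * \<gamma>) * (2 * (\<kappa> * t) * ((x - x0) \<bullet> e))"
          using t0 by (simp add: Ag c_def)
        also have "\<dots> \<le> A * g * exp (- g * tau\<^sup>2) * (2 * tau * ((x - x0) \<bullet> e))"
          using A g ex tau \<kappa>t x(2) by (intro mult_mono) auto
        finally show ?thesis .
      qed
      moreover have "A * g * exp (- g * tau\<^sup>2) * (Lam * (norm (x - x0))\<^sup>2) \<le> K\<^sub>1 * (norm (x - x0))\<^sup>2"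
      proof -
        have "A * g * exp (- g * tau\<^sup>2) * (Lam * (norm (x - x0))\<^sup>2) \<le> A * g * 1 * (Lam * (norm (x - x0))\<^sup>2)"
          using A g Lam by (intro mult_right_mono mult_left_mono) auto
        also have "\<dots> = (A * g * Lam) * (norm (x - x0))\<^sup>2" by simp
        also have "\<dots> \<le> K\<^sub>1 * (norm (x - x0))\<^sup>2"
          using K(1) c Lam tau by (intro mult_right_mono) (auto simp: K\<^sub>1_def)
        finally show ?thesis .
      qed
      ultimately show ?thesis by (simp only: distrib_right right_diff_distrib)
    next
      case False
      \<comment> \<open>Off the ellipsoid the height itself is of second order, so the additional
        slope c disappears in the quadratic error with constant \<open>K\<^sub>1\<close>.\<close>
      have "2 * tau * ((x - x0) \<bullet> e) \<le> M (x - x0) \<bullet> (x - x0)"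
        using False q_shift[of x] by (simp add: ellipsoid_def)
      also have "\<dots> \<le> Lam * (norm (x - x0))\<^sup>2"
        using norm_cauchy_schwarz[of "M (x - x0)" "x - x0"] mult_right_mono[OF M_upper[of "x - x0"], of "norm (x - x0)"]
        by (simp add: power2_eq_square mult.assoc)
      finally have "(x - x0) \<bullet> e \<le> Lam / (2 * tau) * (norm (x - x0))\<^sup>2" using tau by (simp add: field_simps)
      then have "c * ((x - x0) \<bullet> e) \<le> c * (Lam / (2 * tau) * (norm (x - x0))\<^sup>2)" using c by (intro mult_left_mono) auto
      also have "\<dots> = c * Lam / (2 * tau) * (norm (x - x0))\<^sup>2" by simp
      finally have 1: "c * ((x - x0) \<bullet> e) \<le> c * Lam / (2 * tau) * (norm (x - x0))\<^sup>2" .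
      have 2: "m * ((x - x0) \<bullet> e) - K * (norm (x - x0))\<^sup>2 \<le> f x" using K(3) x by simp
      have 3: "\<mu> * ((x - x0) \<bullet> e) \<le> m * ((x - x0) \<bullet> e)" using \<mu>m x(2) by (intro mult_right_mono)
      have 4: "0 \<le> A * g * Lam * (norm (x - x0))\<^sup>2" using A g Lam by simp
      show ?thesis using 1 2 3 4 unfolding K\<^sub>1_def by (simp only: distrib_right)
    qed
  qed
  then have "\<mu> + c \<le> \<alpha>" by (rule max)
  moreover have "3/2 * h \<le> 3/4 * c" by (simp add: h_def)
  ultimately show False using \<mu>\<alpha>(1) c by linarith
qed

lemma positive_slope:
  fixes f :: "'a::euclidean_space \<Rightarrow> real" and p :: real
  assumes p: "1 < p" and S: "open S" and harm: "p_harmonic_on p S f" and lipS: "L-lipschitz_on S f"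
    and pos: "\<And>x. x \<in> S \<Longrightarrow> 0 < f x" and nonneg: "\<And>x. 0 \<le> f x"
    and r: "0 < r" and e: "norm e = 1" and ball: "ball (x0 + r *\<^sub>R e) r \<subseteq> S"
  shows "\<exists>m>0. m \<in> slopes f x0 e"
proof -
  define tau where "tau = r / 2"
  define z where "z = x0 + tau *\<^sub>R e"
  have tau: "0 < tau" using r by (simp add: tau_def)
  have ee: "e \<bullet> e = 1" using e by (simp add: power2_norm_eq_inner[symmetric])
  interpret barrier_geometry "\<lambda>v. v" 1 1 tau x0 z e
    by (rule barrier_geometry.intro) (use tau ee in \<open>auto simp: z_def power2_norm_eq_inner linear_id[unfolded id_def] inner_commute\<close>)
  have E_iff: "x \<in> ellipsoid \<longleftrightarrow> x \<in> ball z tau" for x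
  proof -
    have "(norm (x - z))\<^sup>2 < tau\<^sup>2 \<longleftrightarrow> norm (x - z) < tau"
      using tau by (auto intro: power2_less_imp_less power_strict_mono)
    then show ?thesis
      by (simp add: ellipsoid_def q_def power2_norm_eq_inner[symmetric] dist_norm norm_minus_commute)
  qed
  have zy: "dist (x0 + r *\<^sub>R e) z = tau"
    using e r by (simp add: z_def dist_norm scaleR_diff_left[symmetric] tau_def)
  have ES: "ellipsoid \<subseteq> S"
  proof
    fix x assume "x \<in> ellipsoid"
    then have "dist (x0 + r *\<^sub>R e) x < tau + tau"
      using dist_triangle[of "x0 + r *\<^sub>R e" x z] zy by (simp add: E_iff dist_commute)
    then show "x \<in> S" using ball by (auto simp: tau_def)
  qed
  \<comment> \<open>Small enough for the core of radius 2 s to fit into the ball of radius r / 2,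
    and for points within r / 4 of x0 to stay farther than s from \<open>z\<close>.\<close>
  define s where "s = r / 16"
  have s: "0 < s" using r by (simp add: s_def)
  have "2 * s < tau" using r by (simp add: s_def tau_def)
  then have "cball z (2 * s) \<subseteq> ellipsoid" by (auto simp: E_iff)
  then have cS: "cball z (2 * s) \<subseteq> S" using ES by blast
  have contS: "continuous_on S f" by (rule lipschitz_on_continuous_on[OF lipS])
  obtain x\<^sub>m where xm: "x\<^sub>m \<in> cball z (2 * s)" "\<And>x. x \<in> cball z (2 * s) \<Longrightarrow> f x\<^sub>m \<le> f x"
    using continuous_attains_inf[OF compact_cball _ continuous_on_subset[OF contS cS]] s by force
  define A where "A = f x\<^sub>m"
  have A: "0 < A" using pos xm(1) cS by (auto simp: A_def)
  define g where "g = ((DIM('a) + \<bar>p - 2\<bar>) * 1 + 1) / (2 * min 1 (p - 1) * 1\<^sup>2 * s\<^sup>2)"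
  have den: "0 < 2 * min 1 (p - 1) * 1\<^sup>2 * s\<^sup>2" using p s by simp
  then have g: "0 < g" by (simp add: g_def)
  have large: "(DIM('a) + \<bar>p - 2\<bar>) * 1 < 2 * g * min 1 (p - 1) * 1\<^sup>2 * s\<^sup>2"
  proof -
    have "g * (2 * min 1 (p - 1) * 1\<^sup>2 * s\<^sup>2) = (DIM('a) + \<bar>p - 2\<bar>) * 1 + 1"
      unfolding g_def using den by (metis less_numeral_extra(3) nonzero_eq_divide_eq)
    then show ?thesis by (simp add: mult_ac)
  qed
  have cmp: "barrier 0 A g x \<le> f x" if "x \<in> ellipsoid" "s < norm (x - z)" for x
  proof (rule barrier_comparison[OF p S harm lipS continuous_on_subset[OF contS ES] A g s large _ _ _ _ that])
    show "barrier_grad 0 A g y \<noteq> 0" if "s < norm (y - z)" for y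
      using that s g A by (auto simp: barrier_grad_def)
    show "0 * ((y - x0) \<bullet> e) + A \<le> f y" if "norm (y - z) < 2 * s" for y
      using xm(2)[of y] that by (simp add: A_def dist_norm norm_minus_commute)
    show "barrier 0 A g y \<le> f y" if "y \<in> ellipsoid" "y \<notin> S" for y using that ES by blast
  qed (use nonneg in auto)
  define k where "k = A * g * exp (- g * tau\<^sup>2)"
  have k: "0 < k" using A g by (simp add: k_def)
  have "k * (2 * tau) \<in> slopes f x0 e"
  proof (rule slopesI)
    show "0 \<le> k" using k by simp
    show "0 < r / 4" using r by simp
    fix x assume x: "norm (x - x0) < r / 4"
    show "k * (2 * tau) * ((x - x0) \<bullet> e) - k * (norm (x - x0))\<^sup>2 \<le> f x"
    proof (cases "x \<in> ellipsoid")
      case True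
      have "tau \<le> norm (x - z) + norm (x - x0)"
        using norm_triangle_ineq4[of "x - x0" "x - z"] tau e by (simp add: z_def)
      then have "s < norm (x - z)" using x r by (simp add: s_def tau_def)
      from cmp[OF True this] barrier_bounds(2)[OF A g True, of 0] show ?thesis
        by (simp add: k_def algebra_simps)
    next
      case False
      then have "2 * tau * ((x - x0) \<bullet> e) \<le> (norm (x - x0))\<^sup>2"
        using q_shift[of x] by (simp add: ellipsoid_def power2_norm_eq_inner)
      then have "k * (2 * tau * ((x - x0) \<bullet> e)) \<le> k * (norm (x - x0))\<^sup>2" using k by (intro mult_left_mono) auto
      then show ?thesis using nonneg[of x] by (simp add: mult.assoc)
    qed
  qed
  then show ?thesis using k tau by (intro exI[of _ "k * (2 * tau)"]) auto
qed

subsection \<open>Extension by zero\<close>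

lemma absolutely_integrable_on_cong:
  assumes "\<And>x. x \<in> K \<Longrightarrow> u x = v x"
  shows "u absolutely_integrable_on K \<longleftrightarrow> v absolutely_integrable_on K"
proof -
  have "(\<lambda>x. indicator K x *\<^sub>R u x) = (\<lambda>x. indicator K x *\<^sub>R v x)"
    using assms by (auto simp: indicator_def fun_eq_iff)
  then show ?thesis by (simp add: set_integrable_def)
qed

lemma p_harmonic_on_cong:
  fixes u v :: "'a::euclidean_space \<Rightarrow> real"
  assumes eq: "\<And>x. x \<in> S \<Longrightarrow> u x = v x" and "p_harmonic_on p S u"
  shows "p_harmonic_on p S v"
proof -
  have "u absolutely_integrable_on K \<longleftrightarrow> v absolutely_integrable_on K" if "K \<subseteq> S" for K
    using eq that by (intro absolutely_integrable_on_cong) auto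
  then have "locally_integrable S u \<longleftrightarrow> locally_integrable S v" by (simp add: locally_integrable_def cong: conj_cong)
  moreover have "(LINT x:S|lebesgue. u x *\<^sub>R w x) = (LINT x:S|lebesgue. v x *\<^sub>R w x)" for w :: "'a \<Rightarrow> 'a"
  proof -
    have "(\<lambda>x. indicator S x *\<^sub>R u x *\<^sub>R w x) = (\<lambda>x. indicator S x *\<^sub>R v x *\<^sub>R w x)"
      using eq by (auto simp: indicator_def fun_eq_iff)
    then show ?thesis by (simp only: set_lebesgue_integral_def)
  qed
  ultimately have "weak_gradient S u G \<longleftrightarrow> weak_gradient S v G" for G
    by (simp only: weak_gradient_def)
  then show ?thesis using assms(2) by (simp only: p_harmonic_on_def)
qed

lemma locally_integrable_uminus: "locally_integrable S w \<Longrightarrow> locally_integrable S (\<lambda>x. - w x)"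
  unfolding locally_integrable_def set_integrable_def by simp

lemma p_harmonic_on_uminus:
  fixes u :: "'a::euclidean_space \<Rightarrow> real"
  assumes "p_harmonic_on p S u"
  shows "p_harmonic_on p S (\<lambda>x. - u x)"
proof -
  obtain G where G: "weak_gradient S u G" "locally_integrable S (\<lambda>x. norm (G x) powr p)"
    "\<And>\<phi>. test_function S \<phi> \<Longrightarrow> (LINT x:S|lebesgue. (norm (G x) powr (p - 2) *\<^sub>R G x) \<bullet> grad \<phi> x) = 0"
    using assms by (auto simp: p_harmonic_on_def)
  have "weak_gradient S (\<lambda>x. - u x) (\<lambda>x. - G x)"
    using G(1) unfolding weak_gradient_def set_lebesgue_integral_def
    by (simp add: locally_integrable_uminus)
  moreover have "(LINT x:S|lebesgue. (norm (- G x) powr (p - 2) *\<^sub>R - G x) \<bullet> grad \<phi> x) = 0"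
    if "test_function S \<phi>" for \<phi>
    using G(3)[OF that] unfolding set_lebesgue_integral_def by simp
  ultimately show ?thesis
    unfolding p_harmonic_on_def using G(2) by (intro exI[of _ "\<lambda>x. - G x"]) simp
qed

text \<open>A segment in the ball from a point of \<open>S\<close> to a point off \<open>S\<close>
  meets the frontier, where \<open>u\<close> tends to 0. The Lipschitz estimate up to the crossing
  point is enough, since that point lies on the segment.\<close>

lemma extension_by_zero_lipschitz:
  fixes u :: "'a::euclidean_space \<Rightarrow> real"
  assumes S: "open S" and lip: "L-lipschitz_on S u"
    and van: "vanishes_continuously S (frontier S \<inter> ball x0 \<rho>) u"
  shows "L-lipschitz_on (ball x0 \<rho>) (\<lambda>x. if x \<in> S then u x else 0)"
proof -
  let ?F = "frontier S \<inter> ball x0 \<rho>" and ?f = "\<lambda>x. if x \<in> S then u x else 0"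
  have L: "0 \<le> L" using lip lipschitz_on_nonneg by blast
  have bdry: "\<bar>u a\<bar> \<le> L * dist a w" if a: "a \<in> S" and w: "w \<in> ?F" for a w
  proof -
    have wS: "w \<notin> S" using w S by (simp add: frontier_def interior_open)
    have "w \<in> closure S" using w by (simp add: frontier_def)
    then obtain X where X: "\<And>n. X n \<in> S" "X \<longlonglongrightarrow> w" by (auto simp: closure_sequential)
    have "continuous (at w within S \<union> ?F) ?f" using van w by (auto simp: vanishes_continuously_def)
    then have "(?f \<circ> X) \<longlonglongrightarrow> ?f w"
      using X unfolding continuous_within_sequentially by blast
    then have "(\<lambda>n. ?f (X n)) \<longlonglongrightarrow> ?f w" by (simp only: comp_def)
    then have "(\<lambda>n. u (X n)) \<longlonglongrightarrow> 0" using X(1) wS by simp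
    then have "(\<lambda>n. \<bar>u a - u (X n)\<bar>) \<longlonglongrightarrow> \<bar>u a - 0\<bar>" by (intro tendsto_intros)
    moreover have "(\<lambda>n. L * dist a (X n)) \<longlonglongrightarrow> L * dist a w" by (intro tendsto_intros X)
    moreover have "\<bar>u a - u (X n)\<bar> \<le> L * dist a (X n)" for n
      using lipschitz_onD[OF lip a X(1)] by (simp add: dist_real_def)
    ultimately show ?thesis using LIMSEQ_le by force
  qed
  have mixed: "\<bar>u a\<bar> \<le> L * dist a b" if ab: "a \<in> ball x0 \<rho>" "b \<in> ball x0 \<rho>" "a \<in> S" "b \<notin> S" for a b
  proof -
    have "closed_segment a b \<inter> frontier S \<noteq> {}"
      using ab by (intro connected_Int_frontier) auto
    then obtain w where w: "w \<in> closed_segment a b" "w \<in> frontier S" by blast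
    have "closed_segment a b \<subseteq> ball x0 \<rho>" using ab by (simp add: closed_segment_subset)
    then have "\<bar>u a\<bar> \<le> L * dist a w" using bdry w ab by blast
    also have "\<dots> \<le> L * dist a b"
      using segment_bound(1)[OF w(1)] L by (intro mult_left_mono) (auto simp: dist_norm norm_minus_commute)
    finally show ?thesis .
  qed
  show ?thesis
  proof (rule lipschitz_onI[OF _ L])
    fix a b assume ab: "a \<in> ball x0 \<rho>" "b \<in> ball x0 \<rho>"
    show "dist (?f a) (?f b) \<le> L * dist a b"
      using lipschitz_onD[OF lip, of a b] mixed[OF ab] mixed[OF ab(2,1)] L
      by (auto simp: dist_real_def dist_commute)
  qed
qed

subsection \<open>The asymptotic development\<close>

text \<open>\<alpha> is the supremum of the slopes: Lipschitz continuity and f x0 = 0 bound them by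
  \<open>L\<close>, and \<open>slopes_mono\<close> fills in everything below the supremum.\<close>

lemma slope_exists:
  assumes e: "norm e = 1" and "0 < \<rho>" and lip: "L-lipschitz_on (ball x0 \<rho>) f" and f0: "f x0 = 0"
    and ne: "m\<^sub>0 \<in> slopes f x0 e"
  obtains \<alpha> where "\<And>m. m < \<alpha> \<Longrightarrow> m \<in> slopes f x0 e" "\<And>m. m \<in> slopes f x0 e \<Longrightarrow> m \<le> \<alpha>"
proof -
  have "f x \<le> L * norm (x - x0)" if "norm (x - x0) < \<rho>" for x
    using lipschitz_onD[OF lip, of x x0] that \<open>0 < \<rho>\<close> f0
    by (simp add: dist_real_def dist_norm norm_minus_commute)
  then have "m \<le> L" if "m \<in> slopes f x0 e" for m
    using slopes_le[OF that e \<open>0 < \<rho>\<close>] by blast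
  then have bdd: "bdd_above (slopes f x0 e)" by (rule bdd_aboveI)
  show ?thesis
  proof
    show "m \<in> slopes f x0 e" if m: "m < Sup (slopes f x0 e)" for m
    proof -
      obtain m' where "m' \<in> slopes f x0 e" "m < m'" using less_cSupE[OF m] ne by blast
      then show ?thesis using slopes_mono by (meson less_imp_le)
    qed
    show "m \<le> Sup (slopes f x0 e)" if "m \<in> slopes f x0 e" for m
      using cSup_upper[OF that bdd] .
  qed
qed

lemma frontier_ball_unit:
  fixes x0 y :: "'a::euclidean_space"
  assumes "0 < r" "x0 \<in> frontier (ball y r)"
  shows "norm ((y - x0) /\<^sub>R norm (y - x0)) = 1" "y = x0 + r *\<^sub>R ((y - x0) /\<^sub>R norm (y - x0))"
  using assms by (auto simp: frontier_ball dist_norm norm_minus_commute)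

lemma norm_shift_square:
  fixes e :: "'a::real_inner"
  assumes "norm e = 1"
  shows "(norm (v - r *\<^sub>R e))\<^sup>2 = (norm v)\<^sup>2 - 2 * r * (v \<bullet> e) + r\<^sup>2"
proof -
  have "e \<bullet> e = 1" using assms by (simp add: power2_norm_eq_inner[symmetric])
  then show ?thesis
    unfolding power2_norm_eq_inner
    by (simp add: inner_diff_left inner_diff_right inner_commute power2_eq_square algebra_simps)
qed

lemma ball_iff_square:
  fixes e x0 :: "'a::real_inner"
  assumes "norm e = 1" "0 < r"
  shows "x \<in> ball (x0 + r *\<^sub>R e) r \<longleftrightarrow> (norm (x - x0))\<^sup>2 < 2 * r * ((x - x0) \<bullet> e)"
proof -
  have "x \<in> ball (x0 + r *\<^sub>R e) r \<longleftrightarrow> norm (x - x0 - r *\<^sub>R e) < r"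
    by (simp add: dist_norm norm_minus_commute algebra_simps)
  also have "\<dots> \<longleftrightarrow> (norm (x - x0 - r *\<^sub>R e))\<^sup>2 < r\<^sup>2"
    using assms(2) by (auto intro: power2_less_imp_less power_strict_mono)
  finally show ?thesis unfolding norm_shift_square[OF assms(1)] by simp
qed

lemma interior_ball_asymptotics:
  fixes f :: "'a::euclidean_space \<Rightarrow> real" and p :: real
  assumes p: "1 < p" and S: "open S" and harm: "p_harmonic_on p S f" and lipS: "L-lipschitz_on S f"
    and rho: "0 < \<rho>" and lip: "L-lipschitz_on (ball x0 \<rho>) f" and f0: "f x0 = 0"
    and pos: "\<And>x. x \<in> S \<Longrightarrow> 0 < f x" and nonneg: "\<And>x. 0 \<le> f x"
    and r: "0 < r" and e: "norm e = 1" and ball: "ball (x0 + r *\<^sub>R e) r \<subseteq> S"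
  shows "\<exists>\<alpha>>0. (\<lambda>x. f x - \<alpha> * max ((x - x0) \<bullet> e) 0)
    \<in> o[at x0 within ball (x0 + r *\<^sub>R e) r](\<lambda>x. norm (x - x0))"
proof -
  obtain m where m: "0 < m" "m \<in> slopes f x0 e"
    using positive_slope[OF p S harm lipS pos nonneg r e ball] by blast
  obtain \<alpha> where \<alpha>: "\<And>m. m < \<alpha> \<Longrightarrow> m \<in> slopes f x0 e" "\<And>m. m \<in> slopes f x0 e \<Longrightarrow> m \<le> \<alpha>"
    using slope_exists[OF e rho lip f0 m(2)] by blast
  have \<alpha>0: "0 < \<alpha>" using m \<alpha>(2) by fastforce
  have "(\<lambda>x. f x - \<alpha> * max ((x - x0) \<bullet> e) 0) \<in> o[at x0 within ball (x0 + r *\<^sub>R e) r](\<lambda>x. norm (x - x0))"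
  proof (rule landau_o.smallI)
    fix c :: real assume c: "0 < c"
    obtain \<eta>1 where lo: "0 < \<eta>1"
      "\<And>x. norm (x - x0) < \<eta>1 \<Longrightarrow> 0 \<le> (x - x0) \<bullet> e \<Longrightarrow> \<alpha> * ((x - x0) \<bullet> e) - c * norm (x - x0) \<le> f x"
      using slopes_lower_bound[OF \<alpha>(1) e c] by blast
    have "\<forall>x. (norm (x - x0))\<^sup>2 < 2 * r * ((x - x0) \<bullet> e) \<longrightarrow> x \<in> S"
      using ball ball_iff_square[OF e r] by blast
    then obtain \<eta>2 where up: "0 < \<eta>2"
      "\<And>x. norm (x - x0) < \<eta>2 \<Longrightarrow> 0 \<le> (x - x0) \<bullet> e \<Longrightarrow> f x \<le> \<alpha> * ((x - x0) \<bullet> e) + c * norm (x - x0)"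
      using slopes_upper_bound[OF p S harm lipS rho lip f0 e _ \<alpha> r _ c] \<alpha>0 by blast
    show "\<forall>\<^sub>F x in at x0 within ball (x0 + r *\<^sub>R e) r.
      norm (f x - \<alpha> * max ((x - x0) \<bullet> e) 0) \<le> c * norm (norm (x - x0))"
      unfolding eventually_at
    proof (intro exI[of _ "min \<eta>1 \<eta>2"] conjI ballI impI)
      fix x assume x: "x \<in> ball (x0 + r *\<^sub>R e) r" "x \<noteq> x0 \<and> dist x x0 < min \<eta>1 \<eta>2"
      have "0 < 2 * r * ((x - x0) \<bullet> e)"
        using x(1) unfolding ball_iff_square[OF e r] by (smt (verit) zero_le_power2)
      then have "0 < (x - x0) \<bullet> e" using r by (simp add: zero_less_mult_iff)
      then show "norm (f x - \<alpha> * max ((x - x0) \<bullet> e) 0) \<le> c * norm (norm (x - x0))"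
        using lo(2)[of x] up(2)[of x] x(2) by (simp add: dist_norm abs_le_iff)
    qed (use lo(1) up(1) in simp)
  qed
  then show ?thesis using \<alpha>0 by blast
qed

lemma exterior_ball_asymptotics:
  fixes f :: "'a::euclidean_space \<Rightarrow> real" and p :: real
  assumes p: "1 < p" and S: "open S" and harm: "p_harmonic_on p S f" and lipS: "L-lipschitz_on S f"
    and rho: "0 < \<rho>" and lip: "L-lipschitz_on (ball x0 \<rho>) f" and f0: "f x0 = 0"
    and nonneg: "\<And>x. 0 \<le> f x" and zero: "\<And>x. x \<notin> S \<Longrightarrow> f x = 0"
    and r: "0 < r" and e: "norm e = 1" and ball: "ball (x0 - r *\<^sub>R e) r \<subseteq> - S"
  shows "\<exists>\<beta>\<ge>0. (\<lambda>x. f x - \<beta> * max ((x - x0) \<bullet> e) 0) \<in> o[at x0 within S](\<lambda>x. norm (x - x0)) \<and>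
     (0 < \<beta> \<longrightarrow> tangent_hyperplane_at (frontier S) x0 e)"
proof -
  have L: "0 \<le> L" using lip lipschitz_on_nonneg by blast
  have ee: "e \<bullet> e = 1" using e by (simp add: power2_norm_eq_inner[symmetric])
  have Lip: "\<bar>f x - f y\<bar> \<le> L * norm (x - y)" if "norm (x - x0) < \<rho>" "norm (y - x0) < \<rho>" for x y
    using lipschitz_onD[OF lip, of x y] that by (simp add: dist_real_def dist_norm norm_minus_commute)
  \<comment> \<open>\<open>S\<close> is open, so the touching ball may be replaced by its closure;
    the point constructed below may lie on the sphere.\<close>
  have cball: "cball (x0 - r *\<^sub>R e) r \<subseteq> - S"
    using closure_mono[OF ball] S r by (simp add: closed_Compl)
  have tangential: "norm (v - (v \<bullet> e) *\<^sub>R e) \<le> norm v" "(v - (v \<bullet> e) *\<^sub>R e) \<bullet> e = 0" for v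
  proof -
    have "(norm (v - (v \<bullet> e) *\<^sub>R e))\<^sup>2 = (norm v)\<^sup>2 - (v \<bullet> e)\<^sup>2"
      unfolding norm_shift_square[OF e] by (simp add: power2_eq_square)
    then have "(norm (v - (v \<bullet> e) *\<^sub>R e))\<^sup>2 \<le> (norm v)\<^sup>2" by simp
    then show "norm (v - (v \<bullet> e) *\<^sub>R e) \<le> norm v" by (rule power2_le_imp_le) simp
    show "(v - (v \<bullet> e) *\<^sub>R e) \<bullet> e = 0" by (simp add: inner_diff_left ee)
  qed
  have outer: "- ((x - x0) \<bullet> e) \<le> (norm (x - x0))\<^sup>2 / (2 * r)" if "x \<notin> ball (x0 - r *\<^sub>R e) r" for x
  proof -
    have "x \<notin> ball (x0 + r *\<^sub>R (- e)) r" using that by simp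
    then have "2 * r * ((x - x0) \<bullet> (- e)) \<le> (norm (x - x0))\<^sup>2"
      using ball_iff_square[of "- e" r x x0] e r by simp
    then show ?thesis using r by (simp add: field_simps)
  qed
  let ?g = "\<lambda>x. - f x"
  have slopeL: "- L \<in> slopes ?g x0 e"
  proof (rule slopesI)
    show "0 \<le> L / r" using L r by simp
    show "0 < min r (\<rho> / 2)" using r rho by simp
    fix x assume x: "norm (x - x0) < min r (\<rho> / 2)" "0 \<le> (x - x0) \<bullet> e"
    define X where "X = x - x0"
    \<comment> \<open>X is projected to the hyperplane and pushed down by |X|^2 / r, to leading
      order twice the depth |X|^2 / (2 r) of the sphere below it. This lands in the closed ball,
      where f = 0, at distance X \<bullet> e + |X|^2 / r from x.\<close>
    define Y where "Y = X - (X \<bullet> e) *\<^sub>R e - ((norm X)\<^sup>2 / r) *\<^sub>R e"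
    have X2: "(norm X)\<^sup>2 / r \<le> norm X"
      using mult_right_mono[of "norm X" r "norm X"] x(1) r by (simp add: X_def power2_eq_square divide_le_eq mult.commute)
    have "Y + r *\<^sub>R e = X - (X \<bullet> e) *\<^sub>R e - ((norm X)\<^sup>2 / r - r) *\<^sub>R e" by (simp add: Y_def algebra_simps)
    then have "(norm (Y + r *\<^sub>R e))\<^sup>2 = (norm (X - (X \<bullet> e) *\<^sub>R e))\<^sup>2 + ((norm X)\<^sup>2 / r - r)\<^sup>2"
      by (simp only: norm_shift_square[OF e, of "X - (X \<bullet> e) *\<^sub>R e"] tangential(2))
    also have "\<dots> \<le> (norm X)\<^sup>2 + ((norm X)\<^sup>2 / r - r)\<^sup>2"
      using power_mono[OF tangential(1)[of X], of 2] by simp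
    also have "((norm X)\<^sup>2 / r - r)\<^sup>2 = ((norm X)\<^sup>2 / r)\<^sup>2 - 2 * (norm X)\<^sup>2 + r\<^sup>2"
      using r by (simp add: power2_diff)
    also have "((norm X)\<^sup>2 / r)\<^sup>2 \<le> (norm X)\<^sup>2" using X2 r by (intro power_mono) auto
    finally have "(norm (Y + r *\<^sub>R e))\<^sup>2 \<le> r\<^sup>2" by simp
    then have "norm (Y + r *\<^sub>R e) \<le> r" by (rule power2_le_imp_le) (use r in simp)
    moreover have "x0 - r *\<^sub>R e - (x0 + Y) = - (Y + r *\<^sub>R e)" by simp
    then have "dist (x0 - r *\<^sub>R e) (x0 + Y) = norm (Y + r *\<^sub>R e)"
      by (simp only: dist_norm norm_minus_cancel)
    ultimately have "x0 + Y \<in> cball (x0 - r *\<^sub>R e) r" by (simp only: mem_cball)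
    then have "f (x0 + Y) = 0" using cball zero by blast
    moreover have "norm Y \<le> norm X + norm X"
    proof -
      have "norm Y \<le> norm (X - (X \<bullet> e) *\<^sub>R e) + norm (((norm X)\<^sup>2 / r) *\<^sub>R e)"
        unfolding Y_def by (rule norm_triangle_ineq4)
      also have "\<dots> \<le> norm X + norm X" using tangential(1)[of X] X2 e r by simp
      finally show ?thesis .
    qed
    then have "norm Y < \<rho>" "norm X < \<rho>" using x(1) rho unfolding X_def by linarith+
    then have "\<bar>f x - f (x0 + Y)\<bar> \<le> L * norm (x - (x0 + Y))"
      using Lip[of x "x0 + Y"] by (simp add: X_def)
    moreover have "norm (x - (x0 + Y)) = X \<bullet> e + (norm X)\<^sup>2 / r"
    proof -
      have "x - (x0 + Y) = (X \<bullet> e + (norm X)\<^sup>2 / r) *\<^sub>R e" by (simp add: Y_def X_def algebra_simps)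
      then show ?thesis using e r x(2) by (simp add: X_def)
    qed
    ultimately have "f x \<le> L * (X \<bullet> e + (norm X)\<^sup>2 / r)" by simp
    then show "- L * ((x - x0) \<bullet> e) - L / r * (norm (x - x0))\<^sup>2 \<le> - f x"
      by (simp add: X_def distrib_left)
  qed
  have lip': "L-lipschitz_on (ball x0 \<rho>) ?g" "L-lipschitz_on S ?g" using lip lipS by simp_all
  have g0: "?g x0 = 0" using f0 by simp
  obtain \<alpha> where \<alpha>: "\<And>m. m < \<alpha> \<Longrightarrow> m \<in> slopes ?g x0 e" "\<And>m. m \<in> slopes ?g x0 e \<Longrightarrow> m \<le> \<alpha>"
    using slope_exists[OF e rho lip'(1) g0 slopeL] by blast
  have "\<alpha> \<le> 0"
  proof (rule dense_le)
    fix m assume "m < \<alpha>"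
    then show "m \<le> 0" using slopes_le[OF \<alpha>(1) e rho, of m 0] nonneg by simp
  qed
  define \<beta> where "\<beta> = - \<alpha>"
  have \<beta>: "0 \<le> \<beta>" using \<open>\<alpha> \<le> 0\<close> by (simp add: \<beta>_def)
  have half: "\<exists>\<eta>>0. \<forall>x. norm (x - x0) < \<eta> \<longrightarrow> 0 \<le> (x - x0) \<bullet> e \<longrightarrow>
    \<bar>f x - \<beta> * ((x - x0) \<bullet> e)\<bar> \<le> c * norm (x - x0)" if c: "0 < c" for c
  proof -
    obtain \<eta>1 where lo: "0 < \<eta>1"
      "\<And>x. norm (x - x0) < \<eta>1 \<Longrightarrow> 0 \<le> (x - x0) \<bullet> e \<Longrightarrow> \<alpha> * ((x - x0) \<bullet> e) - c * norm (x - x0) \<le> ?g x"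
      using slopes_lower_bound[OF \<alpha>(1) e c] by blast
    have "\<exists>\<eta>>0. \<forall>x. norm (x - x0) < \<eta> \<longrightarrow> 0 \<le> (x - x0) \<bullet> e \<longrightarrow>
       ?g x \<le> \<alpha> * ((x - x0) \<bullet> e) + c * norm (x - x0)"
    proof (cases "\<alpha> = 0")
      case True
      have "?g x \<le> c * norm (x - x0)" for x
        using nonneg[of x] mult_nonneg_nonneg[OF less_imp_le[OF c] norm_ge_zero[of "x - x0"]] by linarith
      then show ?thesis using True by (intro exI[of _ 1]) simp
    next
      case False
      then have "\<alpha> < 0" using \<open>\<alpha> \<le> 0\<close> by simp
      show ?thesis
        by (rule slopes_upper_bound[OF p S p_harmonic_on_uminus[OF harm] lip'(2) rho lip'(1) _ e False \<alpha> r _ c])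
           (use \<open>\<alpha> < 0\<close> f0 zero in auto)
    qed
    then obtain \<eta>2 where up: "0 < \<eta>2"
      "\<And>x. norm (x - x0) < \<eta>2 \<Longrightarrow> 0 \<le> (x - x0) \<bullet> e \<Longrightarrow> ?g x \<le> \<alpha> * ((x - x0) \<bullet> e) + c * norm (x - x0)"
      by blast
    show ?thesis
    proof (intro exI[of _ "min \<eta>1 \<eta>2"] conjI allI impI)
      fix x assume "norm (x - x0) < min \<eta>1 \<eta>2" "0 \<le> (x - x0) \<bullet> e"
      then show "\<bar>f x - \<beta> * ((x - x0) \<bullet> e)\<bar> \<le> c * norm (x - x0)"
        using lo(2)[of x] up(2)[of x] by (simp add: \<beta>_def abs_le_iff)
    qed (use lo(1) up(1) in simp)
  qed
  have "(\<lambda>x. f x - \<beta> * max ((x - x0) \<bullet> e) 0) \<in> o[at x0 within S](\<lambda>x. norm (x - x0))"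
  proof (rule landau_o.smallI)
    fix c :: real assume c: "0 < c"
    obtain \<eta> where \<eta>: "0 < \<eta>" "\<And>x. norm (x - x0) < \<eta> \<Longrightarrow> 0 \<le> (x - x0) \<bullet> e \<Longrightarrow>
        \<bar>f x - \<beta> * ((x - x0) \<bullet> e)\<bar> \<le> c / 2 * norm (x - x0)"
      using half[of "c / 2"] c by auto
    define d where "d = min (min \<eta> \<rho>) (c * r / (L + 1))"
    have d: "0 < d" "d \<le> \<eta>" "d \<le> \<rho>" "L * d \<le> c * r"
    proof -
      show "0 < d" "d \<le> \<eta>" "d \<le> \<rho>" using \<eta>(1) rho c r L by (auto simp: d_def)
      have "d \<le> c * r / (L + 1)" by (simp add: d_def)
      then have "d * (L + 1) \<le> c * r" using L by (simp add: pos_le_divide_eq)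
      then show "L * d \<le> c * r" using \<open>0 < d\<close> by (simp add: algebra_simps)
    qed
    show "\<forall>\<^sub>F x in at x0 within S. norm (f x - \<beta> * max ((x - x0) \<bullet> e) 0) \<le> c * norm (norm (x - x0))"
      unfolding eventually_at
    proof (intro exI[of _ d] conjI ballI impI)
      fix x assume x: "x \<in> S" "x \<noteq> x0 \<and> dist x x0 < d"
      then have xd: "norm (x - x0) < d" by (simp add: dist_norm)
      show "norm (f x - \<beta> * max ((x - x0) \<bullet> e) 0) \<le> c * norm (norm (x - x0))"
      proof (cases "0 \<le> (x - x0) \<bullet> e")
        case True
        have "c / 2 * norm (x - x0) \<le> c * norm (x - x0)" using c by (intro mult_right_mono) auto
        then show ?thesis using \<eta>(2)[of x] True xd d(2) by simp
      next
        case False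
        \<comment> \<open>A point of \<open>S\<close> below the hyperplane lies outside the ball,
          hence within |x - x0|^2 / (2 r) of the hyperplane. At its projection, of height 0,
          \<open>half\<close> bounds f by c / 2 |x - x0|, and Lipschitz continuity covers the way
          back.\<close>
        define x' where "x' = x - ((x - x0) \<bullet> e) *\<^sub>R e"
        have x'0: "x' - x0 = (x - x0) - ((x - x0) \<bullet> e) *\<^sub>R e" by (simp add: x'_def)
        have x': "norm (x' - x0) \<le> norm (x - x0)" "(x' - x0) \<bullet> e = 0"
          unfolding x'0 by (rule tangential)+
        have "\<bar>f x'\<bar> \<le> c / 2 * norm (x' - x0)" using \<eta>(2)[of x'] x' xd d(2) by simp
        also have "\<dots> \<le> c / 2 * norm (x - x0)" using x'(1) c by (intro mult_left_mono) auto
        finally have 1: "\<bar>f x'\<bar> \<le> c / 2 * norm (x - x0)" .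
        have "norm (x - x') = - ((x - x0) \<bullet> e)" using False e by (simp add: x'_def)
        also have "\<dots> \<le> (norm (x - x0))\<^sup>2 / (2 * r)" using outer x(1) ball by blast
        finally have "L * norm (x - x') \<le> L * ((norm (x - x0))\<^sup>2 / (2 * r))" using L by (intro mult_left_mono)
        also have "\<dots> = (L * norm (x - x0)) / (2 * r) * norm (x - x0)" by (simp add: power2_eq_square)
        also have "\<dots> \<le> c / 2 * norm (x - x0)"
        proof (rule mult_right_mono)
          have "L * norm (x - x0) \<le> L * d" using xd L by (intro mult_left_mono) auto
          then have "L * norm (x - x0) \<le> c * r" using d(4) by linarith
          then show "L * norm (x - x0) / (2 * r) \<le> c / 2" using r by (simp add: field_simps)
        qed simp
        finally have 2: "L * norm (x - x') \<le> c / 2 * norm (x - x0)" .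
        have "\<bar>f x - f x'\<bar> \<le> L * norm (x - x')" using xd d(3) x'(1) by (intro Lip) auto
        then have "\<bar>f x\<bar> \<le> c * norm (x - x0)" using 1 2 by linarith
        then show ?thesis using False by simp
      qed
    qed (rule d(1))
  qed
  moreover have "tangent_hyperplane_at (frontier S) x0 e" if "0 < \<beta>"
    unfolding tangent_hyperplane_at_def
  proof (rule landau_o.smallI)
    fix c :: real assume c: "0 < c"
    obtain \<eta> where \<eta>: "0 < \<eta>" "\<And>x. norm (x - x0) < \<eta> \<Longrightarrow> 0 \<le> (x - x0) \<bullet> e \<Longrightarrow>
        \<bar>f x - \<beta> * ((x - x0) \<bullet> e)\<bar> \<le> \<beta> * c * norm (x - x0)"
      using half[of "\<beta> * c"] c \<open>0 < \<beta>\<close> by auto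
    show "\<forall>\<^sub>F x in at x0 within frontier S. norm ((x - x0) \<bullet> e) \<le> c * norm (norm (x - x0))"
      unfolding eventually_at
    proof (intro exI[of _ "min \<eta> (2 * r * c)"] conjI ballI impI)
      fix x assume x: "x \<in> frontier S" "x \<noteq> x0 \<and> dist x x0 < min \<eta> (2 * r * c)"
      have xS: "x \<notin> S" using x(1) S by (simp add: frontier_def interior_open)
      show "norm ((x - x0) \<bullet> e) \<le> c * norm (norm (x - x0))"
      proof (cases "0 \<le> (x - x0) \<bullet> e")
        case True
        \<comment> \<open>Since f = 0 on the frontier, the expansion bounds \<beta> times the
          height; dividing by \<beta> > 0 gives tangency from above, and the exterior ball gives it
          from below.\<close>
        have "\<bar>\<beta> * ((x - x0) \<bullet> e)\<bar> \<le> \<beta> * c * norm (x - x0)"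
          using \<eta>(2)[of x] x(2) True zero[OF xS] by (simp add: dist_norm)
        then have "\<beta> * ((x - x0) \<bullet> e) \<le> \<beta> * (c * norm (x - x0))" by (simp add: mult.assoc)
        then show ?thesis using True \<open>0 < \<beta>\<close> by simp
      next
        case False
        have "x \<notin> ball (x0 - r *\<^sub>R e) r"
        proof
          assume "x \<in> ball (x0 - r *\<^sub>R e) r"
          then have "x \<in> interior (- S)" using ball by (meson interior_maximal open_ball subsetD)
          then show False using x(1) by (simp add: frontier_def interior_complement)
        qed
        from outer[OF this] have "\<bar>(x - x0) \<bullet> e\<bar> \<le> norm (x - x0) / (2 * r) * norm (x - x0)"
          using False by (simp add: power2_eq_square)
        also have "\<dots> \<le> c * norm (x - x0)"
          using x(2) r by (intro mult_right_mono) (auto simp: dist_norm field_simps)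
        finally show ?thesis by simp
      qed
    qed (use \<eta>(1) r c in simp)
  qed
  ultimately show ?thesis using \<beta> by blast
qed

theorem lemma5p1:
  fixes p\<^sub>0 \<rho> :: real and \<Omega> :: "'a::euclidean_space set" and u :: "'a \<Rightarrow> real" and x\<^sub>0 :: 'a
  assumes "1 < p\<^sub>0"
    and "open \<Omega>" and "connected \<Omega>"
    and "\<forall>x\<in>\<Omega>. 0 < u x"
    and "\<exists>L. L-lipschitz_on \<Omega> u"
    and "p_harmonic_on p\<^sub>0 \<Omega> u"
    and "x\<^sub>0 \<in> frontier \<Omega>"
    and "0 < \<rho>"
    and "vanishes_continuously \<Omega> (frontier \<Omega> \<inter> ball x\<^sub>0 \<rho>) u"
  shows "(\<forall>y r. 0 < r \<and> ball y r \<subseteq> \<Omega> \<and> x\<^sub>0 \<in> frontier (ball y r) \<longrightarrow>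
           (let \<nu> = (y - x\<^sub>0) /\<^sub>R norm (y - x\<^sub>0) in
            \<exists>\<alpha>>0. (\<lambda>x. u x - \<alpha> * max ((x - x\<^sub>0) \<bullet> \<nu>) 0)
                     \<in> o[at x\<^sub>0 within ball y r](\<lambda>x. norm (x - x\<^sub>0))))
       \<and> (\<forall>y r. 0 < r \<and> ball y r \<subseteq> - \<Omega> \<and> x\<^sub>0 \<in> frontier (ball y r) \<longrightarrow>
           (let \<nu> = (x\<^sub>0 - y) /\<^sub>R norm (x\<^sub>0 - y) in
            \<exists>\<beta>\<ge>0. (\<lambda>x. u x - \<beta> * max ((x - x\<^sub>0) \<bullet> \<nu>) 0)
                     \<in> o[at x\<^sub>0 within \<Omega>](\<lambda>x. norm (x - x\<^sub>0))
                 \<and> (0 < \<beta> \<longrightarrow> tangent_hyperplane_at (frontier \<Omega>) x\<^sub>0 \<nu>)))"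
proof -
  define f where "f x = (if x \<in> \<Omega> then u x else 0)" for x
  obtain L where lipu: "L-lipschitz_on \<Omega> u" using assms(5) by blast
  have lip: "L-lipschitz_on (ball x\<^sub>0 \<rho>) f"
    unfolding f_def[abs_def] by (rule extension_by_zero_lipschitz[OF assms(2) lipu assms(9)])
  have f_u: "f x = u x" if "x \<in> \<Omega>" for x using that by (simp add: f_def)
  have lip\<Omega>: "L-lipschitz_on \<Omega> f" using lipu by (simp add: f_u lipschitz_on_def)
  have harm: "p_harmonic_on p\<^sub>0 \<Omega> f"
    by (rule p_harmonic_on_cong[OF _ assms(6)]) (simp add: f_u)
  have zero: "f x = 0" if "x \<notin> \<Omega>" for x using that by (simp add: f_def)
  have f0: "f x\<^sub>0 = 0" using assms(2,7) by (intro zero) (simp add: frontier_def interior_open)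
  have pos: "0 < f x" if "x \<in> \<Omega>" for x using that assms(4) by (simp add: f_def)
  have nonneg: "0 \<le> f x" for x using assms(4) by (simp add: f_def less_imp_le)
  have cong: "(\<lambda>x. f x - c * max ((x - x\<^sub>0) \<bullet> e) 0) \<in> o[at x\<^sub>0 within T](\<lambda>x. norm (x - x\<^sub>0)) \<longleftrightarrow>
     (\<lambda>x. u x - c * max ((x - x\<^sub>0) \<bullet> e) 0) \<in> o[at x\<^sub>0 within T](\<lambda>x. norm (x - x\<^sub>0))"
    if "T \<subseteq> \<Omega>" for c e T
    using that by (intro landau_o.small.in_cong) (auto simp: eventually_at f_u subset_iff intro!: exI[of _ 1])
  show ?thesis
  proof (intro conjI allI impI; elim conjE)
    fix y r assume r: "0 < r" and ball: "ball y r \<subseteq> \<Omega>" and x0: "x\<^sub>0 \<in> frontier (ball y r)"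
    define \<nu> where "\<nu> = (y - x\<^sub>0) /\<^sub>R norm (y - x\<^sub>0)"
    have \<nu>: "norm \<nu> = 1" "y = x\<^sub>0 + r *\<^sub>R \<nu>"
      using frontier_ball_unit[OF r x0] by (simp_all add: \<nu>_def)
    from interior_ball_asymptotics[OF assms(1,2) harm lip\<Omega> assms(8) lip f0 pos nonneg r \<nu>(1)] ball
    have "\<exists>\<alpha>>0. (\<lambda>x. u x - \<alpha> * max ((x - x\<^sub>0) \<bullet> \<nu>) 0) \<in> o[at x\<^sub>0 within ball y r](\<lambda>x. norm (x - x\<^sub>0))"
      unfolding \<nu>(2)[symmetric] by (simp add: cong)
    then show "let \<nu> = (y - x\<^sub>0) /\<^sub>R norm (y - x\<^sub>0) in
        \<exists>\<alpha>>0. (\<lambda>x. u x - \<alpha> * max ((x - x\<^sub>0) \<bullet> \<nu>) 0) \<in> o[at x\<^sub>0 within ball y r](\<lambda>x. norm (x - x\<^sub>0))"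
      by (simp only: Let_def \<nu>_def)
  next
    fix y r assume r: "0 < r" and ball: "ball y r \<subseteq> - \<Omega>" and x0: "x\<^sub>0 \<in> frontier (ball y r)"
    define \<nu> where "\<nu> = (x\<^sub>0 - y) /\<^sub>R norm (x\<^sub>0 - y)"
    have neg: "(y - x\<^sub>0) /\<^sub>R norm (y - x\<^sub>0) = - \<nu>"
      by (simp add: \<nu>_def norm_minus_commute flip: scaleR_minus_right)
    have \<nu>: "norm \<nu> = 1" "y = x\<^sub>0 - r *\<^sub>R \<nu>"
      using frontier_ball_unit[OF r x0] unfolding neg by simp_all
    from exterior_ball_asymptotics[OF assms(1,2) harm lip\<Omega> assms(8) lip f0 nonneg zero r \<nu>(1)] ball
    have "\<exists>\<beta>\<ge>0. (\<lambda>x. u x - \<beta> * max ((x - x\<^sub>0) \<bullet> \<nu>) 0) \<in> o[at x\<^sub>0 within \<Omega>](\<lambda>x. norm (x - x\<^sub>0)) \<and>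
        (0 < \<beta> \<longrightarrow> tangent_hyperplane_at (frontier \<Omega>) x\<^sub>0 \<nu>)"
      unfolding \<nu>(2)[symmetric] by (simp add: cong)
    then show "let \<nu> = (x\<^sub>0 - y) /\<^sub>R norm (x\<^sub>0 - y) in
        \<exists>\<beta>\<ge>0. (\<lambda>x. u x - \<beta> * max ((x - x\<^sub>0) \<bullet> \<nu>) 0) \<in> o[at x\<^sub>0 within \<Omega>](\<lambda>x. norm (x - x\<^sub>0)) \<and>
          (0 < \<beta> \<longrightarrow> tangent_hyperplane_at (frontier \<Omega>) x\<^sub>0 \<nu>)"
      by (simp only: Let_def \<nu>_def)
  qed
qed

end
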